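(* Let $(q,r)$ be such that $$\frac1q\le\Big(\frac12-\Big(\frac14-\frac3{76}\Big)\Big)\Big(\frac12-\frac1r\Big),\qquad\text{and let}\quad \beta=\Big(\frac12-\frac1r\Big)-\frac1q .$$ There exist $C>0$ and $t_0>0$ such that the solution $v_h$ to $$ih\partial_t v_h-h^2\partial_x^2v_h+xv_h=0\ \text{ in } x>0,\qquad v_h|_{t=0}=v_0,\qquad v_h|_{x=0}=0,$$ satisfies the Strichartz bounds $$h^{\beta}\,\|\psi(hD_t)v_h\|_{L^q([-t_0,t_0],L^r(\mathbb R_+))}\le C\|v_0\|_{L^2(\mathbb R_+)},\qquad\forall\, v_0\in L^2(\mathbb R_+).$$
   Context: The space dimension is $d=1$. $h\in(0,1)$ is the semi-classical parameter; the constants $C,t_0$ do not depend on $h$ or $v_0$. $D_t=-i\partial_t$, and $\psi(hD_t)$ is a frequency cut-off in time, where $\psi\in C_0^\infty([\tfrac12,\tfrac32])$ and $0\le\psi\le1$. *)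

theory Defs
  imports "HOL-Analysis.Analysis" "HOL-Probability.Essential_Supremum"
begin

section \<open>Lebesgue norms with exponents in \<open>[1, \<infinity>]\<close>\<close>

text \<open>Norms take values in \<^typ>\<open>ennreal\<close>, so that mixed norms make sense without any
  integrability assumption; this requires real powers of extended nonnegative numbers.
  The exponent \<open>p\<close> below is only used with \<open>p > 0\<close>.\<close>

definition epowr :: "ennreal \<Rightarrow> real \<Rightarrow> ennreal" where
  "epowr a p = (if a = top then top else ennreal (enn2real a powr p))"

definition eLp_norm :: "'a measure \<Rightarrow> ennreal \<Rightarrow> ('a \<Rightarrow> ennreal) \<Rightarrow> ennreal" where
  "eLp_norm M p f =
     (if p = top then esssup M f
      else epowr (\<integral>\<^sup>+ x. epowr (f x) (enn2real p) \<partial>M) (1 / enn2real p))"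

definition Lp_norm :: "'a measure \<Rightarrow> ennreal \<Rightarrow> ('a \<Rightarrow> complex) \<Rightarrow> ennreal" where
  "Lp_norm M p f = eLp_norm M p (\<lambda>x. ennreal (norm (f x)))"

definition mixed_norm ::
    "'a measure \<Rightarrow> ennreal \<Rightarrow> 'b measure \<Rightarrow> ennreal \<Rightarrow> ('a \<Rightarrow> 'b \<Rightarrow> complex) \<Rightarrow> ennreal" where
  "mixed_norm M q N r f = eLp_norm M q (\<lambda>t. Lp_norm N r (f t))"

definition L2_functions :: "'a measure \<Rightarrow> ('a \<Rightarrow> complex) set" where
  "L2_functions M = {f \<in> borel_measurable M. Lp_norm M 2 f < top}"

definition half_line :: "real measure" where
  "half_line = restrict_space lborel {0<..}"


section \<open>Smooth compactly supported functions\<close>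

definition smooth_fun :: "(real \<Rightarrow> real) \<Rightarrow> bool" where
  "smooth_fun f \<longleftrightarrow> (\<forall>n x. (deriv ^^ n) f differentiable (at x))"

definition Cc_infinity :: "real set \<Rightarrow> (real \<Rightarrow> real) set" where
  "Cc_infinity K =
     {f. smooth_fun f \<and> compact (closure {x. f x \<noteq> 0}) \<and> closure {x. f x \<noteq> 0} \<subseteq> K}"


section \<open>Frequency cut-offs in time\<close>

text \<open>With \<open>D\<^sub>t = -\<i>\<partial>\<^sub>t\<close>, the operator \<open>m(D\<^sub>t)\<close> multiplies the Fourier transform
  (kernel \<open>e\<^bsup>-\<i>t\<tau>\<^esup>\<close>) by \<open>m\<close>. For \<open>m\<close> smooth with compact support its action on a function
  of polynomial growth, such as a bounded solution, is convolution with the Schwartz function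
  \<open>(2\<pi>)\<^bsup>-1\<^esup> \<integral> e\<^bsup>\<i>t\<tau>\<^esup> m(\<tau>) d\<tau>\<close>; in particular \<open>m(D\<^sub>t) e\<^bsup>\<i>\<lambda>t\<^esup> = m(\<lambda>) e\<^bsup>\<i>\<lambda>t\<^esup>\<close>.\<close>

definition fourier_multiplier :: "(real \<Rightarrow> real) \<Rightarrow> (real \<Rightarrow> complex) \<Rightarrow> real \<Rightarrow> complex" where
  "fourier_multiplier m f t =
     (\<integral>s. (1 / (2 * of_real pi) * (\<integral>\<tau>. exp (\<i> * of_real ((t - s) * \<tau>)) * of_real (m \<tau>) \<partial>lborel))
          * f s \<partial>lborel)"

definition time_cutoff ::
    "(real \<Rightarrow> real) \<Rightarrow> real \<Rightarrow> (real \<Rightarrow> real \<Rightarrow> complex) \<Rightarrow> real \<Rightarrow> real \<Rightarrow> complex" where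
  "time_cutoff \<psi> h v t x = fourier_multiplier (\<lambda>\<tau>. \<psi> (h * \<tau>)) (\<lambda>s. v s x) t"


section \<open>The Dirichlet problem on the half line\<close>

text \<open>Solutions with \<open>L\<^sup>2\<close> data are functions in \<open>C(\<real>, L\<^sup>2(\<real>\<^sub>+))\<close>, given by a jointly
  measurable representative \<open>v t x\<close>, that solve the problem weakly. For merely
  \<open>L\<^sup>2\<close> data the boundary trace cannot be evaluated pointwise in time, so
  the Dirichlet condition is imposed by transposition: the test functions are smooth up to the
  boundary and vanish at \<open>0\<close>, but their derivative at \<open>0\<close> is arbitrary. For \<open>v\<close> regular up to
  the boundary, integrating by parts twice in \<open>x\<close> leaves the boundary term \<open>v(t,0) \<phi>'(0)\<close>,
  so that the identity below holds for all such \<open>\<phi>\<close> iff the equation holds in \<open>x > 0\<close> and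
  \<open>v(t,0) = 0\<close>. These test functions form a core of the self-adjoint Dirichlet realization of
  \<open>-h\<^sup>2\<partial>\<^sub>x\<^sup>2 + x\<close>, hence the solution is unique (up to null sets).\<close>

definition dirichlet_solution ::
    "real \<Rightarrow> (real \<Rightarrow> complex) \<Rightarrow> (real \<Rightarrow> real \<Rightarrow> complex) \<Rightarrow> bool" where
  "dirichlet_solution h v0 v \<longleftrightarrow>
     (\<lambda>(t, x). v t x) \<in> borel_measurable (lborel \<Otimes>\<^sub>M half_line) \<and>
     (\<forall>t. v t \<in> L2_functions half_line) \<and>
     (\<forall>t. ((\<lambda>s. Lp_norm half_line 2 (\<lambda>x. v s x - v t x)) \<longlongrightarrow> 0) (at t)) \<and>
     (AE x in half_line. v 0 x = v0 x) \<and>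
     (\<forall>\<phi> \<in> Cc_infinity UNIV. \<phi> 0 = 0 \<longrightarrow>
       (\<forall>t. \<exists>d. ((\<lambda>s. \<integral>x. v s x * of_real (\<phi> x) \<partial>half_line) has_vector_derivative d) (at t) \<and>
         \<i> * of_real h * d - (of_real h)\<^sup>2 * (\<integral>x. v t x * of_real (deriv (deriv \<phi>) x) \<partial>half_line)
           + (\<integral>x. of_real x * v t x * of_real (\<phi> x) \<partial>half_line) = 0))"

end

theory Submission
  imports Defs "HOL-Probability.Sinc_Integral"
begin

text \<open>
  In one space dimension the estimate follows from an interaction Morawetz identity, without a
  parametrix. Let \<open>u = \<psi>(h D\<^sub>t) v\<close>, which solves \<open>i h u\<^sub>t = h\<^sup>2 u\<^sub>x\<^sub>x - x u\<close> with \<open>u = 0\<close> at \<open>x = 0\<close>, and put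
  \<open>\<rho> = \<bar>u\<bar>\<^sup>2\<close>, \<open>R(y) = \<integral>\<^sub>0\<^sup>y \<rho> dx\<close>, \<open>j = R\<^sub>t = 2 h Im (cnj u u\<^sub>x)\<close>, \<open>m = \<integral> \<rho> dx\<close>. Then \<open>m\<close> is constant in time and
  \<open>d/dt \<integral> R j dy = m\<^sup>2 - 2 h\<^sup>2 \<integral> (\<rho>\<^sub>x)\<^sup>2 dy\<close>.
  The boundary contributes nothing, because \<open>R\<close> and \<open>u\<close> vanish there, and the potential contributes
  only the bounded term \<open>m\<^sup>2\<close>, because it is linear. The frequency cut-off bounds \<open>u\<close>, \<open>h u\<^sub>t\<close> and hence, by the energy
  identity, \<open>h u\<^sub>x\<close> in \<open>L\<^sup>2\<close> by the data. So \<open>\<integral> R j\<close> is bounded, and integrating over \<open>[-1, 1]\<close> gives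
  \<open>h\<^sup>2 \<integral>\<integral> (\<rho>\<^sub>x)\<^sup>2 dx dt \<le> C \<parallel>v\<^sub>0\<parallel>\<^sup>4\<close>. As \<open>sup \<rho>\<^sup>3 \<le> 4 m \<integral> (\<rho>\<^sub>x)\<^sup>2\<close>, this is the Strichartz bound with
  \<open>(q, r) = (6, \<infinity>)\<close> and the loss-free power \<open>h\<^bsup>1/3\<^esup>\<close>. Together with \<open>sup \<rho> \<le> C \<parallel>v\<^sub>0\<parallel>\<^sup>2 / h\<close> and the \<open>L\<^sup>2\<close> bound,
  Hoelder's inequality yields every pair with \<open>1/q \<le> 1/3 (1/2 - 1/r)\<close>; the factor of the theorem is
  \<open>1/2 - (1/4 - 3/76) = 11/38 < 1/3\<close>. The identity is \<open>morawetz_identity\<close>, its integrated form \<open>morawetz_estimate\<close>, and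
  the interpolation \<open>mixed_norm_bound\<close>.

  The rest of the work is to justify the calculus for solutions that are merely continuous in
  time with values in \<open>L\<^sup>2\<close>. Let \<open>U\<^sub>n\<close> be the convolution of \<open>v\<close> in time with the \<open>n\<close>-th derivative of a
  kernel. For almost every \<open>x\<close> the \<open>U\<^sub>n\<close> are smooth in time with \<open>\<partial>\<^sub>t U\<^sub>n = U\<^bsub>n+1\<^esub>\<close>, and at every fixed time \<open>U\<^sub>n\<close> is a
  weak solution of \<open>h\<^sup>2 U\<^sub>n'' = x U\<^sub>n + i h U\<^bsub>n+1\<^esub>\<close>, which the du Bois-Reymond lemma turns into a classical
  one. Hence space derivatives are only ever taken at a fixed time and time derivatives only of integrals
  without space derivatives. The same averages, with kernels approximating the identity, show that the
  mass of \<open>v\<close> itself is conserved.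
\<close>


section \<open>Smooth compactly supported functions\<close>

lemma smooth_fun_iff_deriv:
  "smooth_fun f \<longleftrightarrow> (\<forall>x. f differentiable (at x)) \<and> smooth_fun (deriv f)"
proof
  assume f: "smooth_fun f"
  have "(deriv ^^ n) (deriv f) differentiable (at x)" for n x
    using f[unfolded smooth_fun_def, rule_format, of "Suc n" x] by (simp only: funpow_Suc_right o_apply)
  moreover have "f differentiable (at x)" for x
    using f[unfolded smooth_fun_def, rule_format, of 0 x] by simp
  ultimately show "(\<forall>x. f differentiable (at x)) \<and> smooth_fun (deriv f)"
    by (simp add: smooth_fun_def)
next
  assume f: "(\<forall>x. f differentiable (at x)) \<and> smooth_fun (deriv f)"
  show "smooth_fun f"
    unfolding smooth_fun_def
  proof (intro allI)
    fix n x
    show "(deriv ^^ n) f differentiable (at x)"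
    proof (cases n)
      case (Suc m)
      then show ?thesis
        using f by (simp only: smooth_fun_def funpow_Suc_right o_apply)
    qed (use f in simp)
  qed
qed

text \<open>Smoothness is a coinductive property: any class of functions closed under differentiation
  consists of smooth functions.\<close>

lemma smooth_fun_coinduct:
  assumes "P f" and "\<And>g. P g \<Longrightarrow> \<exists>g'. (\<forall>x. (g has_real_derivative g' x) (at x)) \<and> P g'"
  shows "smooth_fun f"
proof -
  have "(\<forall>x. g differentiable (at x)) \<and> P (deriv g)" if Pg: "P g" for g
  proof -
    obtain g' where g': "\<And>x. (g has_real_derivative g' x) (at x)" "P g'"
      using assms(2)[OF Pg] by blast
    have "deriv g = g'" using g'(1) DERIV_imp_deriv by blast
    then show ?thesis
      using g' real_differentiable_def by auto
  qed
  then have "P ((deriv ^^ n) f)" for n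
    using assms(1) by (induction n) auto
  then show ?thesis
    unfolding smooth_fun_def
    using \<open>\<And>g. P g \<Longrightarrow> (\<forall>x. g differentiable (at x)) \<and> P (deriv g)\<close> by blast
qed

lemma smooth_fun_has_derivative:
  assumes "smooth_fun f"
  shows "(f has_real_derivative deriv f x) (at x)"
  using assms smooth_fun_iff_deriv DERIV_deriv_iff_real_differentiable by blast

lemma smooth_fun_deriv: "smooth_fun f \<Longrightarrow> smooth_fun (deriv f)"
  using smooth_fun_iff_deriv by blast

lemma smooth_fun_continuous: "smooth_fun f \<Longrightarrow> continuous_on S f"
  by (meson smooth_fun_has_derivative DERIV_isCont continuous_at_imp_continuous_on)

lemma smooth_fun_antiderivative:
  assumes "smooth_fun f" "\<And>x. (F has_real_derivative f x) (at x)"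
  shows "smooth_fun F"
proof -
  have "deriv F = f" using assms(2) DERIV_imp_deriv by blast
  then show ?thesis
    using assms smooth_fun_iff_deriv[of F] real_differentiable_def by auto
qed

lemma smooth_fun_const: "smooth_fun (\<lambda>_. c)"
proof (rule smooth_fun_coinduct[where P = "\<lambda>f. \<exists>c. f = (\<lambda>_. c)"])
  show "\<exists>c'. (\<lambda>_. c) = (\<lambda>_. c')" by blast
  fix g :: "real \<Rightarrow> real" assume "\<exists>c. g = (\<lambda>_. c)"
  then obtain c where "g = (\<lambda>_. c)" by auto
  then show "\<exists>g'. (\<forall>x. (g has_real_derivative g' x) (at x)) \<and> (\<exists>c. g' = (\<lambda>_. c))"
    by (intro exI[of _ "\<lambda>_. 0"]) auto
qed

lemma smooth_fun_ident: "smooth_fun (\<lambda>x. x)"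
  by (rule smooth_fun_antiderivative[OF smooth_fun_const[of 1]]) auto

lemma smooth_fun_affine:
  assumes "smooth_fun f"
  shows "smooth_fun (\<lambda>x. f (a * x + b))"
proof (rule smooth_fun_coinduct[where P = "\<lambda>g. \<exists>c f. smooth_fun f \<and> g = (\<lambda>x. c * f (a * x + b))"])
  show "\<exists>c fa. smooth_fun fa \<and> (\<lambda>x. f (a * x + b)) = (\<lambda>x. c * fa (a * x + b))"
    by (rule exI[of _ 1], rule exI[of _ f]) (use assms in auto)
  fix g :: "real \<Rightarrow> real" assume "\<exists>c f. smooth_fun f \<and> g = (\<lambda>x. c * f (a * x + b))"
  then obtain c f where f: "smooth_fun f" and g: "g = (\<lambda>x. c * f (a * x + b))" by auto
  have "((\<lambda>x. c * f (a * x + b)) has_real_derivative (c * a) * deriv f (a * x + b)) (at x)" for x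
  proof -
    have "((\<lambda>x. a * x + b) has_real_derivative a) (at x)"
      by (auto intro!: derivative_eq_intros)
    from DERIV_chain2[OF smooth_fun_has_derivative[OF f] this]
    have "((\<lambda>x. f (a * x + b)) has_real_derivative deriv f (a * x + b) * a) (at x)" .
    from DERIV_cmult[OF this, of c] show ?thesis by (simp add: mult_ac)
  qed
  then show "\<exists>g'. (\<forall>x. (g has_real_derivative g' x) (at x)) \<and>
      (\<exists>c f. smooth_fun f \<and> g' = (\<lambda>x. c * f (a * x + b)))"
    using g smooth_fun_deriv[OF f]
    by (intro exI[of _ "\<lambda>x. c * a * deriv f (a * x + b)"] exI[of _ "c * a"]
        exI[of _ "deriv f"] conjI allI) simp_all
qed

text \<open>Products alone are not closed under differentiation, but finite sums of products are; hence
  the detour through lists, from which products and sums are read off.\<close>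

lemma smooth_fun_mult_list:
  assumes "\<forall>p\<in>set ps. smooth_fun (fst p) \<and> smooth_fun (snd p)"
  shows "smooth_fun (\<lambda>x. \<Sum>p\<leftarrow>ps. fst p x * snd p x)"
proof (rule smooth_fun_coinduct[where P = "\<lambda>g. \<exists>ps. (\<forall>p\<in>set ps. smooth_fun (fst p) \<and> smooth_fun (snd p))
      \<and> g = (\<lambda>x. \<Sum>p\<leftarrow>ps. fst p x * snd p x)"], goal_cases)
  case 1
  then show ?case using assms by blast
next
  case (2 g)
  then obtain ps where ps: "\<forall>p\<in>set ps. smooth_fun (fst p) \<and> smooth_fun (snd p)"
    and g: "g = (\<lambda>x. \<Sum>p\<leftarrow>ps. fst p x * snd p x)" by auto
  define qs where "qs = map (\<lambda>p. (deriv (fst p), snd p)) ps @ map (\<lambda>p. (fst p, deriv (snd p))) ps"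
  have "(g has_real_derivative (\<Sum>p\<leftarrow>qs. fst p x * snd p x)) (at x)" for x
    using ps unfolding g qs_def
  proof (induction ps)
    case (Cons p ps)
    have "((\<lambda>x. fst p x * snd p x) has_real_derivative
        deriv (fst p) x * snd p x + deriv (snd p) x * fst p x) (at x)"
      using Cons.prems by (intro DERIV_mult smooth_fun_has_derivative) auto
    from DERIV_add[OF this Cons.IH] Cons.prems show ?case
      by (simp add: algebra_simps)
  qed simp
  moreover have "\<forall>p\<in>set qs. smooth_fun (fst p) \<and> smooth_fun (snd p)"
    using ps smooth_fun_deriv by (auto simp: qs_def)
  ultimately show ?case
    by (intro exI[of _ "\<lambda>x. \<Sum>p\<leftarrow>qs. fst p x * snd p x"] conjI allI exI[of _ qs] refl)
qed

lemma smooth_fun_mult: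
  assumes "smooth_fun f" "smooth_fun g"
  shows "smooth_fun (\<lambda>x. f x * g x)"
  using smooth_fun_mult_list[of "[(f, g)]"] assms by simp

lemma smooth_fun_add:
  assumes "smooth_fun f" "smooth_fun g"
  shows "smooth_fun (\<lambda>x. f x + g x)"
  using smooth_fun_mult_list[of "[(f, \<lambda>_. 1), (g, \<lambda>_. 1)]"] assms smooth_fun_const by simp

lemma smooth_fun_cmult: "smooth_fun f \<Longrightarrow> smooth_fun (\<lambda>x. c * f x)"
  using smooth_fun_mult smooth_fun_const by blast

lemma smooth_fun_diff:
  assumes "smooth_fun f" "smooth_fun g"
  shows "smooth_fun (\<lambda>x. f x - g x)"
  using smooth_fun_add[OF assms(1) smooth_fun_cmult[OF assms(2), of "-1"]] by simp

lemma Cc_infinityI: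
  assumes "smooth_fun f" "\<And>x. f x \<noteq> 0 \<Longrightarrow> a \<le> x \<and> x \<le> b"
  shows "f \<in> Cc_infinity UNIV"
proof -
  have "closure {x. f x \<noteq> 0} \<subseteq> {a..b}"
    by (rule closure_minimal) (use assms in auto)
  then show ?thesis
    using assms(1) compact_Icc[of a b] closed_closure[of "{x. f x \<noteq> 0}"]
      compact_Int_closed[of "{a..b}" "closure {x. f x \<noteq> 0}"]
    unfolding Cc_infinity_def by (simp add: Int_absorb1)
qed

lemma Cc_infinityE:
  assumes "f \<in> Cc_infinity K"
  obtains B where "smooth_fun f" "B > 0" "\<And>x. \<bar>x\<bar> \<ge> B \<Longrightarrow> f x = 0"
proof -
  have f: "smooth_fun f" and "bounded (closure {x. f x \<noteq> 0})"
    using assms by (auto simp: Cc_infinity_def compact_imp_bounded)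
  then obtain B where B: "\<And>x. x \<in> closure {x. f x \<noteq> 0} \<Longrightarrow> norm x \<le> B"
    by (auto simp: bounded_iff)
  have "f x = 0" if x: "\<bar>x\<bar> \<ge> \<bar>B\<bar> + 1" for x
  proof (rule ccontr)
    assume "f x \<noteq> 0"
    then have "x \<in> closure {x. f x \<noteq> 0}" by (intro subsetD[OF closure_subset]) simp
    from B[OF this] x show False by simp
  qed
  then show thesis
    using f by (intro that[of "\<bar>B\<bar> + 1"]) simp_all
qed

lemma continuous_antiderivative:
  fixes f :: "real \<Rightarrow> real"
  assumes "continuous_on UNIV f"
  obtains F where "\<And>x. (F has_real_derivative f x) (at x)"
proof -
  define F where "F x = (LBINT y=ereal 0..ereal x. f y)" for x
  have "(F has_real_derivative f x) (at x)" for x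
  proof -
    have "((\<lambda>x. LBINT y=ereal 0..ereal x. f y) has_vector_derivative f x) (at x within {-\<bar>x\<bar>-1..\<bar>x\<bar>+1})"
      by (rule interval_integral_FTC2) (use assms in \<open>auto intro: continuous_on_subset\<close>)
    then have "(F has_vector_derivative f x) (at x)"
      unfolding F_def[abs_def] by (subst (asm) at_within_Icc_at) auto
    then show ?thesis by (simp add: has_real_derivative_iff_has_vector_derivative)
  qed
  then show thesis by (rule that)
qed

text \<open>A single nonzero, nonnegative bump already provides a smooth step: normalize its primitive.
  The cut-off of the theorem itself will serve as the bump.\<close>

lemma smooth_step_exists:
  assumes "b \<in> Cc_infinity K" "\<And>x. 0 \<le> b x" "b x0 \<noteq> 0"
  obtains \<theta> where "smooth_fun \<theta>" "\<And>x. 0 \<le> \<theta> x" "\<And>x. \<theta> x \<le> 1"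
    "\<And>x. x \<le> 0 \<Longrightarrow> \<theta> x = 0" "\<And>x. 1 \<le> x \<Longrightarrow> \<theta> x = 1"
proof -
  obtain B where b: "smooth_fun b" and B: "B > 0" "\<And>x. \<bar>x\<bar> \<ge> B \<Longrightarrow> b x = 0"
    using Cc_infinityE[OF assms(1)] by metis
  obtain F where F: "\<And>x. (F has_real_derivative b x) (at x)"
    using continuous_antiderivative smooth_fun_continuous[OF b] by blast
  have sF: "smooth_fun F" by (rule smooth_fun_antiderivative[OF b F])
  have mono: "F x \<le> F y" if "x \<le> y" for x y
    by (rule DERIV_nonneg_imp_nondecreasing[OF that]) (use F assms(2) in blast)
  have left: "F x = F (-B)" if "x \<le> -B" for x
  proof -
    have "(F has_real_derivative 0) (at x within {..-B})" if "x \<in> {..-B}" for x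
    proof -
      have "b x = 0" using B that by (intro B(2)) auto
      then show ?thesis using has_field_derivative_at_within[OF F[of x]] by simp
    qed
    then have "\<exists>c. \<forall>x\<in>{..-B}. F x = c"
      by (intro has_field_derivative_zero_constant) auto
    then show ?thesis using that by force
  qed
  have right: "F x = F B" if "x \<ge> B" for x
  proof -
    have "(F has_real_derivative 0) (at x within {B..})" if "x \<in> {B..}" for x
    proof -
      have "b x = 0" using B that by (intro B(2)) auto
      then show ?thesis using has_field_derivative_at_within[OF F[of x]] by simp
    qed
    then have "\<exists>c. \<forall>x\<in>{B..}. F x = c"
      by (intro has_field_derivative_zero_constant) auto
    then show ?thesis using that by force
  qed
  have "F (-B) < F B"
  proof (rule ccontr)
    assume "\<not> F (-B) < F B"
    then have c: "F x = F B" if "-B \<le> x" "x \<le> B" for x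
      using mono[of "-B" x] mono[of x B] that by linarith
    have "F x = F B" for x
      using c[of x] c[of "-B"] left[of x] right[of x] B(1) by linarith
    then have "F = (\<lambda>_. F B)" by blast
    then have "(F has_real_derivative 0) (at x0)"
      using DERIV_const[of "F B" "at x0"] by simp
    then show False using F[of x0] assms(3) DERIV_unique by blast
  qed
  define D where "D = F B - F (-B)"
  have D: "D > 0" using \<open>F (-B) < F B\<close> by (simp add: D_def)
  define \<theta> where "\<theta> x = (1/D) * (F (2 * B * x + (-B)) - F (-B))" for x
  have "smooth_fun \<theta>"
    unfolding \<theta>_def[abs_def]
    by (intro smooth_fun_cmult smooth_fun_diff smooth_fun_const smooth_fun_affine sF)
  moreover have "0 \<le> \<theta> x" for x
    using D left[of "2 * B * x + (-B)"] mono[of "-B" "2 * B * x + (-B)"]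
    by (cases "2 * B * x + (-B) \<le> -B") (auto simp: \<theta>_def)
  moreover have "\<theta> x \<le> 1" for x
    using D right[of "2 * B * x + (-B)"] mono[of "2 * B * x + (-B)" B]
    by (cases "2 * B * x + (-B) \<ge> B") (auto simp: \<theta>_def D_def)
  moreover have "\<theta> x = 0" if "x \<le> 0" for x
    using B left[of "2 * B * x + (-B)"] that by (auto simp: \<theta>_def mult_le_0_iff)
  moreover have "\<theta> x = 1" if "x \<ge> 1" for x
    using B D right[of "2 * B * x + (-B)"] that by (auto simp: \<theta>_def D_def)
  ultimately show thesis by (rule that)
qed


section \<open>Integration on the half-line\<close>

lemma space_half_line: "space half_line = {0<..}"
  by (simp add: half_line_def space_restrict_space)

lemma sets_half_line: "sets half_line = sets (restrict_space borel {0<..})"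
  by (simp add: half_line_def sets_restrict_space)

lemma sigma_finite_half_line: "sigma_finite_measure half_line"
  unfolding half_line_def
  by (rule sigma_finite_measure_restrict_space) (auto simp: sigma_finite_lborel)

interpretation half_line: sigma_finite_measure half_line
  by (rule sigma_finite_half_line)

interpretation lborel_half_line: pair_sigma_finite lborel half_line ..

lemma half_line_integral_eq:
  fixes f :: "real \<Rightarrow> 'a::{banach, second_countable_topology}"
  shows "(LINT x|half_line. f x) = (LINT x:{0<..}|lborel. f x)"
  by (simp add: half_line_def integral_restrict_space set_lebesgue_integral_def)

lemma half_line_integrable_iff:
  fixes f :: "real \<Rightarrow> 'a::{banach, second_countable_topology}"
  shows "integrable half_line f \<longleftrightarrow> set_integrable lborel {0<..} f"
  by (simp add: half_line_def integrable_restrict_space set_integrable_def)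

lemma borel_measurable_half_lineI:
  "f \<in> borel_measurable borel \<Longrightarrow> f \<in> borel_measurable half_line"
  by (simp add: half_line_def measurable_restrict_space1)

lemma borel_measurable_half_line_continuous:
  fixes f :: "real \<Rightarrow> 'a::topological_space"
  assumes "continuous_on {0..} f"
  shows "f \<in> borel_measurable half_line"
proof -
  have "f \<in> borel_measurable (restrict_space borel {0<..})"
    by (rule borel_measurable_continuous_on_restrict) (rule continuous_on_subset[OF assms], auto)
  then show ?thesis
    by (subst measurable_cong_sets[OF sets_half_line refl])
qed

lemma AE_half_line: "(AE x in half_line. P x) \<longleftrightarrow> (AE x in lborel. 0 < x \<longrightarrow> P x)"
  unfolding half_line_def by (subst AE_restrict_space_iff) auto

lemma half_line_truncated_eq:
  fixes f :: "real \<Rightarrow> 'a::{banach, second_countable_topology}"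
  shows "(LINT x|half_line. indicator {..y} x *\<^sub>R f x) = (LINT x:{0<..y}|lborel. f x)"
    and "integrable half_line (\<lambda>x. indicator {..y} x *\<^sub>R f x) \<longleftrightarrow> set_integrable lborel {0<..y} f"
proof -
  have *: "indicat_real {0<..} x *\<^sub>R (indicat_real {..y} x *\<^sub>R f x) = indicat_real {0<..y} x *\<^sub>R f x" for x
    by (auto split: split_indicator)
  show "(LINT x|half_line. indicator {..y} x *\<^sub>R f x) = (LINT x:{0<..y}|lborel. f x)"
    unfolding half_line_integral_eq set_lebesgue_integral_def * ..
  show "integrable half_line (\<lambda>x. indicator {..y} x *\<^sub>R f x) \<longleftrightarrow> set_integrable lborel {0<..y} f"
    unfolding half_line_integrable_iff set_integrable_def * ..
qed

lemma half_line_truncated_integral: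
  fixes f :: "real \<Rightarrow> 'a::euclidean_space"
  assumes "integrable half_line (\<lambda>x. indicator {..y} x *\<^sub>R f x)"
  shows "f integrable_on {0..y}"
    and "(LINT x|half_line. indicator {..y} x *\<^sub>R f x) = integral {0..y} f"
proof -
  have s: "set_integrable lborel {0<..y} f"
    using assms half_line_truncated_eq(2) by blast
  have neg: "negligible ({0..y} - {0<..y} \<union> ({0<..y} - {0..y}))"
    by (rule negligible_subset[of "{0}"]) auto
  have i: "f integrable_on {0<..y}" and e: "set_lebesgue_integral lborel {0<..y} f = integral {0<..y} f"
    using set_borel_integral_eq_integral[OF s] by auto
  show "f integrable_on {0..y}"
    using i neg by (subst integrable_spike_set_eq[of _ "{0<..y}"]) (auto simp: Un_commute)
  show "(LINT x|half_line. indicator {..y} x *\<^sub>R f x) = integral {0..y} f"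
    unfolding half_line_truncated_eq(1) e
    by (rule integral_spike_set; rule negligible_subset[of "{0}"]) auto
qed

lemma half_line_truncated_continuous:
  fixes f :: "real \<Rightarrow> 'a::euclidean_space"
  assumes "continuous_on {0..y} f"
  shows "integrable half_line (\<lambda>x. indicator {..y} x *\<^sub>R f x)"
proof -
  have "set_integrable lborel {0..y} f"
    using assms by (rule borel_integrable_compact[OF compact_Icc, folded set_integrable_def])
  then have "set_integrable lborel {0<..y} f"
    by (rule set_integrable_subset) auto
  then show ?thesis using half_line_truncated_eq(2) by blast
qed

lemma half_line_truncated_FTC:
  fixes f :: "real \<Rightarrow> 'a::euclidean_space"
  assumes "0 \<le> y" "continuous_on {0..y} f"
    and "\<And>x. 0 \<le> x \<Longrightarrow> (F has_vector_derivative f x) (at x within {0..})"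
  shows "(LINT x|half_line. indicator {..y} x *\<^sub>R f x) = F y - F 0"
proof -
  have "(f has_integral (F y - F 0)) {0..y}"
    by (rule fundamental_theorem_of_calculus)
       (use assms(1) in \<open>auto intro: has_vector_derivative_within_subset[OF assms(3)]\<close>)
  then show ?thesis
    using half_line_truncated_integral(2)[OF half_line_truncated_continuous[OF assms(2)]]
    by (simp add: integral_unique)
qed

text \<open>A nonzero limit would dominate a positive constant near infinity. This turns integrability
  into the vanishing of boundary terms at infinity.\<close>

lemma half_line_integrable_limit_zero:
  fixes F :: "real \<Rightarrow> 'a::{banach, second_countable_topology}"
  assumes "integrable half_line F" "(F \<longlongrightarrow> L) at_top"
  shows "L = 0"
proof (rule ccontr)
  assume "L \<noteq> 0"
  define c where "c = norm L / 2"
  have c: "c > 0" "c < norm L" using \<open>L \<noteq> 0\<close> by (auto simp: c_def)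
  have "((\<lambda>x. norm (F x)) \<longlongrightarrow> norm L) at_top" using assms(2) by (rule tendsto_norm)
  then have "eventually (\<lambda>x. c < norm (F x)) at_top" using c(2) order_tendstoD(1) by blast
  then obtain X where X: "\<And>x. x \<ge> X \<Longrightarrow> c < norm (F x)"
    unfolding eventually_at_top_linorder by auto
  define Y where "Y = max X 1"
  have fin: "(\<integral>\<^sup>+x. ennreal (norm (F x)) \<partial>half_line) < \<infinity>"
    using assms(1) by (simp add: integrable_iff_bounded)
  have "ennreal c * emeasure lborel {Y..Y + real n} \<le> (\<integral>\<^sup>+x. ennreal (norm (F x)) \<partial>half_line)" for n
  proof -
    have "ennreal c * emeasure lborel {Y..Y + real n} = (\<integral>\<^sup>+x. ennreal c * indicator {Y..Y + real n} x \<partial>lborel)"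
      by (simp add: nn_integral_cmult_indicator)
    also have "\<dots> \<le> (\<integral>\<^sup>+x. ennreal (norm (F x)) * indicator {0<..} x \<partial>lborel)"
      by (rule nn_integral_mono)
         (use X in \<open>auto simp: Y_def less_imp_le split: split_indicator intro!: ennreal_leI\<close>)
    also have "\<dots> = (\<integral>\<^sup>+x. ennreal (norm (F x)) \<partial>half_line)"
      by (simp add: half_line_def nn_integral_restrict_space)
    finally show ?thesis .
  qed
  then have *: "ennreal (c * real n) \<le> (\<integral>\<^sup>+x. ennreal (norm (F x)) \<partial>half_line)" for n
    using c by (simp add: ennreal_mult'')
  obtain K where K: "(\<integral>\<^sup>+x. ennreal (norm (F x)) \<partial>half_line) = ennreal K" "K \<ge> 0"
    using fin by (cases "\<integral>\<^sup>+x. ennreal (norm (F x)) \<partial>half_line") auto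
  obtain n where "K / c < real n" using reals_Archimedean2 by blast
  then have "K < c * real n" using c by (simp add: field_simps)
  then show False using *[of n] K c by (simp add: ennreal_le_iff)
qed

lemma half_line_truncated_tendsto:
  fixes f :: "real \<Rightarrow> 'a::{banach, second_countable_topology}"
  assumes "integrable half_line f"
  shows "((\<lambda>y. LINT x|half_line. indicator {..y} x *\<^sub>R f x) \<longlongrightarrow> (LINT x|half_line. f x)) at_top"
proof (rule integral_dominated_convergence_at_top[where w = "\<lambda>x. norm (f x)"])
  have [measurable]: "f \<in> borel_measurable half_line" using assms by auto
  show "f \<in> borel_measurable half_line" by simp
  have [measurable]: "indicat_real {..t} \<in> borel_measurable half_line" for t
    by (rule borel_measurable_half_lineI) simp
  show "(\<lambda>x. indicat_real {..t} x *\<^sub>R f x) \<in> borel_measurable half_line" for t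
    by measurable
  show "integrable half_line (\<lambda>x. norm (f x))" using assms by simp
  show "AE x in half_line. ((\<lambda>t. indicat_real {..t} x *\<^sub>R f x) \<longlongrightarrow> f x) at_top"
  proof (rule AE_I2)
    fix x
    show "((\<lambda>t. indicat_real {..t} x *\<^sub>R f x) \<longlongrightarrow> f x) at_top"
      by (rule tendsto_eventually)
         (rule eventually_mono[OF eventually_ge_at_top[of x]], simp)
  qed
  show "\<forall>\<^sub>F t in at_top. AE x in half_line. norm (indicat_real {..t} x *\<^sub>R f x) \<le> norm (f x)"
    by (auto split: split_indicator)
qed

text \<open>Integrability of \<open>F\<close> and of its derivative replaces a decay condition: \<open>F\<close> has a limit at
  infinity, which must be zero. Applied to products, this is integration by parts.\<close>

lemma half_line_integral_derivative:
  fixes f :: "real \<Rightarrow> 'a::euclidean_space"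
  assumes "\<And>x. 0 \<le> x \<Longrightarrow> (F has_vector_derivative f x) (at x within {0..})"
    and "continuous_on {0..} f" "integrable half_line F" "integrable half_line f"
  shows "(LINT x|half_line. f x) = - F 0"
proof -
  have "((\<lambda>y. LINT x|half_line. indicator {..y} x *\<^sub>R f x) \<longlongrightarrow> (LINT x|half_line. f x)) at_top"
    by (rule half_line_truncated_tendsto) fact
  moreover have "eventually (\<lambda>y. (LINT x|half_line. indicator {..y} x *\<^sub>R f x) = F y - F 0) at_top"
    using eventually_ge_at_top[of 0]
  proof eventually_elim
    case (elim y)
    have "continuous_on {0..y} f" by (rule continuous_on_subset[OF assms(2)]) auto
    then show ?case using half_line_truncated_FTC[OF elim _ assms(1)] by blast
  qed
  ultimately have "((\<lambda>y. F y - F 0) \<longlongrightarrow> (LINT x|half_line. f x)) at_top"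
    by (rule Lim_transform_eventually)
  from tendsto_add[OF this tendsto_const[of "F 0"]]
  have "(F \<longlongrightarrow> (LINT x|half_line. f x) + F 0) at_top" by simp
  then have "(LINT x|half_line. f x) + F 0 = 0"
    by (rule half_line_integrable_limit_zero[OF assms(3)])
  then show ?thesis by (simp add: eq_neg_iff_add_eq_0)
qed

text \<open>The same on the whole line, by splitting at the origin and reflecting the negative half.\<close>

lemma integral_derivative_eq_0:
  fixes f :: "real \<Rightarrow> 'a::euclidean_space"
  assumes F: "\<And>x. (F has_vector_derivative f x) (at x)"
    and f: "continuous_on UNIV f" and int: "integrable lborel F" "integrable lborel f"
  shows "(LINT x|lborel. f x) = 0"
proof -
  have refl_int: "integrable lborel (\<lambda>x. g (-x))" if "integrable lborel g" for g :: "real \<Rightarrow> 'a"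
    using lborel_integrable_real_affine[OF that, of "-1" 0] by simp
  have hl: "integrable half_line g" if "integrable lborel g" for g :: "real \<Rightarrow> 'a"
    unfolding half_line_integrable_iff set_integrable_def
    by (rule integrable_mult_indicator) (use that in auto)
  have "(LINT x|half_line. f x) = - F 0"
    by (rule half_line_integral_derivative[OF has_vector_derivative_at_within[OF F]
          continuous_on_subset[OF f] hl[OF int(1)] hl[OF int(2)]]) auto
  moreover have "(LINT x|half_line. f (-x)) = - (- F (-0))"
  proof (rule half_line_integral_derivative)
    show "((\<lambda>x. - F (-x)) has_vector_derivative f (-x)) (at x within {0..})" for x
    proof -
      have "((\<lambda>x. F (-x)) has_vector_derivative (-1) *\<^sub>R f (-x)) (at x within {0..})"
      proof -
        have "((\<lambda>x. - x) has_real_derivative -1) (at x within {0..})"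
          by (auto intro!: derivative_eq_intros)
        from vector_diff_chain_within[OF this[unfolded has_real_derivative_iff_has_vector_derivative]
            has_vector_derivative_at_within[OF F[of "-x"]]]
        show ?thesis by (simp add: o_def)
      qed
      from has_vector_derivative_minus[OF this] show ?thesis by simp
    qed
    show "continuous_on {0..} (\<lambda>x. f (-x))"
      by (rule continuous_on_compose2[OF f]) (auto intro!: continuous_intros)
    show "integrable half_line (\<lambda>x. - F (-x))"
      using hl[OF refl_int[OF int(1)]] by simp
    show "integrable half_line (\<lambda>x. f (-x))"
      using hl[OF refl_int[OF int(2)]] .
  qed
  moreover have "(LINT x|half_line. f (-x)) = (LINT x:{..<0}|lborel. f x)"
  proof -
    have "(LINT x:{..<0}|lborel. f x) = (LINT x|lborel. indicator {..<0} (-x) *\<^sub>R f (-x))"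
      unfolding set_lebesgue_integral_def
      using lborel_integral_real_affine[of "-1" "\<lambda>x. indicat_real {..<0} x *\<^sub>R f x" 0] by simp
    also have "\<dots> = (LINT x|half_line. f (-x))"
      unfolding half_line_integral_eq set_lebesgue_integral_def
      by (intro Bochner_Integration.integral_cong) (auto split: split_indicator)
    finally show ?thesis ..
  qed
  moreover have "(LINT x|lborel. f x) = (LINT x:{0<..}|lborel. f x) + (LINT x:{..<0}|lborel. f x)"
  proof -
    have s: "set_integrable lborel A f" if "A \<in> sets borel" for A
      unfolding set_integrable_def by (rule integrable_mult_indicator) (use that int in auto)
    have "(LINT x:({0<..} \<union> {..<0})|lborel. f x) = (LINT x:{0<..}|lborel. f x) + (LINT x:{..<0}|lborel. f x)"
      by (rule set_integral_Un) (auto intro: s)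
    moreover have "(LINT x:({0<..} \<union> {..<0})|lborel. f x) = (LINT x|lborel. f x)"
      unfolding set_lebesgue_integral_def
    proof (rule integral_cong_AE)
      show "AE x in lborel. indicat_real ({0<..} \<union> {..<0}) x *\<^sub>R f x = f x"
        using AE_lborel_singleton[of 0] by eventually_elim (auto split: split_indicator)
    qed (use int in auto)
    ultimately show ?thesis by simp
  qed
  ultimately show ?thesis using half_line_integral_eq[of f] by simp
qed

text \<open>Integrate \<open>0 \<le> (s\<bar>f\<bar> - \<bar>g\<bar>)\<^sup>2\<close> and optimize in \<open>s\<close>.\<close>

lemma Cauchy_Schwarz_integral:
  fixes f g :: "'a \<Rightarrow> real"
  assumes [measurable]: "f \<in> borel_measurable M" "g \<in> borel_measurable M"
    and f: "integrable M (\<lambda>x. (f x)\<^sup>2)" and g: "integrable M (\<lambda>x. (g x)\<^sup>2)"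
  shows "integrable M (\<lambda>x. f x * g x)"
    and "(LINT x|M. \<bar>f x * g x\<bar>)\<^sup>2 \<le> (LINT x|M. (f x)\<^sup>2) * (LINT x|M. (g x)\<^sup>2)"
proof -
  show i: "integrable M (\<lambda>x. f x * g x)"
  proof (rule Bochner_Integration.integrable_bound)
    show "integrable M (\<lambda>x. (f x)\<^sup>2 + (g x)\<^sup>2)" using f g by simp
    show "AE x in M. norm (f x * g x) \<le> norm ((f x)\<^sup>2 + (g x)\<^sup>2)"
    proof (rule AE_I2)
      fix x
      have "2 * (\<bar>f x\<bar> * \<bar>g x\<bar>) \<le> (f x)\<^sup>2 + (g x)\<^sup>2"
        using sum_squares_bound[of "\<bar>f x\<bar>" "\<bar>g x\<bar>"] by simp
      moreover have "0 \<le> \<bar>f x\<bar> * \<bar>g x\<bar>" by simp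
      ultimately have "\<bar>f x\<bar> * \<bar>g x\<bar> \<le> (f x)\<^sup>2 + (g x)\<^sup>2" by linarith
      then show "norm (f x * g x) \<le> norm ((f x)\<^sup>2 + (g x)\<^sup>2)"
        unfolding real_norm_def abs_mult by (simp add: sum_power2_ge_zero)
    qed
  qed measurable
  define A B C where "A = (LINT x|M. (f x)\<^sup>2)" and "B = (LINT x|M. \<bar>f x * g x\<bar>)"
    and "C = (LINT x|M. (g x)\<^sup>2)"
  have B0: "B \<ge> 0" and A0: "A \<ge> 0" and C0: "C \<ge> 0"
    unfolding A_def B_def C_def by (auto intro!: integral_nonneg_AE)
  have key: "2 * s * B \<le> s\<^sup>2 * A + C" for s
  proof -
    have "(LINT x|M. 2 * s * \<bar>f x * g x\<bar>) \<le> (LINT x|M. s\<^sup>2 * (f x)\<^sup>2 + (g x)\<^sup>2)"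
    proof (rule integral_mono)
      fix x
      have "0 \<le> (s * \<bar>f x\<bar> - \<bar>g x\<bar>)\<^sup>2" by simp
      then show "2 * s * \<bar>f x * g x\<bar> \<le> s\<^sup>2 * (f x)\<^sup>2 + (g x)\<^sup>2"
        by (simp add: power2_diff power_mult_distrib abs_mult mult_ac)
    qed (use i f g in auto)
    then show ?thesis
      using i f g unfolding A_def B_def C_def by simp
  qed
  have "B\<^sup>2 \<le> A * C"
  proof (cases "A = 0")
    case True
    have "B = 0"
    proof (rule ccontr)
      assume "B \<noteq> 0"
      then have "2 * ((C + 1) / (2 * B)) * B = C + 1" by simp
      then show False using key[of "(C + 1) / (2 * B)"] True by simp
    qed
    then show ?thesis using True by simp
  next
    case False
    then have "A > 0" using A0 by simp
    have "2 * (B / A) * B \<le> (B / A)\<^sup>2 * A + C" by (rule key)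
    then have "B\<^sup>2 / A \<le> C"
      using \<open>A > 0\<close> by (simp add: power2_eq_square field_simps)
    then show ?thesis using \<open>A > 0\<close> by (simp add: field_simps)
  qed
  then show "(LINT x|M. \<bar>f x * g x\<bar>)\<^sup>2 \<le> (LINT x|M. (f x)\<^sup>2) * (LINT x|M. (g x)\<^sup>2)"
    by (simp add: A_def B_def C_def)
qed

lemma has_vector_derivative_iff_quotient:
  "(f has_vector_derivative D) (at t within S) \<longleftrightarrow>
    ((\<lambda>s. (f s - f t) /\<^sub>R (s - t)) \<longlongrightarrow> D) (at t within S)"
proof -
  have "(f has_vector_derivative D) (at t within S) \<longleftrightarrow>
      ((\<lambda>s. norm (f s - f t - (s - t) *\<^sub>R D) / norm (s - t)) \<longlongrightarrow> 0) (at t within S)"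
    unfolding has_vector_derivative_def has_derivative_iff_norm
    by (simp add: bounded_linear_scaleR_left)
  also have "\<dots> \<longleftrightarrow> ((\<lambda>s. norm ((f s - f t) /\<^sub>R (s - t) - D)) \<longlongrightarrow> 0) (at t within S)"
  proof (rule filterlim_cong[OF refl refl])
    show "\<forall>\<^sub>F s in at t within S. norm (f s - f t - (s - t) *\<^sub>R D) / norm (s - t) =
        norm ((f s - f t) /\<^sub>R (s - t) - D)"
    proof (unfold eventually_at_filter, rule eventuallyI, intro impI)
      fix s assume "s \<noteq> t"
      then have "(f s - f t) /\<^sub>R (s - t) - D = inverse (s - t) *\<^sub>R (f s - f t - (s - t) *\<^sub>R D)"
        by (simp add: scaleR_diff_right)
      then show "norm (f s - f t - (s - t) *\<^sub>R D) / norm (s - t) = norm ((f s - f t) /\<^sub>R (s - t) - D)"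
        by (simp add: divide_inverse mult.commute)
    qed
  qed
  finally show ?thesis
    unfolding tendsto_norm_zero_iff LIM_zero_iff .
qed

text \<open>Dominated convergence applied to the difference quotients, which the mean value inequality
  bounds by the same majorant as the derivative. All time derivatives of the proof are taken this
  way, pointwise in space, so that no calculus in a function space is needed.\<close>

lemma has_vector_derivative_integral_dominated:
  fixes f f' :: "real \<Rightarrow> 'b \<Rightarrow> 'c::{banach, second_countable_topology}"
  assumes t: "a < t" "t < b"
    and int: "\<And>s. a < s \<Longrightarrow> s < b \<Longrightarrow> integrable M (f s)"
    and meas: "f' t \<in> borel_measurable M"
    and der: "AE x in M. \<forall>s\<in>{a<..<b}. ((\<lambda>s. f s x) has_vector_derivative f' s x) (at s) \<and> norm (f' s x) \<le> w x"
    and w: "integrable M w"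
  shows "((\<lambda>s. LINT x|M. f s x) has_vector_derivative (LINT x|M. f' t x)) (at t)"
proof -
  have at: "at t = at t within {a<..<b}"
    using t by (intro at_within_open[symmetric]) auto
  show ?thesis
    unfolding has_vector_derivative_iff_quotient
    unfolding at tendsto_at_iff_sequentially
  proof (intro allI impI)
    fix X assume X: "\<forall>i. X i \<in> {a<..<b} - {t}" "X \<longlonglongrightarrow> t"
    have "(\<lambda>i. LINT x|M. (f (X i) x - f t x) /\<^sub>R (X i - t)) \<longlonglongrightarrow> (LINT x|M. f' t x)"
    proof (rule integral_dominated_convergence[where w = w])
      show "f' t \<in> borel_measurable M" by fact
      show "integrable M w" by fact
      show "(\<lambda>x. (f (X i) x - f t x) /\<^sub>R (X i - t)) \<in> borel_measurable M" for i
        using int[of "X i"] int[OF t] X(1) by (intro borel_measurable_scaleR) auto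
      show "AE x in M. (\<lambda>i. (f (X i) x - f t x) /\<^sub>R (X i - t)) \<longlonglongrightarrow> f' t x"
        using der
      proof eventually_elim
        case (elim x)
        then have "((\<lambda>s. f s x) has_vector_derivative f' t x) (at t)" using t by auto
        then have "((\<lambda>s. (f s x - f t x) /\<^sub>R (s - t)) \<longlongrightarrow> f' t x) (at t within {a<..<b})"
          unfolding has_vector_derivative_iff_quotient at .
        then show ?case
          using X unfolding tendsto_at_iff_sequentially comp_def by blast
      qed
      show "AE x in M. norm ((f (X i) x - f t x) /\<^sub>R (X i - t)) \<le> w x" for i
        using der
      proof eventually_elim
        case (elim x)
        have "norm (f (X i) x - f t x) \<le> w x * norm (X i - t)"
        proof (rule differentiable_bound[where S = "{a<..<b}" and f' = "\<lambda>s h. h *\<^sub>R f' s x"])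
          fix s assume s: "s \<in> {a<..<b}"
          show "((\<lambda>s. f s x) has_derivative (\<lambda>h. h *\<^sub>R f' s x)) (at s within {a<..<b})"
            using elim s unfolding has_vector_derivative_def
            by (auto intro: has_derivative_at_withinI)
          show "onorm (\<lambda>h. h *\<^sub>R f' s x) \<le> w x"
            using elim s by (intro onorm_le) (auto simp: mult_mono mult.commute)
        qed (use X t in auto)
        moreover have "X i \<noteq> t" using X(1) by auto
        moreover have "norm ((f (X i) x - f t x) /\<^sub>R (X i - t)) = norm (f (X i) x - f t x) / norm (X i - t)"
          by (simp add: divide_inverse mult.commute)
        ultimately show ?case by (simp add: pos_divide_le_eq)
      qed
    qed
    moreover have "(LINT x|M. (f (X i) x - f t x) /\<^sub>R (X i - t)) =
        ((LINT x|M. f (X i) x) - (LINT x|M. f t x)) /\<^sub>R (X i - t)" for i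
      using int[of "X i"] int[OF t] X(1) by simp
    ultimately show "((\<lambda>s. ((LINT x|M. f s x) - (LINT x|M. f t x)) /\<^sub>R (s - t)) \<circ> X)
        \<longlonglongrightarrow> (LINT x|M. f' t x)"
      unfolding comp_def by (simp only:)
  qed
qed

text \<open>The half-lines \<open>{..a}\<close> form an intersection-stable generator of the Borel sets, so all
  integrals over Borel sets vanish.\<close>

lemma AE_zero_if_integral_atMost_zero:
  fixes f :: "real \<Rightarrow> 'a::{banach, second_countable_topology}"
  assumes f: "integrable lborel f" and all: "(LINT x|lborel. f x) = 0"
    and le: "\<And>a. (LINT x:{..a}|lborel. f x) = 0"
  shows "AE x in lborel. f x = 0"
proof -
  have int: "set_integrable lborel A f" if "A \<in> sets borel" for A
    unfolding set_integrable_def by (rule integrable_mult_indicator) (use that f in auto)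
  have s: "sets borel = sigma_sets UNIV (range (\<lambda>a::real. {..a}))"
    by (subst borel_eq_atMost) simp
  have "(LINT x:A|lborel. f x) = 0" if "A \<in> sigma_sets UNIV (range (\<lambda>a::real. {..a}))" for A
  proof (rule sigma_sets_induct_disjoint[OF _ _ that, where P = "\<lambda>A. (LINT x:A|lborel. f x) = 0"])
    show "Int_stable (range (\<lambda>a::real. {..a}))"
      by (auto simp: Int_stable_def)
    show "range (\<lambda>a::real. {..a}) \<subseteq> Pow UNIV" by simp
    show "(LINT x:{}|lborel. f x) = 0" by (simp add: set_lebesgue_integral_def)
    show "(LINT x:A|lborel. f x) = 0" if "A \<in> range (\<lambda>a. {..a})" for A
      using that le by auto
    show "(LINT x:(UNIV - A)|lborel. f x) = 0"
      if A: "A \<in> sigma_sets UNIV (range (\<lambda>a. {..a}))" "(LINT x:A|lborel. f x) = 0" for A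
    proof -
      have m: "A \<in> sets borel" using A(1) s by simp
      have "(LINT x:(A \<union> (UNIV - A))|lborel. f x) = (LINT x:A|lborel. f x) + (LINT x:(UNIV - A)|lborel. f x)"
        using m by (intro set_integral_Un int) auto
      then show ?thesis using A(2) all by (simp add: set_lebesgue_integral_def)
    qed
    show "(LINT x:(\<Union>i. A i)|lborel. f x) = 0"
      if A: "disjoint_family A" "range A \<subseteq> sigma_sets UNIV (range (\<lambda>a. {..a}))"
        "\<And>i. (LINT x:A i|lborel. f x) = 0" for A :: "nat \<Rightarrow> real set"
    proof -
      have m: "A i \<in> sets borel" for i using A(2) s by auto
      have "(LINT x:(\<Union>i. A i)|lborel. f x) = (\<Sum>i. (LINT x:(A i)|lborel. f x))"
        by (rule lebesgue_integral_countable_add)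
           (use m A(1) in \<open>auto simp: disjoint_family_on_def intro!: int\<close>)
      then show ?thesis using A(3) by simp
    qed
  qed
  then show ?thesis
    by (intro sigma_finite_measure.density_zero[OF sigma_finite_lborel f]) (simp add: s)
qed


section \<open>Weak solutions of second order equations with Dirichlet condition\<close>

lemma half_line_integrable_compact_support:
  fixes g :: "real \<Rightarrow> 'a::euclidean_space"
  assumes "continuous_on {0..} g" "\<And>x. x > B \<Longrightarrow> g x = 0"
  shows "integrable half_line g"
proof -
  have "integrable half_line (\<lambda>x. indicator {..B} x *\<^sub>R g x)"
    by (rule half_line_truncated_continuous) (rule continuous_on_subset[OF assms(1)], auto)
  moreover have "(\<lambda>x. indicator {..B} x *\<^sub>R g x) = g"
    using assms(2) by (auto simp: fun_eq_iff split: split_indicator)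
  ultimately show ?thesis by simp
qed

lemma half_line_integrable_local:
  fixes u :: "real \<Rightarrow> complex"
  assumes u: "\<And>y. integrable half_line (\<lambda>x. indicator {..y} x *\<^sub>R u x)"
    and g: "continuous_on {0..} g" and g0: "\<And>x. x > B \<Longrightarrow> g x = (0::complex)"
  shows "integrable half_line (\<lambda>x. u x * g x)"
proof -
  have "bounded (g ` {0..B})"
    by (intro compact_imp_bounded compact_continuous_image continuous_on_subset[OF g]) auto
  then obtain K where K: "\<And>x. 0 \<le> x \<Longrightarrow> x \<le> B \<Longrightarrow> norm (g x) \<le> K"
    unfolding bounded_iff by (metis atLeastAtMost_iff imageI)
  have [measurable]: "g \<in> borel_measurable half_line"
    by (rule borel_measurable_half_line_continuous[OF g])
  have [measurable]: "(\<lambda>x. indicator {..B} x *\<^sub>R u x) \<in> borel_measurable half_line"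
    by (rule borel_measurable_integrable[OF u])
  have "integrable half_line (\<lambda>x. (indicator {..B} x *\<^sub>R u x) * g x)"
  proof (rule Bochner_Integration.integrable_bound[where f = "\<lambda>x. K *\<^sub>R (indicator {..B} x *\<^sub>R u x)"])
    show "integrable half_line (\<lambda>x. K *\<^sub>R (indicator {..B} x *\<^sub>R u x))"
      by (intro integrable_scaleR_right u)
    show "AE x in half_line. norm ((indicator {..B} x *\<^sub>R u x) * g x)
        \<le> norm (K *\<^sub>R (indicator {..B} x *\<^sub>R u x))"
    proof (rule AE_I2)
      fix x assume "x \<in> space half_line"
      then have "0 \<le> x" by (simp add: space_half_line)
      then show "norm ((indicator {..B} x *\<^sub>R u x) * g x) \<le> norm (K *\<^sub>R (indicator {..B} x *\<^sub>R u x))"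
        using K[of x] by (auto simp: norm_mult mult.commute[of "norm (u x)"] split: split_indicator intro!: mult_right_mono)
    qed
  qed measurable
  moreover have "(\<lambda>x. (indicator {..B} x *\<^sub>R u x) * g x) = (\<lambda>x. u x * g x)"
    using g0 by (auto simp: fun_eq_iff split: split_indicator)
  ultimately show ?thesis by simp
qed

lemma at_within_atLeast:
  fixes x :: real
  assumes "0 \<le> x"
  shows "at x within {0..x + 1} = at x within {0..}"
  by (rule at_within_nhd[of x "{..<x + 1}"]) (use assms in auto)

lemma integral_has_vector_derivative_atLeast:
  fixes f :: "real \<Rightarrow> 'a::banach"
  assumes "continuous_on {0..} f" "0 \<le> x"
  shows "((\<lambda>u. integral {0..u} f) has_vector_derivative f x) (at x within {0..})"
proof -
  have "((\<lambda>u. integral {0..u} f) has_vector_derivative f x) (at x within {0..x + 1})"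
    by (rule integral_has_vector_derivative)
       (use assms in \<open>auto intro: continuous_on_subset[OF assms(1)]\<close>)
  then show ?thesis by (simp only: at_within_atLeast[OF assms(2)])
qed

lemma indefinite_integral_continuous_atLeast:
  fixes f :: "real \<Rightarrow> 'a::banach"
  assumes "\<And>y. f integrable_on {0..y}"
  shows "continuous_on {0..} (\<lambda>u. integral {0..u} f)"
  unfolding continuous_on_eq_continuous_within
proof
  fix x :: real assume x: "x \<in> {0..}"
  have "continuous_on {0..x + 1} (\<lambda>u. integral {0..u} f)"
    by (rule indefinite_integral_continuous_1) (rule assms)
  then have "continuous (at x within {0..x + 1}) (\<lambda>u. integral {0..u} f)"
    using x by (auto simp: continuous_on_eq_continuous_within)
  then show "continuous (at x within {0..}) (\<lambda>u. integral {0..u} f)"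
    using x at_within_atLeast[of x] by (simp add: continuous_within)
qed

lemma smooth_fun_deriv_eq_0:
  assumes "smooth_fun f" "\<And>x. B \<le> x \<Longrightarrow> f x = 0" "B < x"
  shows "deriv f x = 0"
proof -
  have "(f has_real_derivative 0) (at x)"
    by (rule has_field_derivative_transform_within_open[where f = "\<lambda>_. 0" and S = "{B<..}"]) (use assms in auto)
  then show ?thesis by (rule DERIV_imp_deriv)
qed

text \<open>Integration by parts against a primitive of a function that is merely locally integrable:
  Fubini on the triangle \<open>0 < y \<le> s\<close>.\<close>

lemma indefinite_integral_pairing:
  fixes f :: "real \<Rightarrow> complex"
  assumes f: "\<And>y. integrable half_line (\<lambda>x. indicator {..y} x *\<^sub>R f x)"
    and \<phi>: "smooth_fun \<phi>" "\<And>x. B \<le> x \<Longrightarrow> \<phi> x = 0" and fm[measurable]: "f \<in> borel_measurable half_line"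
  shows "(LINT s|half_line. integral {0..s} f * of_real (deriv \<phi> s)) = - (LINT x|half_line. f x * of_real (\<phi> x))"
proof -
  define k where "k s y = indicator {..s} y *\<^sub>R (f y * complex_of_real (deriv \<phi> s))" for s y
  have c1: "continuous_on S (\<lambda>s. complex_of_real (deriv \<phi> s))" for S
    by (intro continuous_intros smooth_fun_continuous smooth_fun_deriv \<phi>)
  have d0: "deriv \<phi> s = 0" if "s > B" for s
    by (rule smooth_fun_deriv_eq_0[OF \<phi> that])
  have [measurable]: "deriv \<phi> \<in> borel_measurable half_line"
    by (intro borel_measurable_half_line_continuous smooth_fun_continuous smooth_fun_deriv \<phi>)
  have id: "(\<lambda>x. x) \<in> borel_measurable half_line"
    by (intro borel_measurable_half_lineI) simp
  have [measurable]: "Measurable.pred (half_line \<Otimes>\<^sub>M half_line) (\<lambda>p. snd p \<le> fst p)"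
    unfolding pred_def
    by (intro borel_measurable_le measurable_compose[OF measurable_fst id]
        measurable_compose[OF measurable_snd id])
  interpret P: pair_sigma_finite half_line half_line ..
  have km: "(\<lambda>(s, y). k s y) \<in> borel_measurable (half_line \<Otimes>\<^sub>M half_line)"
  proof -
    have "(\<lambda>(s, y). k s y) = (\<lambda>p. if snd p \<le> fst p then f (snd p) * of_real (deriv \<phi> (fst p)) else 0)"
      by (auto simp: k_def fun_eq_iff split: split_indicator)
    also have "\<dots> \<in> borel_measurable (half_line \<Otimes>\<^sub>M half_line)" by measurable
    finally show ?thesis .
  qed
  have ki: "integrable half_line (k s)" for s
    using integrable_mult_left[OF f[of s], of "of_real (deriv \<phi> s)"]
    by (simp add: k_def[abs_def] scaleR_conv_of_real mult_ac)
  have int: "integrable (half_line \<Otimes>\<^sub>M half_line) (\<lambda>(s, y). k s y)"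
  proof (rule P.Fubini_integrable[OF km])
    show "AE x in half_line. integrable half_line (\<lambda>y. case (x, y) of (s, y) \<Rightarrow> k s y)"
      using ki by simp
    have bd: "(LINT y|half_line. norm (k s y)) \<le> (LINT y|half_line. norm (indicator {..B} y *\<^sub>R f y)) * norm (deriv \<phi> s)" for s
    proof -
      have "(LINT y|half_line. norm (k s y)) \<le> (LINT y|half_line. norm (indicator {..B} y *\<^sub>R f y) * norm (deriv \<phi> s))"
      proof (rule integral_mono)
        show "norm (k s y) \<le> norm (indicator {..B} y *\<^sub>R f y) * norm (deriv \<phi> s)" for y
          using d0[of s] by (cases "s > B") (auto simp: k_def norm_mult split: split_indicator)
      qed (use ki f[of B] in \<open>auto intro!: integrable_norm integrable_mult_left simp del: norm_scaleR\<close>)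
      then show ?thesis by simp
    qed
    show "integrable half_line (\<lambda>x. LINT y|half_line. norm (case (x, y) of (s, y) \<Rightarrow> k s y))"
    proof (rule Bochner_Integration.integrable_bound[where f = "\<lambda>s. (LINT y|half_line. norm (indicator {..B} y *\<^sub>R f y)) * norm (deriv \<phi> s)"])
      have "integrable half_line (\<lambda>s. norm (deriv \<phi> s))"
        by (rule half_line_integrable_compact_support[where B = B])
           (use d0 in \<open>auto simp del: real_norm_def
              intro!: continuous_on_norm[OF smooth_fun_continuous[OF smooth_fun_deriv[OF \<phi>(1)]]]\<close>)
      then show "integrable half_line (\<lambda>s. (LINT y|half_line. norm (indicator {..B} y *\<^sub>R f y)) * norm (deriv \<phi> s))"
        by (rule integrable_mult_right)
      show "(\<lambda>x. LINT y|half_line. norm (case (x, y) of (s, y) \<Rightarrow> k s y)) \<in> borel_measurable half_line"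
        using km by (intro half_line.borel_measurable_lebesgue_integral) (simp add: case_prod_unfold)
      show "AE x in half_line. norm (LINT y|half_line. norm (case (x, y) of (s, y) \<Rightarrow> k s y))
          \<le> norm ((LINT y|half_line. norm (indicator {..B} y *\<^sub>R f y)) * norm (deriv \<phi> x))"
      proof (rule AE_I2)
        fix s
        have "0 \<le> (LINT y|half_line. norm (k s y))" by (rule integral_nonneg_AE) simp
        then show "norm (LINT y|half_line. norm (case (s, y) of (s, y) \<Rightarrow> k s y))
          \<le> norm ((LINT y|half_line. norm (indicator {..B} y *\<^sub>R f y)) * norm (deriv \<phi> s))"
          using bd[of s] by simp
      qed
    qed
  qed
  have "(LINT s|half_line. integral {0..s} f * of_real (deriv \<phi> s)) = (LINT s|half_line. LINT y|half_line. k s y)"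
  proof (rule Bochner_Integration.integral_cong[OF refl])
    fix s
    have "(LINT y|half_line. k s y) = (LINT y|half_line. (indicator {..s} y *\<^sub>R f y) * of_real (deriv \<phi> s))"
      by (simp add: k_def)
    also have "\<dots> = (LINT y|half_line. (indicator {..s} y *\<^sub>R f y)) * of_real (deriv \<phi> s)"
      by (rule integral_mult_left_zero)
    also have "\<dots> = integral {0..s} f * of_real (deriv \<phi> s)"
      using half_line_truncated_integral(2)[OF f] by simp
    finally show "integral {0..s} f * of_real (deriv \<phi> s) = (LINT y|half_line. k s y)" ..
  qed
  also have "\<dots> = (LINT y|half_line. LINT s|half_line. k s y)"
    by (rule P.Fubini_integral[OF int, symmetric])
  also have "\<dots> = (LINT y|half_line. - (f y * of_real (\<phi> y)))"
  proof (rule Bochner_Integration.integral_cong[OF refl])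
    fix y assume "y \<in> space half_line"
    then have y: "0 < y" by (simp add: space_half_line)
    define C where "C = max B y + 1"
    have "(LINT s|half_line. k s y) = f y * (LINT s|half_line. of_real (indicator {y..} s * deriv \<phi> s))"
    proof -
      have "k s y = f y * of_real (indicator {y..} s * deriv \<phi> s)" for s
        by (auto simp: k_def split: split_indicator)
      then show ?thesis by (simp only: integral_mult_right_zero)
    qed
    also have "(LINT s|half_line. complex_of_real (indicator {y..} s * deriv \<phi> s)) =
        of_real (LINT s|half_line. indicator {y..} s * deriv \<phi> s)"
      by (rule integral_complex_of_real)
    also have "(LINT s|half_line. indicator {y..} s * deriv \<phi> s) = (LINT s:{y..C}|lborel. deriv \<phi> s)"
      unfolding half_line_integral_eq set_lebesgue_integral_def
      using y d0 by (intro Bochner_Integration.integral_cong) (auto simp: C_def split: split_indicator)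
    also have "\<dots> = integral {y..C} (deriv \<phi>)"
      by (intro set_borel_integral_eq_integral borel_integrable_compact[OF compact_Icc, folded set_integrable_def]
          smooth_fun_continuous smooth_fun_deriv \<phi>)
    also have "\<dots> = \<phi> C - \<phi> y"
      by (rule integral_unique, rule fundamental_theorem_of_calculus)
         (auto simp: C_def has_real_derivative_iff_has_vector_derivative[symmetric]
           intro!: has_field_derivative_at_within smooth_fun_has_derivative \<phi>)
    also have "\<phi> C = 0" by (rule \<phi>) (simp add: C_def)
    finally show "(LINT s|half_line. k s y) = - (f y * of_real (\<phi> y))" by simp
  qed
  finally show ?thesis by simp
qed

text \<open>A weak solution of \<open>u'' = f\<close> differs from the double primitive of \<open>f\<close> by a multiple of \<open>x\<close>.
  The constant term is missing because the test functions only vanish at \<open>0\<close>, with arbitrary slope: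
  this is how the weak formulation encodes the Dirichlet condition.\<close>

lemma du_Bois_Reymond_half_line:
  fixes u f :: "real \<Rightarrow> complex"
  assumes \<theta>: "smooth_fun \<theta>" "\<And>x. 0 \<le> \<theta> x" "\<And>x. \<theta> x \<le> 1"
      "\<And>x. x \<le> 0 \<Longrightarrow> \<theta> x = 0" "\<And>x. 1 \<le> x \<Longrightarrow> \<theta> x = 1"
    and u: "\<And>y. integrable half_line (\<lambda>x. indicator {..y} x *\<^sub>R u x)"
    and um[measurable]: "u \<in> borel_measurable half_line"
    and f: "\<And>y. integrable half_line (\<lambda>x. indicator {..y} x *\<^sub>R f x)"
    and fm[measurable]: "f \<in> borel_measurable half_line"
    and weak: "\<And>\<phi>. \<phi> \<in> Cc_infinity UNIV \<Longrightarrow> \<phi> 0 = 0 \<Longrightarrow>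
      (LINT x|half_line. u x * of_real (deriv (deriv \<phi>) x)) = (LINT x|half_line. f x * of_real (\<phi> x))"
  obtains A where "AE x in half_line. u x = A * of_real x + integral {0..x} (\<lambda>s. integral {0..s} f)"
proof -
  define f1 where "f1 s = integral {0..s} f" for s
  define w where "w x = integral {0..x} f1" for x
  have f1c: "continuous_on {0..} f1"
    unfolding f1_def[abs_def]
    by (rule indefinite_integral_continuous_atLeast) (rule half_line_truncated_integral(1)[OF f])
  have wd: "(w has_vector_derivative f1 x) (at x within {0..})" if "0 \<le> x" for x
    unfolding w_def[abs_def] by (rule integral_has_vector_derivative_atLeast[OF f1c that])
  have wc: "continuous_on {0..} w"
    using has_vector_derivative_continuous[OF wd] by (simp add: continuous_on_eq_continuous_within)
  have w0: "w 0 = 0" by (simp add: w_def)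
  have lw: "(LINT x|half_line. w x * of_real (deriv (deriv \<phi>) x)) = (LINT x|half_line. f x * of_real (\<phi> x))"
    if \<phi>: "smooth_fun \<phi>" "\<And>x. B \<le> x \<Longrightarrow> \<phi> x = 0" for \<phi> B
  proof -
    have d1: "deriv \<phi> x = 0" if "x > B" for x by (rule smooth_fun_deriv_eq_0[OF \<phi> that])
    have d2: "deriv (deriv \<phi>) x = 0" if "x > B + 1" for x
      by (rule smooth_fun_deriv_eq_0[OF smooth_fun_deriv[OF \<phi>(1)], of "B + 1"]) (use d1 that in auto)
    have c1: "continuous_on S (\<lambda>x. complex_of_real (deriv \<phi> x))"
      and c2: "continuous_on S (\<lambda>x. complex_of_real (deriv (deriv \<phi>) x))" for S
      by (intro continuous_intros smooth_fun_continuous smooth_fun_deriv \<phi>)+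
    have i1: "integrable half_line (\<lambda>x. f1 x * of_real (deriv \<phi> x))"
      by (rule half_line_integrable_compact_support[where B = B])
         (use d1 in \<open>auto intro!: continuous_intros f1c c1\<close>)
    have i2: "integrable half_line (\<lambda>x. w x * of_real (deriv (deriv \<phi>) x))"
      by (rule half_line_integrable_compact_support[where B = "B + 1"])
         (use d2 in \<open>auto intro!: continuous_intros wc c2\<close>)
    have "(LINT x|half_line. w x * of_real (deriv (deriv \<phi>) x) + f1 x * of_real (deriv \<phi> x)) = - (w 0 * of_real (deriv \<phi> 0))"
    proof (rule half_line_integral_derivative)
      fix x :: real assume x: "0 \<le> x"
      have "((\<lambda>x. complex_of_real (deriv \<phi> x)) has_vector_derivative of_real (deriv (deriv \<phi>) x)) (at x within {0..})"
        by (rule has_vector_derivative_of_real)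
           (rule has_field_derivative_at_within[OF smooth_fun_has_derivative[OF smooth_fun_deriv[OF \<phi>(1)]]])
      from has_vector_derivative_mult[OF wd[OF x] this]
      show "((\<lambda>x. w x * of_real (deriv \<phi> x)) has_vector_derivative
          w x * of_real (deriv (deriv \<phi>) x) + f1 x * of_real (deriv \<phi> x)) (at x within {0..})" .
    next
      show "continuous_on {0..} (\<lambda>x. w x * of_real (deriv (deriv \<phi>) x) + f1 x * of_real (deriv \<phi> x))"
        by (intro continuous_on_add continuous_on_mult wc f1c c1 c2)
      show "integrable half_line (\<lambda>x. w x * of_real (deriv \<phi> x))"
        by (rule half_line_integrable_compact_support[where B = B])
           (use d1 in \<open>auto intro!: continuous_on_mult wc c1\<close>)
      show "integrable half_line (\<lambda>x. w x * of_real (deriv (deriv \<phi>) x) + f1 x * of_real (deriv \<phi> x))"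
        using i1 i2 by simp
    qed
    then have "(LINT x|half_line. w x * of_real (deriv (deriv \<phi>) x)) = - (LINT x|half_line. f1 x * of_real (deriv \<phi> x))"
      using i1 i2 w0 by (simp add: eq_neg_iff_add_eq_0)
    then show ?thesis
      using indefinite_integral_pairing[OF f \<phi> fm] by (simp add: f1_def)
  qed
  define F where "F x = u x - w x" for x
  have wl: "integrable half_line (\<lambda>x. indicator {..y} x *\<^sub>R w x)" for y
    by (rule half_line_truncated_continuous) (rule continuous_on_subset[OF wc], auto)
  have F: "integrable half_line (\<lambda>x. indicator {..y} x *\<^sub>R F x)" for y
    using Bochner_Integration.integrable_diff[OF u[of y] wl[of y]] by (simp add: F_def scaleR_diff_right)
  have [measurable]: "w \<in> borel_measurable half_line"
    by (rule borel_measurable_half_line_continuous[OF wc])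
  have Fm[measurable]: "F \<in> borel_measurable half_line" unfolding F_def[abs_def] by measurable
  \<comment> \<open>A test function \<open>\<zeta>\<close> is a second derivative of an admissible one as soon as its first moment
    vanishes: the primitive \<open>P\<close> vanishing near infinity has \<open>P 0 = \<integral> x \<zeta>\<close>.\<close>
  have zero: "(LINT x|half_line. F x * of_real (\<zeta> x)) = 0"
    if \<zeta>: "smooth_fun \<zeta>" "\<And>x. b \<le> x \<Longrightarrow> \<zeta> x = 0" "b > 0" "(LINT x|half_line. x * \<zeta> x) = 0" for \<zeta> b
  proof -
    obtain Y1 where Y1: "\<And>x. (Y1 has_real_derivative \<zeta> x) (at x)"
      using continuous_antiderivative smooth_fun_continuous[OF \<zeta>(1)] by blast
    define Z1 where "Z1 x = Y1 x - Y1 b" for x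
    have Z1: "(Z1 has_real_derivative \<zeta> x) (at x)" for x
      unfolding Z1_def[abs_def] using DERIV_diff[OF Y1 DERIV_const] by simp
    have sZ1: "smooth_fun Z1" by (rule smooth_fun_antiderivative[OF \<zeta>(1) Z1])
    obtain Y2 where Y2: "\<And>x. (Y2 has_real_derivative Z1 x) (at x)"
      using continuous_antiderivative smooth_fun_continuous[OF sZ1] by blast
    define P where "P x = Y2 x - Y2 b" for x
    have P: "(P has_real_derivative Z1 x) (at x)" for x
      unfolding P_def[abs_def] using DERIV_diff[OF Y2 DERIV_const] by simp
    have sP: "smooth_fun P" by (rule smooth_fun_antiderivative[OF sZ1 P])
    have Z1b: "Z1 x = 0" if "b \<le> x" for x
    proof -
      have "(Z1 has_real_derivative 0) (at x within {b..})" if "x \<in> {b..}" for x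
        using has_field_derivative_at_within[OF Z1[of x]] \<zeta>(2)[of x] that by simp
      then have "\<exists>c. \<forall>x\<in>{b..}. Z1 x = c" by (intro has_field_derivative_zero_constant) auto
      moreover have "Z1 b = 0" by (simp add: Z1_def)
      ultimately show ?thesis using that by force
    qed
    have Pb: "P x = 0" if "b \<le> x" for x
    proof -
      have "(P has_real_derivative 0) (at x within {b..})" if "x \<in> {b..}" for x
        using has_field_derivative_at_within[OF P[of x]] Z1b[of x] that by simp
      then have "\<exists>c. \<forall>x\<in>{b..}. P x = c" by (intro has_field_derivative_zero_constant) auto
      moreover have "P b = 0" by (simp add: P_def)
      ultimately show ?thesis using that by force
    qed
    have P0: "P 0 = 0"
    proof -
      have "(LINT x|half_line. indicator {..b} x *\<^sub>R (x * \<zeta> x)) = (b * Z1 b - P b) - (0 * Z1 0 - P 0)"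
      proof (rule half_line_truncated_FTC[where F = "\<lambda>x. x * Z1 x - P x"])
        show "continuous_on {0..b} (\<lambda>x. x * \<zeta> x)"
          by (intro continuous_intros smooth_fun_continuous \<zeta>)
        show "((\<lambda>x. x * Z1 x - P x) has_vector_derivative x * \<zeta> x) (at x within {0..})" for x
          unfolding has_real_derivative_iff_has_vector_derivative[symmetric]
          by (rule has_field_derivative_at_within)
             (auto intro!: derivative_eq_intros Z1 P)
      qed (use \<zeta>(3) in auto)
      moreover have "(\<lambda>x. indicator {..b} x *\<^sub>R (x * \<zeta> x)) = (\<lambda>x. x * \<zeta> x)"
        using \<zeta>(2) by (auto simp: fun_eq_iff split: split_indicator)
      ultimately show ?thesis using \<zeta>(4) Z1b[of b] Pb[of b] by simp
    qed
    \<comment> \<open>Only the values on \<open>(0, \<infinity>)\<close> matter, so \<open>P\<close> may be cut off on the negative axis.\<close>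
    define cut where "cut x = \<theta> (1 * x + 2)" for x
    have scut: "smooth_fun cut" unfolding cut_def[abs_def] by (rule smooth_fun_affine[OF \<theta>(1)])
    define \<phi> where "\<phi> x = P x * cut x" for x
    have s\<phi>: "smooth_fun \<phi>" unfolding \<phi>_def[abs_def] by (rule smooth_fun_mult[OF sP scut])
    have \<phi>C: "\<phi> \<in> Cc_infinity UNIV"
    proof (rule Cc_infinityI[OF s\<phi>])
      fix x assume "\<phi> x \<noteq> 0"
      then show "-2 \<le> x \<and> x \<le> b"
        using Pb[of x] \<theta>(4)[of "1 * x + 2"] by (cases "b \<le> x"; cases "x \<le> -2") (auto simp: \<phi>_def cut_def)
    qed
    have \<phi>P: "\<phi> x = P x" if "x > -1" for x
      using that \<theta>(5)[of "1 * x + 2"] by (simp add: \<phi>_def cut_def)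
    have d1: "deriv \<phi> x = Z1 x" if "x > -1" for x
      by (rule DERIV_imp_deriv, rule has_field_derivative_transform_within_open[OF P, where S = "{-1<..}"])
         (use that \<phi>P in auto)
    have d2: "deriv (deriv \<phi>) x = \<zeta> x" if "x > -1" for x
      by (rule DERIV_imp_deriv, rule has_field_derivative_transform_within_open[OF Z1, where S = "{-1<..}"])
         (use that d1 in auto)
    have "\<phi> 0 = 0" using \<phi>P[of 0] P0 by simp
    have "\<phi> x = 0" if "b \<le> x" for x using Pb[OF that] by (simp add: \<phi>_def)
    from weak[OF \<phi>C \<open>\<phi> 0 = 0\<close>] lw[OF s\<phi> this]
    have "(LINT x|half_line. u x * of_real (deriv (deriv \<phi>) x)) = (LINT x|half_line. w x * of_real (deriv (deriv \<phi>) x))"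
      by simp
    moreover have "(LINT x|half_line. g x * of_real (deriv (deriv \<phi>) x)) = (LINT x|half_line. g x * of_real (\<zeta> x))" for g :: "real \<Rightarrow> complex"
      by (rule Bochner_Integration.integral_cong) (auto simp: space_half_line d2)
    ultimately have "(LINT x|half_line. u x * of_real (\<zeta> x)) = (LINT x|half_line. w x * of_real (\<zeta> x))" by simp
    moreover have "integrable half_line (\<lambda>x. g x * of_real (\<zeta> x))"
      if "\<And>y. integrable half_line (\<lambda>x. indicator {..y} x *\<^sub>R g x)" for g :: "real \<Rightarrow> complex"
      by (rule half_line_integrable_local[where B = b, OF that])
         (use \<zeta>(2) in \<open>auto intro!: continuous_intros smooth_fun_continuous \<zeta>(1)\<close>)
    ultimately show ?thesis
      using u wl by (simp add: F_def left_diff_distrib)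
  qed
  \<comment> \<open>A fixed function with nonzero first moment \<open>c0\<close>, to correct the first moment of any other.\<close>
  define \<zeta>0 where "\<zeta>0 x = 1 - \<theta> (1 * x + (-1))" for x
  have s\<zeta>0: "smooth_fun \<zeta>0"
    unfolding \<zeta>0_def[abs_def] by (intro smooth_fun_diff smooth_fun_const smooth_fun_affine \<theta>(1))
  have \<zeta>0b: "\<zeta>0 x = 0" if "2 \<le> x" for x using \<theta>(5)[of "1 * x + (-1)"] that by (simp add: \<zeta>0_def)
  have xi: "integrable half_line (\<lambda>x. x * \<zeta> x)" if "smooth_fun \<zeta>" "\<And>x. b \<le> x \<Longrightarrow> \<zeta> x = 0" for \<zeta> b
    by (rule half_line_integrable_compact_support[where B = b])
       (use that in \<open>auto intro!: smooth_fun_continuous smooth_fun_mult smooth_fun_ident\<close>)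
  have FI: "integrable half_line (\<lambda>x. F x * of_real (\<zeta> x))" if "smooth_fun \<zeta>" "\<And>x. b \<le> x \<Longrightarrow> \<zeta> x = 0" for \<zeta> b
    by (rule half_line_integrable_local[where B = b, OF F])
       (use that in \<open>auto intro!: continuous_intros smooth_fun_continuous\<close>)
  define c0 where "c0 = (LINT x|half_line. x * \<zeta>0 x)"
  have c0: "c0 > 0"
  proof -
    have "(LINT x|half_line. indicator {..1} x *\<^sub>R x) = 1\<^sup>2 / 2 - 0\<^sup>2 / 2"
      by (rule half_line_truncated_FTC[where F = "\<lambda>x. x\<^sup>2 / 2"])
         (auto simp: has_real_derivative_iff_has_vector_derivative[symmetric] intro!: derivative_eq_intros continuous_intros)
    moreover have "(LINT x|half_line. indicator {..1} x *\<^sub>R x) \<le> c0"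
      unfolding c0_def
    proof (rule integral_mono)
      show "integrable half_line (\<lambda>x. x * \<zeta>0 x)" by (rule xi[OF s\<zeta>0 \<zeta>0b])
      show "integrable half_line (\<lambda>x. indicator {..1} x *\<^sub>R x)"
        by (rule half_line_truncated_continuous) (intro continuous_intros)
      fix x :: real assume "x \<in> space half_line"
      then show "indicator {..1} x *\<^sub>R x \<le> x * \<zeta>0 x"
        using \<theta>(3)[of "1 * x + (-1)"] \<theta>(4)[of "1 * x + (-1)"]
        by (auto simp: space_half_line \<zeta>0_def split: split_indicator)
    qed
    ultimately show ?thesis by simp
  qed
  define A where "A = (LINT x|half_line. F x * of_real (\<zeta>0 x)) / of_real c0"
  have FA: "(LINT x|half_line. F x * of_real (\<zeta> x)) = A * of_real (LINT x|half_line. x * \<zeta> x)"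
    if \<zeta>: "smooth_fun \<zeta>" "\<And>x. b \<le> x \<Longrightarrow> \<zeta> x = 0" for \<zeta> b
  proof -
    define c where "c = (LINT x|half_line. x * \<zeta> x) / c0"
    define \<eta> where "\<eta> x = \<zeta> x - c * \<zeta>0 x" for x
    have "(LINT x|half_line. F x * of_real (\<eta> x)) = 0"
    proof (rule zero[of \<eta> "max b 2"])
      show "smooth_fun \<eta>"
        unfolding \<eta>_def[abs_def] by (intro smooth_fun_diff smooth_fun_cmult \<zeta> s\<zeta>0)
      have "(LINT x|half_line. x * \<eta> x) = (LINT x|half_line. x * \<zeta> x - c * (x * \<zeta>0 x))"
        by (rule Bochner_Integration.integral_cong) (auto simp: \<eta>_def algebra_simps)
      also have "\<dots> = (LINT x|half_line. x * \<zeta> x) - c * c0"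
        using xi[OF \<zeta>] xi[OF s\<zeta>0 \<zeta>0b] by (simp add: c0_def)
      finally show "(LINT x|half_line. x * \<eta> x) = 0" using c0 by (simp add: c_def)
    qed (use \<zeta>(2) \<zeta>0b in \<open>auto simp: \<eta>_def\<close>)
    moreover have "(LINT x|half_line. F x * of_real (\<eta> x)) =
        (LINT x|half_line. F x * of_real (\<zeta> x) - of_real c * (F x * of_real (\<zeta>0 x)))"
      by (rule Bochner_Integration.integral_cong) (auto simp: \<eta>_def algebra_simps)
    moreover have "\<dots> = (LINT x|half_line. F x * of_real (\<zeta> x)) - of_real c * (LINT x|half_line. F x * of_real (\<zeta>0 x))"
      using FI[OF \<zeta>] FI[OF s\<zeta>0 \<zeta>0b] by simp
    ultimately show ?thesis by (simp add: A_def c_def)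
  qed
  define H where "H x = F x - A * of_real x" for x
  have Hl: "integrable half_line (\<lambda>x. indicator {..y} x *\<^sub>R H x)" for y
  proof -
    have "integrable half_line (\<lambda>x. indicator {..y} x *\<^sub>R (A * of_real x))"
      by (rule half_line_truncated_continuous) (intro continuous_intros)
    from Bochner_Integration.integrable_diff[OF F[of y] this] show ?thesis
      by (simp add: H_def scaleR_diff_right)
  qed
  have [measurable]: "complex_of_real \<in> borel_measurable half_line"
    by (intro borel_measurable_half_lineI) simp
  have Hm[measurable]: "H \<in> borel_measurable half_line" unfolding H_def[abs_def] by measurable
  have [measurable]: "indicat_real {..c} \<in> borel_measurable half_line" for c
    by (rule borel_measurable_half_lineI) simp
  have H0: "(LINT x|half_line. indicator {..c} x *\<^sub>R H x) = 0" if "c > 0" for c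
  proof -
    \<comment> \<open>Smooth functions decreasing from 1 to 0 in a layer of width \<open>1/(n+1)\<close> after \<open>c\<close>.\<close>
    define \<zeta> where "\<zeta> n x = 1 - \<theta> (real (Suc n) * x + (- real (Suc n) * c))" for n x
    have s: "smooth_fun (\<zeta> n)" for n
      unfolding \<zeta>_def[abs_def] by (intro smooth_fun_diff smooth_fun_const smooth_fun_affine \<theta>(1))
    have arg: "real (Suc n) * x + (- real (Suc n) * c) = real (Suc n) * (x - c)" for n x
      by (simp add: algebra_simps)
    have b: "\<zeta> n x = 0" if "c + 1 \<le> x" for n x
    proof -
      have "1 * 1 \<le> real (Suc n) * (x - c)" using that by (intro mult_mono) auto
      then show ?thesis unfolding \<zeta>_def arg using \<theta>(5) by simp
    qed
    have z: "(LINT x|half_line. H x * of_real (\<zeta> n x)) = 0" for n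
    proof -
      have "(LINT x|half_line. H x * of_real (\<zeta> n x)) =
          (LINT x|half_line. F x * of_real (\<zeta> n x) - A * of_real (x * \<zeta> n x))"
        by (rule Bochner_Integration.integral_cong) (auto simp: H_def algebra_simps)
      also have "\<dots> = (LINT x|half_line. F x * of_real (\<zeta> n x)) - A * of_real (LINT x|half_line. x * \<zeta> n x)"
      proof -
        have "integrable half_line (\<lambda>x. A * complex_of_real (x * \<zeta> n x))"
          by (intro integrable_mult_right integrable_of_real xi[OF s b])
        from Bochner_Integration.integral_diff[OF FI[OF s b] this]
        show ?thesis by (simp only: integral_mult_right_zero integral_complex_of_real)
      qed
      also have "\<dots> = 0" using FA[OF s b] by simp
      finally show ?thesis .
    qed
    have "(\<lambda>n. LINT x|half_line. H x * of_real (\<zeta> n x)) \<longlonglongrightarrow> (LINT x|half_line. indicator {..c} x *\<^sub>R H x)"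
    proof (rule integral_dominated_convergence[where w = "\<lambda>x. norm (indicator {..c + 1} x *\<^sub>R H x)"])
      show "integrable half_line (\<lambda>x. norm (indicator {..c + 1} x *\<^sub>R H x))"
        using Hl by (rule integrable_norm)
      show "(\<lambda>x. H x * of_real (\<zeta> n x)) \<in> borel_measurable half_line" for n
      proof -
        have [measurable]: "\<zeta> n \<in> borel_measurable half_line"
          by (intro borel_measurable_half_line_continuous smooth_fun_continuous s)
        show ?thesis by measurable
      qed
      show "AE x in half_line. (\<lambda>n. H x * of_real (\<zeta> n x)) \<longlonglongrightarrow> indicator {..c} x *\<^sub>R H x"
      proof (rule AE_I2)
        fix x
        have "eventually (\<lambda>n. \<zeta> n x = indicator {..c} x) sequentially"
        proof (cases "x \<le> c")
          case True
          then have "\<zeta> n x = 1" for n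
            unfolding \<zeta>_def arg using \<theta>(4)[of "real (Suc n) * (x - c)"] by (simp add: mult_nonneg_nonpos)
          then show ?thesis using True by simp
        next
          case False
          then obtain N where N: "1 / (x - c) < real N" using reals_Archimedean2 by blast
          have "\<zeta> n x = 0" if "n \<ge> N" for n
          proof -
            have "1 / (x - c) \<le> real (Suc n)" using N that by linarith
            then have "1 \<le> real (Suc n) * (x - c)" using False by (simp add: field_simps)
            then show ?thesis unfolding \<zeta>_def arg using \<theta>(5) by simp
          qed
          then show ?thesis using False unfolding eventually_sequentially by auto
        qed
        then have "eventually (\<lambda>n. H x * of_real (\<zeta> n x) = indicator {..c} x *\<^sub>R H x) sequentially"
          by eventually_elim (simp add: scaleR_conv_of_real)
        then show "(\<lambda>n. H x * of_real (\<zeta> n x)) \<longlonglongrightarrow> indicator {..c} x *\<^sub>R H x"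
          by (rule tendsto_eventually)
      qed
      show "AE x in half_line. norm (H x * of_real (\<zeta> n x)) \<le> norm (indicator {..c + 1} x *\<^sub>R H x)" for n
      proof (rule AE_I2)
        fix x
        have "\<bar>\<zeta> n x\<bar> \<le> 1" using \<theta>(2,3) by (simp add: \<zeta>_def abs_le_iff)
        then show "norm (H x * of_real (\<zeta> n x)) \<le> norm (indicator {..c + 1} x *\<^sub>R H x)"
          using b[of x n] by (auto simp: norm_mult mult_left_le split: split_indicator)
      qed
    qed measurable
    then show ?thesis using z by (simp add: LIMSEQ_const_iff)
  qed
  have "AE x in lborel. indicator {0<..real N} x *\<^sub>R H x = 0" for N :: nat
  proof (rule AE_zero_if_integral_atMost_zero)
    have *: "(LINT x:{0<..c}|lborel. H x) = 0" for c
    proof (cases "c > 0")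
      case True
      then show ?thesis using H0[OF True] half_line_truncated_eq(1)[of c H] by simp
    next
      case False
      then have "{0<..c} = {}" by auto
      then show ?thesis by (simp add: set_lebesgue_integral_def)
    qed
    show "integrable lborel (\<lambda>x. indicator {0<..real N} x *\<^sub>R H x)"
      using Hl half_line_truncated_eq(2)[of "real N" H] by (simp add: set_integrable_def)
    show "(LINT x|lborel. indicator {0<..real N} x *\<^sub>R H x) = 0"
      using *[of "real N"] by (simp add: set_lebesgue_integral_def)
    fix a :: real
    have eq: "indicat_real {..a} x *\<^sub>R indicat_real {0<..real N} x *\<^sub>R H x = indicat_real {0<..min a (real N)} x *\<^sub>R H x" for x
      by (auto split: split_indicator)
    show "(LINT x:{..a}|lborel. indicator {0<..real N} x *\<^sub>R H x) = 0"
      unfolding set_lebesgue_integral_def eq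
      by (rule *[of "min a (real N)", unfolded set_lebesgue_integral_def])
  qed
  then have "AE x in lborel. \<forall>N::nat. indicator {0<..real N} x *\<^sub>R H x = 0"
    unfolding AE_all_countable by blast
  then have "AE x in lborel. 0 < x \<longrightarrow> H x = 0"
  proof eventually_elim
    case (elim x)
    obtain N :: nat where "x \<le> real N" using real_arch_simple by blast
    then show ?case using elim[rule_format, of N] by (auto split: split_indicator_asm)
  qed
  then have "AE x in half_line. u x = A * of_real x + integral {0..x} (\<lambda>s. integral {0..s} f)"
    unfolding AE_half_line
    by eventually_elim (auto simp: H_def F_def w_def f1_def[abs_def] diff_eq_eq)
  then show thesis by (rule that)
qed


section \<open>Regularity and energy of time slices\<close>

definition square_integrable :: "(real \<Rightarrow> complex) \<Rightarrow> bool" where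
  "square_integrable f \<longleftrightarrow>
     f \<in> borel_measurable half_line \<and> integrable half_line (\<lambda>x. (norm (f x))\<^sup>2)"

text \<open>The square of the \<open>L\<^sup>2\<close> norm; it is conserved by the evolution.\<close>

definition mass :: "(real \<Rightarrow> complex) \<Rightarrow> real" where
  "mass f = (LINT x|half_line. (norm (f x))\<^sup>2)"

lemma mass_nonneg: "0 \<le> mass f"
  unfolding mass_def by (rule integral_nonneg_AE) simp

lemma square_integrable_measurable: "square_integrable f \<Longrightarrow> f \<in> borel_measurable half_line"
  by (simp add: square_integrable_def)

lemma square_integrable_mult_norm:
  assumes "square_integrable f" "square_integrable g"
  shows "integrable half_line (\<lambda>x. norm (f x) * norm (g x))"
    and "(LINT x|half_line. norm (f x) * norm (g x)) \<le> sqrt (mass f * mass g)"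
proof -
  have [measurable]: "f \<in> borel_measurable half_line" "g \<in> borel_measurable half_line"
    using assms by (auto simp: square_integrable_def)
  have i: "integrable half_line (\<lambda>x. (norm (f x))\<^sup>2)" "integrable half_line (\<lambda>x. (norm (g x))\<^sup>2)"
    using assms by (auto simp: square_integrable_def)
  show "integrable half_line (\<lambda>x. norm (f x) * norm (g x))"
    by (rule Cauchy_Schwarz_integral(1)[OF _ _ i]) measurable
  have "(LINT x|half_line. \<bar>norm (f x) * norm (g x)\<bar>)\<^sup>2 \<le> mass f * mass g"
    unfolding mass_def by (rule Cauchy_Schwarz_integral(2)[OF _ _ i]) measurable
  then have "(LINT x|half_line. norm (f x) * norm (g x))\<^sup>2 \<le> mass f * mass g"
    by (simp add: abs_mult)
  then show "(LINT x|half_line. norm (f x) * norm (g x)) \<le> sqrt (mass f * mass g)"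
    by (rule real_le_rsqrt)
qed

lemma square_integrable_AE_cong:
  assumes "square_integrable f" "AE x in half_line. f x = g x" "g \<in> borel_measurable half_line"
  shows "square_integrable g" "mass g = mass f"
proof -
  have [measurable]: "f \<in> borel_measurable half_line" using assms by (simp add: square_integrable_def)
  note [measurable] = assms(3)
  have eq: "AE x in half_line. (norm (f x))\<^sup>2 = (norm (g x))\<^sup>2" using assms(2) by eventually_elim simp
  have "integrable half_line (\<lambda>x. (norm (f x))\<^sup>2) = integrable half_line (\<lambda>x. (norm (g x))\<^sup>2)"
    by (rule integrable_cong_AE[OF _ _ eq]) measurable
  then show "square_integrable g" using assms by (simp add: square_integrable_def)
  show "mass g = mass f"
    unfolding mass_def by (rule sym, rule integral_cong_AE[OF _ _ eq]) measurable
qed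

lemma indicator_atMost_measurable_half_line [measurable]: "indicat_real {..y} \<in> borel_measurable half_line"
  by (rule borel_measurable_half_lineI) simp

lemma ident_measurable_half_line [measurable]: "(\<lambda>x. x) \<in> borel_measurable half_line"
  by (rule borel_measurable_half_lineI) simp

lemma square_integrable_locally:
  assumes "square_integrable f"
  shows "integrable half_line (\<lambda>x. indicator {..y} x *\<^sub>R f x)"
proof -
  have [measurable]: "f \<in> borel_measurable half_line" using assms by (simp add: square_integrable_def)
  have 1: "integrable half_line (\<lambda>x. indicator {..y} x *\<^sub>R (1::real))"
    by (rule half_line_truncated_continuous) simp
  have 2: "integrable half_line (\<lambda>x. (norm (f x))\<^sup>2)" using assms by (simp add: square_integrable_def)
  show ?thesis
  proof (rule Bochner_Integration.integrable_bound[OF Bochner_Integration.integrable_add[OF 1 2]])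
    show "AE x in half_line. norm (indicator {..y} x *\<^sub>R f x) \<le> norm (indicator {..y} x *\<^sub>R 1 + (norm (f x))\<^sup>2)"
    proof (rule AE_I2)
      fix x
      have "norm (f x) \<le> 1 + (norm (f x))\<^sup>2"
      proof -
        have "2 * norm (f x) \<le> 1 + (norm (f x))\<^sup>2"
          using sum_squares_bound[of 1 "norm (f x)"] by simp
        then show ?thesis using norm_ge_zero[of "f x"] by linarith
      qed
      then show "norm (indicator {..y} x *\<^sub>R f x) \<le> norm (indicator {..y} x *\<^sub>R 1 + (norm (f x))\<^sup>2)"
        by (auto split: split_indicator)
    qed
  qed measurable
qed

text \<open>The time slice of a solution, with \<open>G\<close> in the place of the time derivative: the equation
  \<open>i h u\<^sub>t = h\<^sup>2 u\<^sub>x\<^sub>x - x u\<close> becomes the ordinary differential equation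
  \<open>h\<^sup>2 U'' = x U + i h G\<close>, and \<open>D\<close> is \<open>U'\<close>.\<close>

definition classical_profile :: "real \<Rightarrow> (real \<Rightarrow> complex) \<Rightarrow> (real \<Rightarrow> complex) \<Rightarrow> (real \<Rightarrow> complex) \<Rightarrow> bool" where
  "classical_profile h U D G \<longleftrightarrow> U 0 = 0 \<and> continuous_on {0..} G \<and>
     (\<forall>x\<ge>0. (U has_vector_derivative D x) (at x within {0..})) \<and>
     (\<forall>x\<ge>0. (D has_vector_derivative ((of_real x * U x + \<i> * of_real h * G x) / (of_real h)\<^sup>2)) (at x within {0..}))"

text \<open>The du Bois-Reymond lemma gives a representative \<open>U\<close> that is continuously differentiable. The
  last conclusion is a bootstrap: once \<open>g\<close> itself is known to be continuous, \<open>U\<close> is twice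
  continuously differentiable.\<close>

lemma dirichlet_regularity:
  fixes u g :: "real \<Rightarrow> complex"
  assumes \<theta>: "smooth_fun \<theta>" "\<And>x. 0 \<le> \<theta> x" "\<And>x. \<theta> x \<le> 1"
      "\<And>x. x \<le> 0 \<Longrightarrow> \<theta> x = 0" "\<And>x. 1 \<le> x \<Longrightarrow> \<theta> x = 1"
    and h: "h > 0" and u: "square_integrable u" and g: "square_integrable g"
    and weak: "\<And>\<phi>. \<phi> \<in> Cc_infinity UNIV \<Longrightarrow> \<phi> 0 = 0 \<Longrightarrow>
      (of_real h)\<^sup>2 * (LINT x|half_line. u x * of_real (deriv (deriv \<phi>) x)) =
      (LINT x|half_line. of_real x * u x * of_real (\<phi> x)) + \<i> * of_real h * (LINT x|half_line. g x * of_real (\<phi> x))"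
  obtains U D where "AE x in half_line. u x = U x" "U 0 = 0"
    "\<And>x. 0 \<le> x \<Longrightarrow> (U has_vector_derivative D x) (at x within {0..})" "continuous_on {0..} D"
    "\<And>G. continuous_on {0..} G \<Longrightarrow> AE x in half_line. g x = G x \<Longrightarrow> classical_profile h U D G"
proof -
  define f where "f x = (of_real x * u x + \<i> * of_real h * g x) / (of_real h)\<^sup>2" for x
  have [measurable]: "u \<in> borel_measurable half_line" "g \<in> borel_measurable half_line"
    using u g by (auto simp: square_integrable_def)
  have fm: "f \<in> borel_measurable half_line"
    unfolding f_def[abs_def] by measurable
  have xl: "integrable half_line (\<lambda>x. indicator {..y} x *\<^sub>R (of_real x * u x))" for y
  proof (rule Bochner_Integration.integrable_bound[OF integrable_scaleR_right[OF square_integrable_locally[OF u], of y y]])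
    show "AE x in half_line. norm (indicator {..y} x *\<^sub>R (of_real x * u x)) \<le> norm (y *\<^sub>R indicator {..y} x *\<^sub>R u x)"
      by (rule AE_I2) (auto simp: space_half_line norm_mult mult_right_mono split: split_indicator)
  qed measurable
  have fl: "integrable half_line (\<lambda>x. indicator {..y} x *\<^sub>R f x)" for y
  proof -
    have "integrable half_line (\<lambda>x. (indicator {..y} x *\<^sub>R (of_real x * u x) +
        (\<i> * of_real h) * (indicator {..y} x *\<^sub>R g x)) / (of_real h)\<^sup>2)"
      using square_integrable_locally[OF g, of y] xl[of y]
      by (intro integrable_divide_zero Bochner_Integration.integrable_add integrable_mult_right)
    moreover have "(\<lambda>x. (indicator {..y} x *\<^sub>R (of_real x * u x) +
        (\<i> * of_real h) * (indicator {..y} x *\<^sub>R g x)) / (of_real h)\<^sup>2) = (\<lambda>x. indicator {..y} x *\<^sub>R f x)"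
      by (auto simp: fun_eq_iff f_def split: split_indicator)
    ultimately show ?thesis by simp
  qed
  have weak': "(LINT x|half_line. u x * of_real (deriv (deriv \<phi>) x)) = (LINT x|half_line. f x * of_real (\<phi> x))"
    if \<phi>: "\<phi> \<in> Cc_infinity UNIV" "\<phi> 0 = 0" for \<phi>
  proof -
    obtain B where B: "smooth_fun \<phi>" "\<And>x. \<bar>x\<bar> \<ge> B \<Longrightarrow> \<phi> x = 0" "B > 0"
      using Cc_infinityE[OF \<phi>(1)] by metis
    have c: "continuous_on {0..} (\<lambda>x. complex_of_real (\<phi> x))"
      by (intro continuous_intros smooth_fun_continuous B)
    have i1: "integrable half_line (\<lambda>x. of_real x * u x * of_real (\<phi> x))"
      by (rule half_line_integrable_local[OF xl c, of B]) (use B in auto)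
    have i2: "integrable half_line (\<lambda>x. g x * of_real (\<phi> x))"
      by (rule half_line_integrable_local[OF square_integrable_locally[OF g] c, of B]) (use B in auto)
    have "(LINT x|half_line. f x * of_real (\<phi> x)) =
        (LINT x|half_line. (of_real x * u x * of_real (\<phi> x) + \<i> * of_real h * (g x * of_real (\<phi> x))) / (of_real h)\<^sup>2)"
      by (rule Bochner_Integration.integral_cong) (auto simp: f_def algebra_simps)
    also have "\<dots> = ((LINT x|half_line. of_real x * u x * of_real (\<phi> x)) + \<i> * of_real h * (LINT x|half_line. g x * of_real (\<phi> x))) / (of_real h)\<^sup>2"
      using i1 i2 by simp
    also have "\<dots> = (LINT x|half_line. u x * of_real (deriv (deriv \<phi>) x))"
      unfolding weak[OF \<phi>, symmetric] using h by simp
    finally show ?thesis ..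
  qed
  obtain A where A: "AE x in half_line. u x = A * of_real x + integral {0..x} (\<lambda>s. integral {0..s} f)"
    using du_Bois_Reymond_half_line[OF \<theta> square_integrable_locally[OF u] square_integrable_measurable[OF u] fl fm weak'] by blast
  define f1 where "f1 s = integral {0..s} f" for s
  define U where "U x = A * of_real x + integral {0..x} f1" for x
  define D where "D x = A + f1 x" for x
  have f1c: "continuous_on {0..} f1"
    unfolding f1_def[abs_def]
    by (rule indefinite_integral_continuous_atLeast) (rule half_line_truncated_integral(1)[OF fl])
  have Dc: "continuous_on {0..} D"
    unfolding D_def[abs_def] by (intro continuous_intros f1c)
  have UD: "(U has_vector_derivative D x) (at x within {0..})" if "0 \<le> x" for x
  proof -
    have "((\<lambda>x. A * complex_of_real x) has_vector_derivative A * of_real 1) (at x within {0..})"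
      by (intro has_vector_derivative_mult_right has_vector_derivative_of_real) (rule DERIV_ident)
    from has_vector_derivative_add[OF this integral_has_vector_derivative_atLeast[OF f1c that]]
    show ?thesis by (simp add: U_def[abs_def] D_def)
  qed
  have uU: "AE x in half_line. u x = U x"
    using A by (simp add: U_def f1_def[abs_def])
  have U0: "U 0 = 0" by (simp add: U_def)
  have Uc: "continuous_on {0..} U"
    using has_vector_derivative_continuous[OF UD] by (simp add: continuous_on_eq_continuous_within)
  have "classical_profile h U D G" if G: "continuous_on {0..} G" "AE x in half_line. g x = G x" for G
  proof -
    define F where "F x = (of_real x * U x + \<i> * of_real h * G x) / (of_real h)\<^sup>2" for x
    have Fc: "continuous_on {0..} F"
      unfolding F_def[abs_def] using h by (intro continuous_intros Uc G) auto
    have Fm: "F \<in> borel_measurable half_line" by (rule borel_measurable_half_line_continuous[OF Fc])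
    have fF: "AE x in half_line. f x = F x"
      using uU G(2) by eventually_elim (simp add: f_def F_def)
    have "f1 y = integral {0..y} F" for y
    proof -
      note [measurable] = fm Fm
      have "f1 y = (LINT x|half_line. indicator {..y} x *\<^sub>R f x)"
        unfolding f1_def by (rule half_line_truncated_integral(2)[OF fl, symmetric])
      also have "\<dots> = (LINT x|half_line. indicator {..y} x *\<^sub>R F x)"
      proof (rule integral_cong_AE)
        show "AE x in half_line. indicat_real {..y} x *\<^sub>R f x = indicat_real {..y} x *\<^sub>R F x"
          using fF by eventually_elim simp
      qed measurable
      also have "\<dots> = integral {0..y} F"
        by (rule half_line_truncated_integral(2)[OF half_line_truncated_continuous[OF continuous_on_subset[OF Fc]]]) auto
      finally show ?thesis .
    qed
    then have "D = (\<lambda>x. A + integral {0..x} F)" by (simp add: D_def fun_eq_iff)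
    then have "(D has_vector_derivative F x) (at x within {0..})" if "0 \<le> x" for x
      using has_vector_derivative_add[OF has_vector_derivative_const integral_has_vector_derivative_atLeast[OF Fc that]]
      by simp
    then show ?thesis
      unfolding classical_profile_def using U0 G(1) UD by (simp add: F_def)
  qed
  then show thesis using that[OF uU U0 UD Dc] by blast
qed

text \<open>The local form of the Morawetz identity, with \<open>U = a + i b\<close>, \<open>U' = p + i q\<close>, \<open>G = c + i d\<close>
  and \<open>R\<close> a primitive of \<open>\<bar>U\<bar>\<^sup>2\<close>. The differentiated function is
  \<open>2h R Im(cnj U G) + h\<^sup>2 \<rho> \<rho>' + 2h\<^sup>2 R \<bar>U'\<bar>\<^sup>2 - 2x R \<rho>\<close> for \<open>\<rho> = \<bar>U\<bar>\<^sup>2\<close>. The terms carrying the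
  potential cancel, except for \<open>-2 R \<rho> = -(R\<^sup>2)'\<close>, because the derivative of \<open>x\<close> is constant;
  the kinetic terms combine by \<open>4 \<rho> \<bar>U'\<bar>\<^sup>2 = (\<rho>')\<^sup>2 + 4 (Im (cnj U U'))\<^sup>2\<close>.\<close>

lemma morawetz_flux_derivative:
  fixes a b c d p q R :: "real \<Rightarrow> real"
  assumes "(a has_real_derivative p x) F" "(b has_real_derivative q x) F"
    and "(p has_real_derivative P) F" "(q has_real_derivative Q) F"
    and "(c has_real_derivative e) F" "(d has_real_derivative f) F"
    and "(R has_real_derivative (a x)\<^sup>2 + (b x)\<^sup>2) F" and F: "F = at x within S"
    and P: "h\<^sup>2 * P = x * a x - h * d x" and Q: "h\<^sup>2 * Q = x * b x + h * c x"
  shows "((\<lambda>x. 2 * h * R x * (a x * d x - b x * c x) + 2 * h\<^sup>2 * ((a x)\<^sup>2 + (b x)\<^sup>2) * (a x * p x + b x * q x)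
      + 2 * h\<^sup>2 * R x * ((p x)\<^sup>2 + (q x)\<^sup>2) - 2 * x * R x * ((a x)\<^sup>2 + (b x)\<^sup>2)) has_real_derivative
      R x * (2 * h * ((a x * f - b x * e) - (d x * p x - c x * q x))) + (2 * h * (a x * q x - b x * p x))\<^sup>2
      + 2 * h\<^sup>2 * (2 * (a x * p x + b x * q x))\<^sup>2 - 2 * R x * ((a x)\<^sup>2 + (b x)\<^sup>2)) F"
proof -
  note [derivative_intros] = assms(1-7)[unfolded F]
  show ?thesis
    unfolding F
    apply (rule derivative_eq_intros refl)+
    using P Q
    apply (simp add: power2_eq_square)
    apply algebra
    done
qed

lemma real_product_derivatives:
  fixes a b p q :: "real \<Rightarrow> real"
  assumes "(a has_real_derivative a') (at x within S)" "(b has_real_derivative b') (at x within S)"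
    and "(p has_real_derivative p') (at x within S)" "(q has_real_derivative q') (at x within S)"
  shows "((\<lambda>x. a x * p x + b x * q x) has_real_derivative a' * p x + a x * p' + b' * q x + b x * q') (at x within S)"
    and "((\<lambda>x. a x * q x - b x * p x) has_real_derivative a' * q x + a x * q' - b' * p x - b x * p') (at x within S)"
proof -
  note [derivative_intros] = assms
  show "((\<lambda>x. a x * p x + b x * q x) has_real_derivative a' * p x + a x * p' + b' * q x + b x * q') (at x within S)"
    "((\<lambda>x. a x * q x - b x * p x) has_real_derivative a' * q x + a x * q' - b' * p x - b x * p') (at x within S)"
    by (rule derivative_eq_intros refl | simp)+
qed

context
  fixes h :: real and U D G :: "real \<Rightarrow> complex"
  assumes prof: "classical_profile h U D G"
begin

lemma profile_continuous: "continuous_on {0..} U" "continuous_on {0..} D" "continuous_on {0..} G"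
proof -
  have 1: "\<And>x. 0 \<le> x \<Longrightarrow> (U has_vector_derivative D x) (at x within {0..})"
    and 2: "\<And>x. 0 \<le> x \<Longrightarrow> (D has_vector_derivative ((of_real x * U x + \<i> * of_real h * G x) / (of_real h)\<^sup>2)) (at x within {0..})"
    using prof by (auto simp: classical_profile_def)
  show "continuous_on {0..} U" "continuous_on {0..} D"
    using has_vector_derivative_continuous[OF 1] has_vector_derivative_continuous[OF 2]
    by (auto simp: continuous_on_eq_continuous_within)
  show "continuous_on {0..} G" using prof by (auto simp: classical_profile_def)
qed

lemma profile_measurable:
  "U \<in> borel_measurable half_line" "D \<in> borel_measurable half_line" "G \<in> borel_measurable half_line"
  by (intro borel_measurable_half_line_continuous profile_continuous)+

lemma profile_Re_Im_derivative:
  assumes "0 \<le> x"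
  shows "((\<lambda>x. Re (U x)) has_real_derivative Re (D x)) (at x within {0..})"
    and "((\<lambda>x. Im (U x)) has_real_derivative Im (D x)) (at x within {0..})"
    and "((\<lambda>x. Re (D x)) has_real_derivative (x * Re (U x) - h * Im (G x)) / h\<^sup>2) (at x within {0..})"
    and "((\<lambda>x. Im (D x)) has_real_derivative (x * Im (U x) + h * Re (G x)) / h\<^sup>2) (at x within {0..})"
proof -
  have 1: "(U has_vector_derivative D x) (at x within {0..})"
    and 2: "(D has_vector_derivative ((of_real x * U x + \<i> * of_real h * G x) / (of_real h)\<^sup>2)) (at x within {0..})"
    using prof assms by (auto simp: classical_profile_def)
  have r: "Re ((of_real x * U x + \<i> * of_real h * G x) / (of_real h)\<^sup>2) = (x * Re (U x) - h * Im (G x)) / h\<^sup>2"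
    and i: "Im ((of_real x * U x + \<i> * of_real h * G x) / (of_real h)\<^sup>2) = (x * Im (U x) + h * Re (G x)) / h\<^sup>2"
    by (simp_all flip: of_real_power add: mult_ac)
  note * = bounded_linear.has_vector_derivative[OF bounded_linear_Re] bounded_linear.has_vector_derivative[OF bounded_linear_Im]
  show "((\<lambda>x. Re (U x)) has_real_derivative Re (D x)) (at x within {0..})"
    "((\<lambda>x. Im (U x)) has_real_derivative Im (D x)) (at x within {0..})"
    "((\<lambda>x. Re (D x)) has_real_derivative (x * Re (U x) - h * Im (G x)) / h\<^sup>2) (at x within {0..})"
    "((\<lambda>x. Im (D x)) has_real_derivative (x * Im (U x) + h * Re (G x)) / h\<^sup>2) (at x within {0..})"
    using *[OF 1] *[OF 2]
    by (simp_all add: has_real_derivative_iff_has_vector_derivative r i)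
qed

lemma profile_Re_Im_continuous:
  "continuous_on S (\<lambda>x. Re (U x))" "continuous_on S (\<lambda>x. Im (U x))"
  "continuous_on S (\<lambda>x. Re (D x))" "continuous_on S (\<lambda>x. Im (D x))"
  "continuous_on S (\<lambda>x. Re (G x))" "continuous_on S (\<lambda>x. Im (G x))" if "S \<subseteq> {0..}"
  by (intro continuous_intros continuous_on_subset[OF profile_continuous(1) that]
      continuous_on_subset[OF profile_continuous(2) that] continuous_on_subset[OF profile_continuous(3) that])+

end

lemma norm_sq_Re_Im: "(norm (z::complex))\<^sup>2 = (Re z)\<^sup>2 + (Im z)\<^sup>2"
  by (simp add: cmod_power2)

lemma profile_density_derivative:
  assumes prof: "classical_profile h U D G" and x: "0 \<le> x"
  shows "((\<lambda>x. (norm (U x))\<^sup>2) has_real_derivative 2 * (Re (U x) * Re (D x) + Im (U x) * Im (D x))) (at x within {0..})"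
  unfolding norm_sq_Re_Im unfolding power2_eq_square
  by (rule DERIV_cong[OF real_product_derivatives(1)[OF profile_Re_Im_derivative(1,2,1,2)[OF assms]]]) simp

text \<open>The identity \<open>h\<^sup>2 \<bar>U'\<bar>\<^sup>2 + x \<bar>U\<bar>\<^sup>2 = h\<^sup>2 (Re (cnj U U'))' + h Im (cnj U G)\<close> bounds the energy on
  \<open>[0, y]\<close> up to the boundary term \<open>h\<^sup>2 (\<bar>U\<bar>\<^sup>2)'(y) / 2\<close>. If the energy exceeded the bound at some
  point, it would from then on, so \<open>\<bar>U\<bar>\<^sup>2\<close> would grow at least linearly, against integrability. Since \<open>G\<close> is the time derivative, of size \<open>1/h\<close> after the frequency
  cut-off, this is what bounds \<open>h U'\<close>.\<close>

lemma profile_energy: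
  assumes h: "h > 0" and prof: "classical_profile h U D G"
    and sqU: "square_integrable U" and sqG: "square_integrable G"
  shows "square_integrable D" "integrable half_line (\<lambda>x. x * (norm (U x))\<^sup>2)"
  "h\<^sup>2 * mass D \<le> h * sqrt (mass U * mass G)"
proof -
  define e where "e x = h\<^sup>2 * (norm (D x))\<^sup>2 + x * (norm (U x))\<^sup>2" for x
  define k where "k x = h * (norm (U x) * norm (G x))" for x
  define B where "B x = Re (U x) * Re (D x) + Im (U x) * Im (D x)" for x
  define K where "K = (LINT x|half_line. k x)"
  have ki: "integrable half_line k"
    unfolding k_def[abs_def] by (intro integrable_mult_right square_integrable_mult_norm sqU sqG)
  have kc: "continuous_on {0..} k"
    unfolding k_def[abs_def] by (intro continuous_intros profile_continuous[OF prof])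
  have ec: "continuous_on {0..} e"
    unfolding e_def[abs_def] by (intro continuous_intros profile_continuous[OF prof])
  have e0: "0 \<le> e x" if "0 \<le> x" for x using that by (simp add: e_def)
  have k0: "0 \<le> k x" for x using h by (simp add: k_def)
  have eI: "integrable half_line (\<lambda>x. indicator {..w} x *\<^sub>R e x)" for w
    by (intro half_line_truncated_continuous continuous_on_subset[OF ec]) auto
  have trunc: "(LINT x|half_line. indicator {..y} x *\<^sub>R e x) \<le> h\<^sup>2 * B y + K" if "0 \<le> y" for y
  proof -
    define r where "r x = h * (Re (U x) * Im (G x) - Im (U x) * Re (G x))" for x
    have rk: "\<bar>r x\<bar> \<le> k x" for x
    proof -
      have "Re (U x) * Im (G x) - Im (U x) * Re (G x) = Im (cnj (U x) * G x)" by simp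
      also have "\<bar>\<dots>\<bar> \<le> norm (cnj (U x) * G x)" by (rule abs_Im_le_cmod)
      also have "\<dots> = norm (U x) * norm (G x)" by (simp add: norm_mult)
      finally show ?thesis using h by (simp add: r_def k_def abs_mult)
    qed
    have "(LINT x|half_line. indicator {..y} x *\<^sub>R (e x - r x)) = h\<^sup>2 * B y - h\<^sup>2 * B 0"
    proof (rule half_line_truncated_FTC[OF that])
      show "continuous_on {0..y} (\<lambda>x. e x - r x)"
        unfolding r_def by (intro continuous_intros continuous_on_subset[OF ec] profile_Re_Im_continuous[OF prof]) auto
      fix x :: real assume x: "0 \<le> x"
      have "((\<lambda>x. h\<^sup>2 * B x) has_real_derivative e x - r x) (at x within {0..})"
        unfolding B_def[abs_def]
        by (rule DERIV_cong[OF DERIV_cmult[OF real_product_derivatives(1)[OF profile_Re_Im_derivative[OF prof x]]]])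
           (use h in \<open>unfold e_def r_def norm_sq_Re_Im, simp add: field_simps power2_eq_square\<close>)
      then show "((\<lambda>x. h\<^sup>2 * B x) has_vector_derivative e x - r x) (at x within {0..})"
        by (simp add: has_real_derivative_iff_has_vector_derivative)
    qed
    moreover have "B 0 = 0" using prof by (simp add: B_def classical_profile_def)
    moreover have "(LINT x|half_line. indicator {..y} x *\<^sub>R e x) - K \<le> (LINT x|half_line. indicator {..y} x *\<^sub>R (e x - r x))"
    proof -
      have i1: "integrable half_line (\<lambda>x. indicator {..y} x *\<^sub>R e x)"
        and i2: "integrable half_line (\<lambda>x. indicator {..y} x *\<^sub>R (e x - r x))"
        unfolding r_def
        by (intro half_line_truncated_continuous continuous_intros continuous_on_subset[OF ec] profile_Re_Im_continuous[OF prof]; auto)+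
      have "(LINT x|half_line. indicator {..y} x *\<^sub>R e x - k x) \<le> (LINT x|half_line. indicator {..y} x *\<^sub>R (e x - r x))"
      proof (rule integral_mono)
        fix x
        show "indicator {..y} x *\<^sub>R e x - k x \<le> indicator {..y} x *\<^sub>R (e x - r x)"
          using rk[of x] k0[of x] by (auto split: split_indicator)
      qed (use i1 i2 ki in auto)
      then show ?thesis using i1 ki by (simp add: K_def)
    qed
    ultimately show ?thesis by simp
  qed
  have bound: "(LINT x|half_line. indicator {..y} x *\<^sub>R e x) \<le> K" if y: "0 \<le> y" for y
  proof (rule ccontr)
    define T where "T y = (LINT x|half_line. indicator {..y} x *\<^sub>R e x)" for y
    assume "\<not> ?thesis"
    then have lt: "K < T y" by (simp add: T_def)
    have mono: "T y \<le> T z" if "y \<le> z" for z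
      unfolding T_def
    proof (rule integral_mono[OF eI eI])
      show "indicator {..y} x *\<^sub>R e x \<le> indicator {..z} x *\<^sub>R e x" if "x \<in> space half_line" for x
        using that e0[of x] \<open>y \<le> z\<close> by (auto simp: space_half_line split: split_indicator)
    qed
    define s where "s = 2 * (T y - K) / h\<^sup>2"
    have s: "s > 0" using lt h by (simp add: s_def)
    have grow: "s * (z - y) \<le> (norm (U z))\<^sup>2" if "y \<le> z" for z
    proof -
      have "(norm (U y))\<^sup>2 - s * y \<le> (norm (U z))\<^sup>2 - s * z"
      proof (rule DERIV_nonneg_imp_increasing_open[OF that])
        show "\<exists>w. ((\<lambda>x. (norm (U x))\<^sup>2 - s * x) has_real_derivative w) (at x) \<and> 0 \<le> w" if x: "y < x" "x < z" for x
        proof -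
          have "0 < x" using x y by simp
          then have at: "at x within {0..} = at x" by (intro at_within_interior) auto
          have "((\<lambda>x. (norm (U x))\<^sup>2 - s * x) has_real_derivative 2 * B x - s) (at x within {0..})"
            unfolding B_def
            by (rule derivative_eq_intros profile_density_derivative[OF prof] refl | use \<open>0 < x\<close> in simp)+
          moreover have "T y \<le> h\<^sup>2 * B x + K"
            using mono[of x] trunc[of x] x \<open>0 < x\<close> by (simp add: T_def)
          then have "s \<le> 2 * B x" using h by (simp add: s_def field_simps)
          ultimately show ?thesis unfolding at by auto
        qed
        show "continuous_on {y..z} (\<lambda>x. (norm (U x))\<^sup>2 - s * x)"
          using y by (intro continuous_intros continuous_on_subset[OF profile_continuous(1)[OF prof]]) auto
      qed
      then show ?thesis by (simp add: algebra_simps) (smt (verit) zero_le_power2)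
    qed
    have "eventually (\<lambda>z. 1 \<le> (norm (U z))\<^sup>2) at_top"
      using eventually_ge_at_top[of "y + 1 / s"]
    proof eventually_elim
      case (elim z)
      have "y \<le> z" using elim s by (smt (verit) divide_pos_pos)
      moreover have "1 \<le> s * (z - y)" using elim s by (simp add: field_simps)
      ultimately show ?case using grow by fastforce
    qed
    then obtain Z where Z: "\<And>z. z \<ge> Z \<Longrightarrow> 1 \<le> (norm (U z))\<^sup>2"
      unfolding eventually_at_top_linorder by auto
    have "integrable half_line (\<lambda>x. indicator {Z..} x *\<^sub>R (1::real))"
    proof (rule Bochner_Integration.integrable_bound)
      show "integrable half_line (\<lambda>x. (norm (U x))\<^sup>2)" using sqU by (simp add: square_integrable_def)
      show "(\<lambda>x. indicator {Z..} x *\<^sub>R (1::real)) \<in> borel_measurable half_line"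
        by (rule borel_measurable_half_lineI) simp
      show "AE x in half_line. norm (indicator {Z..} x *\<^sub>R (1::real)) \<le> norm ((norm (U x))\<^sup>2)"
        using Z by (intro AE_I2) (auto split: split_indicator)
    qed
    moreover have "((\<lambda>x. indicator {Z..} x *\<^sub>R (1::real)) \<longlongrightarrow> 1) at_top"
      by (rule tendsto_eventually) (use eventually_ge_at_top[of Z] in eventually_elim, simp)
    ultimately have "(1::real) = 0" by (rule half_line_integrable_limit_zero)
    then show False by simp
  qed
  have em: "e \<in> borel_measurable half_line" by (rule borel_measurable_half_line_continuous[OF ec])
  have incr: "mono (\<lambda>n. LINT x|half_line. indicator {..real n} x *\<^sub>R e x)"
  proof (rule monoI, rule integral_mono[OF eI eI])
    show "indicator {..real m} x *\<^sub>R e x \<le> indicator {..real n} x *\<^sub>R e x" if "m \<le> n" "x \<in> space half_line" for m n x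
      using that e0[of x] by (auto simp: space_half_line split: split_indicator)
  qed
  have "\<exists>L. (\<lambda>n. LINT x|half_line. indicator {..real n} x *\<^sub>R e x) \<longlonglongrightarrow> L"
    using incseq_convergent[OF incr, of K] bound by (metis of_nat_0_le_iff)
  then obtain L where L: "(\<lambda>n. LINT x|half_line. indicator {..real n} x *\<^sub>R e x) \<longlonglongrightarrow> L" ..
  have LK: "L \<le> K" by (rule LIMSEQ_le_const2[OF L]) (use bound in auto)
  have lim: "(\<lambda>n. indicator {..real n} x *\<^sub>R e x) \<longlonglongrightarrow> e x" for x
  proof (rule tendsto_eventually)
    obtain N :: nat where "x \<le> real N" using real_arch_simple by blast
    then show "eventually (\<lambda>n. indicator {..real n} x *\<^sub>R e x = e x) sequentially"
      unfolding eventually_sequentially by (intro exI[of _ N]) auto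
  qed
  have ei: "integrable half_line e" and eL: "(LINT x|half_line. e x) = L"
  proof -
    note * = eI[of "real _"]
    have m: "AE x in half_line. mono (\<lambda>n. indicator {..real n} x *\<^sub>R e x)"
      by (rule AE_I2) (auto simp: mono_def space_half_line e0 less_imp_le split: split_indicator)
    have p: "AE x in half_line. 0 \<le> indicator {..real i} x *\<^sub>R e x" for i
      by (rule AE_I2) (auto simp: space_half_line e0 less_imp_le split: split_indicator)
    show "integrable half_line e"
      by (rule integral_monotone_convergence_nonneg(1)[OF * m p AE_I2[OF lim] L em])
    show "(LINT x|half_line. e x) = L"
      by (rule integral_monotone_convergence_nonneg(2)[OF * m p AE_I2[OF lim] L em])
  qed
  note [measurable] = profile_measurable[OF prof]
  have Di: "integrable half_line (\<lambda>x. h\<^sup>2 * (norm (D x))\<^sup>2)"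
    by (rule Bochner_Integration.integrable_bound[OF ei])
       (auto intro!: AE_I2 simp: e_def space_half_line)
  then have "integrable half_line (\<lambda>x. (norm (D x))\<^sup>2)" using h by simp
  then show sD: "square_integrable D" using profile_measurable[OF prof] by (simp add: square_integrable_def)
  show xi: "integrable half_line (\<lambda>x. x * (norm (U x))\<^sup>2)"
    by (rule Bochner_Integration.integrable_bound[OF ei])
       (auto intro!: AE_I2 simp: e_def space_half_line)
  have "h\<^sup>2 * mass D = (LINT x|half_line. h\<^sup>2 * (norm (D x))\<^sup>2)" by (simp add: mass_def)
  also have "\<dots> \<le> (LINT x|half_line. e x)"
    by (rule integral_mono[OF Di ei]) (simp add: e_def space_half_line)
  also have "\<dots> \<le> K" using eL LK by simp
  also have "K \<le> h * sqrt (mass U * mass G)"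
    unfolding K_def k_def using h square_integrable_mult_norm(2)[OF sqU sqG] by simp
  finally show "h\<^sup>2 * mass D \<le> h * sqrt (mass U * mass G)" .
qed


section \<open>Fluxes and the Morawetz identity at a fixed time\<close>

text \<open>The continuity equation \<open>\<rho>\<^sub>t = j\<^sub>x\<close>, integrated from the boundary, where the current \<open>j\<close>
  vanishes with \<open>U\<close>.\<close>

lemma profile_mass_flux:
  assumes h: "h > 0" and prof: "classical_profile h U D G" and y: "0 \<le> y"
  shows "(LINT x|half_line. indicator {..y} x *\<^sub>R (2 * (Re (U x) * Re (G x) + Im (U x) * Im (G x)))) =
    2 * h * (Re (U y) * Im (D y) - Im (U y) * Re (D y))"
proof -
  have "(LINT x|half_line. indicator {..y} x *\<^sub>R (2 * (Re (U x) * Re (G x) + Im (U x) * Im (G x)))) =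
      2 * h * (Re (U y) * Im (D y) - Im (U y) * Re (D y)) - 2 * h * (Re (U 0) * Im (D 0) - Im (U 0) * Re (D 0))"
  proof (rule half_line_truncated_FTC[OF y])
    show "continuous_on {0..y} (\<lambda>x. 2 * (Re (U x) * Re (G x) + Im (U x) * Im (G x)))"
      by (intro continuous_intros profile_Re_Im_continuous[OF prof]) auto
    fix x :: real assume x: "0 \<le> x"
    show "((\<lambda>x. 2 * h * (Re (U x) * Im (D x) - Im (U x) * Re (D x))) has_vector_derivative
        2 * (Re (U x) * Re (G x) + Im (U x) * Im (G x))) (at x within {0..})"
      unfolding has_real_derivative_iff_has_vector_derivative[symmetric]
      by (rule DERIV_cong[OF DERIV_cmult[OF real_product_derivatives(2)[OF profile_Re_Im_derivative[OF prof x]]]])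
         (use h in \<open>simp add: field_simps power2_eq_square\<close>)
  qed
  then show ?thesis using prof by (simp add: classical_profile_def)
qed

text \<open>The time derivative of the preceding identity. Here \<open>G\<close> stands for \<open>u\<^sub>t\<close> and \<open>K\<close> for \<open>u\<^sub>t\<^sub>t\<close>; differentiating
  the current only in this form keeps third space derivatives out of the proof.\<close>

lemma profile_second_flux:
  assumes h: "h > 0" and prof: "classical_profile h U D G" and prof': "classical_profile h G E K" and y: "0 \<le> y"
  shows "(LINT x|half_line. indicator {..y} x *\<^sub>R
      (2 * ((norm (G x))\<^sup>2 + (Re (U x) * Re (K x) + Im (U x) * Im (K x))))) =
    2 * h * ((Re (U y) * Im (E y) - Im (U y) * Re (E y)) - (Im (G y) * Re (D y) - Re (G y) * Im (D y)))"
proof -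
  have "(LINT x|half_line. indicator {..y} x *\<^sub>R
      (2 * ((norm (G x))\<^sup>2 + (Re (U x) * Re (K x) + Im (U x) * Im (K x))))) =
    2 * h * ((Re (U y) * Im (E y) - Im (U y) * Re (E y)) - (Im (G y) * Re (D y) - Re (G y) * Im (D y))) -
    2 * h * ((Re (U 0) * Im (E 0) - Im (U 0) * Re (E 0)) - (Im (G 0) * Re (D 0) - Re (G 0) * Im (D 0)))"
  proof (rule half_line_truncated_FTC[OF y])
    show "continuous_on {0..y} (\<lambda>x. 2 * ((norm (G x))\<^sup>2 + (Re (U x) * Re (K x) + Im (U x) * Im (K x))))"
      by (intro continuous_intros profile_Re_Im_continuous[OF prof] profile_Re_Im_continuous[OF prof']
          continuous_on_subset[OF profile_continuous(1)[OF prof']]) auto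
    fix x :: real assume x: "0 \<le> x"
    note d = profile_Re_Im_derivative[OF prof x] and d' = profile_Re_Im_derivative[OF prof' x]
    show "((\<lambda>x. 2 * h * ((Re (U x) * Im (E x) - Im (U x) * Re (E x)) - (Im (G x) * Re (D x) - Re (G x) * Im (D x))))
        has_vector_derivative
        2 * ((norm (G x))\<^sup>2 + (Re (U x) * Re (K x) + Im (U x) * Im (K x)))) (at x within {0..})"
      unfolding has_real_derivative_iff_has_vector_derivative[symmetric]
      by (rule DERIV_cong[OF DERIV_cmult[OF DERIV_diff[OF real_product_derivatives(2)[OF d(1,2) d'(3,4)]
              real_product_derivatives(2)[OF d'(2,1) d(4,3)]]]])
         (use h in \<open>unfold norm_sq_Re_Im, simp add: field_simps power2_eq_square\<close>)
  qed
  then show ?thesis using prof prof' by (simp add: classical_profile_def)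
qed

lemma abs_Re_Im_pairing_le:
  "\<bar>Re z * Re w + Im z * Im w\<bar> \<le> norm z * norm w"
  "\<bar>Re z * Im w - Im z * Re w\<bar> \<le> norm z * norm w"
proof -
  have "\<bar>Re (cnj z * w)\<bar> \<le> norm (cnj z * w)" "\<bar>Im (cnj z * w)\<bar> \<le> norm (cnj z * w)"
    by (rule abs_Re_le_cmod, rule abs_Im_le_cmod)
  then show "\<bar>Re z * Re w + Im z * Im w\<bar> \<le> norm z * norm w"
    "\<bar>Re z * Im w - Im z * Re w\<bar> \<le> norm z * norm w"
    by (simp_all add: norm_mult)
qed

definition density_slope :: "(real \<Rightarrow> complex) \<Rightarrow> (real \<Rightarrow> complex) \<Rightarrow> real \<Rightarrow> real" where
  "density_slope U D x = 2 * (Re (U x) * Re (D x) + Im (U x) * Im (D x))"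

context
  fixes h :: real and U D G E K :: "real \<Rightarrow> complex"
  assumes h: "h > 0" and prof: "classical_profile h U D G"
    and sqU: "square_integrable U" and sqG: "square_integrable G"
begin

lemmas sqD = profile_energy(1)[OF h prof sqU sqG]
lemmas cont = profile_continuous[OF prof]
lemmas recont = profile_Re_Im_continuous[OF prof order_refl]

lemma density_slope_continuous: "continuous_on {0..} (density_slope U D)"
  unfolding density_slope_def[abs_def] by (intro continuous_intros recont)

lemma density_slope_le: "\<bar>density_slope U D x\<bar> \<le> 2 * (norm (U x) * norm (D x))"
  using abs_Re_Im_pairing_le(1)[of "U x" "D x"] by (simp add: density_slope_def)

lemma density_derivative:
  "0 \<le> x \<Longrightarrow> ((\<lambda>x. (norm (U x))\<^sup>2) has_real_derivative density_slope U D x) (at x within {0..})"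
  unfolding density_slope_def by (rule profile_density_derivative[OF prof])

text \<open>\<open>\<bar>U\<bar>\<^sup>2\<close> vanishes at \<open>0\<close> and has derivative at most \<open>2 \<bar>U\<bar> \<bar>U'\<bar>\<close>.\<close>

lemma profile_sup_bound:
  assumes y: "0 \<le> y"
  shows "(norm (U y))\<^sup>2 \<le> 2 * sqrt (mass U * mass D)"
proof -
  have i: "integrable half_line (\<lambda>x. 2 * (norm (U x) * norm (D x)))"
    by (intro integrable_mult_right square_integrable_mult_norm sqU sqD)
  have "(norm (U y))\<^sup>2 = (LINT x|half_line. indicator {..y} x *\<^sub>R density_slope U D x)"
  proof -
    have "(LINT x|half_line. indicator {..y} x *\<^sub>R density_slope U D x) = (norm (U y))\<^sup>2 - (norm (U 0))\<^sup>2"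
      by (rule half_line_truncated_FTC[OF y continuous_on_subset[OF density_slope_continuous]])
         (use density_derivative in \<open>auto simp: has_real_derivative_iff_has_vector_derivative\<close>)
    then show ?thesis using prof by (simp add: classical_profile_def)
  qed
  also have "\<dots> \<le> (LINT x|half_line. 2 * (norm (U x) * norm (D x)))"
  proof (rule integral_mono[OF half_line_truncated_continuous[OF continuous_on_subset[OF density_slope_continuous]] i])
    fix x show "indicator {..y} x *\<^sub>R density_slope U D x \<le> 2 * (norm (U x) * norm (D x))"
      using density_slope_le[of x] by (auto split: split_indicator)
  qed auto
  also have "\<dots> \<le> 2 * sqrt (mass U * mass D)"
    using square_integrable_mult_norm(2)[OF sqU sqD] by simp
  finally show ?thesis .
qed

lemma density_slope_square_integrable: "integrable half_line (\<lambda>x. (density_slope U D x)\<^sup>2)"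
proof (rule Bochner_Integration.integrable_bound[where f = "\<lambda>x. 8 * sqrt (mass U * mass D) * (norm (D x))\<^sup>2"])
  show "integrable half_line (\<lambda>x. 8 * sqrt (mass U * mass D) * (norm (D x))\<^sup>2)"
    using sqD by (intro integrable_mult_right) (simp add: square_integrable_def)
  show "(\<lambda>x. (density_slope U D x)\<^sup>2) \<in> borel_measurable half_line"
    by (intro borel_measurable_half_line_continuous continuous_intros density_slope_continuous)
  show "AE x in half_line. norm ((density_slope U D x)\<^sup>2) \<le> norm (8 * sqrt (mass U * mass D) * (norm (D x))\<^sup>2)"
  proof (rule AE_I2)
    fix x assume "x \<in> space half_line"
    then have x: "0 \<le> x" by (simp add: space_half_line)
    have "(density_slope U D x)\<^sup>2 \<le> (2 * (norm (U x) * norm (D x)))\<^sup>2"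
      using density_slope_le[of x] by (metis abs_ge_zero power2_abs power_mono)
    also have "\<dots> = 4 * (norm (U x))\<^sup>2 * (norm (D x))\<^sup>2" by (simp add: power_mult_distrib)
    also have "\<dots> \<le> 4 * (2 * sqrt (mass U * mass D)) * (norm (D x))\<^sup>2"
      using profile_sup_bound[OF x] by (intro mult_mono) (auto intro: mult_nonneg_nonneg mass_nonneg)
    finally show "norm ((density_slope U D x)\<^sup>2) \<le> norm (8 * sqrt (mass U * mass D) * (norm (D x))\<^sup>2)"
      using mass_nonneg by simp
  qed
qed

text \<open>Gagliardo-Nirenberg: with \<open>\<rho> = \<bar>U\<bar>\<^sup>2\<close> and \<open>S = sup \<rho>\<close>, one has
  \<open>\<rho>\<^sup>2 \<le> 2 \<integral> \<rho> \<bar>\<rho>'\<bar> \<le> 2 (S \<integral> \<rho>)\<^bsup>1/2\<^esup> (\<integral> (\<rho>')\<^sup>2)\<^bsup>1/2\<^esup>\<close>; take the supremum and solve for \<open>S\<close>, which is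
  finite by the preceding bound. This converts the Morawetz bound on \<open>\<rho>'\<close> into a bound on the maximum.\<close>

lemma profile_sup_sixth_power:
  assumes y: "0 \<le> y"
  shows "(norm (U y)) ^ 6 \<le> 4 * mass U * (LINT x|half_line. (density_slope U D x)\<^sup>2)"
proof -
  define S where "S = (SUP x\<in>{0..}. (norm (U x))\<^sup>2)"
  define H where "H = (LINT x|half_line. (density_slope U D x)\<^sup>2)"
  have H0: "0 \<le> H" unfolding H_def by (rule integral_nonneg_AE) simp
  have bdd: "bdd_above ((\<lambda>x. (norm (U x))\<^sup>2) ` {0..})"
    by (rule bdd_aboveI[of _ "2 * sqrt (mass U * mass D)"]) (auto intro: profile_sup_bound)
  have US: "(norm (U x))\<^sup>2 \<le> S" if "0 \<le> x" for x
    unfolding S_def by (rule cSUP_upper[OF _ bdd]) (use that in auto)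
  have S0: "0 \<le> S" using US[of 0] by (smt (verit) zero_le_power2)
  have Um: "U \<in> borel_measurable half_line" using sqU by (simp add: square_integrable_def)
  note [measurable] = Um
  have dm[measurable]: "density_slope U D \<in> borel_measurable half_line"
    by (rule borel_measurable_half_line_continuous[OF density_slope_continuous])
  have iU: "integrable half_line (\<lambda>x. (norm (U x))\<^sup>2)" using sqU by (simp add: square_integrable_def)
  have p4: "((norm (U x))\<^sup>2)\<^sup>2 \<le> S * (norm (U x))\<^sup>2" if "x \<in> space half_line" for x
    unfolding power2_eq_square[of "(norm (U x))\<^sup>2"]
    by (rule mult_right_mono) (use that in \<open>auto intro!: US simp: space_half_line\<close>)
  have i4: "integrable half_line (\<lambda>x. ((norm (U x))\<^sup>2)\<^sup>2)"
  proof (rule Bochner_Integration.integrable_bound[OF integrable_mult_right[OF iU, of S]])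
    show "AE x in half_line. norm (((norm (U x))\<^sup>2)\<^sup>2) \<le> norm (S * (norm (U x))\<^sup>2)"
      using order_trans[OF p4 abs_ge_self] by (intro AE_I2) simp
  qed measurable
  have m4: "(LINT x|half_line. ((norm (U x))\<^sup>2)\<^sup>2) \<le> S * mass U"
  proof -
    have "(LINT x|half_line. ((norm (U x))\<^sup>2)\<^sup>2) \<le> (LINT x|half_line. S * (norm (U x))\<^sup>2)"
      by (rule integral_mono[OF i4 integrable_mult_right[OF iU] p4])
    then show ?thesis by (simp add: mass_def)
  qed
  have key: "((norm (U x))\<^sup>2)\<^sup>2 \<le> 2 * sqrt (S * mass U * H)" if x: "0 \<le> x" for x
  proof -
    have "(LINT s|half_line. indicator {..x} s *\<^sub>R (2 * ((norm (U s))\<^sup>2 * density_slope U D s))) = ((norm (U x))\<^sup>2)\<^sup>2 - ((norm (U 0))\<^sup>2)\<^sup>2"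
    proof (rule half_line_truncated_FTC[OF x])
      show "continuous_on {0..x} (\<lambda>s. 2 * ((norm (U s))\<^sup>2 * density_slope U D s))"
        by (intro continuous_intros continuous_on_subset[OF density_slope_continuous] continuous_on_subset[OF cont(1)]) auto
      show "((\<lambda>s. ((norm (U s))\<^sup>2)\<^sup>2) has_vector_derivative 2 * ((norm (U s))\<^sup>2 * density_slope U D s)) (at s within {0..})"
        if "0 \<le> s" for s
        unfolding has_real_derivative_iff_has_vector_derivative[symmetric] power2_eq_square[of "(norm (U _))\<^sup>2"]
        by (rule DERIV_cong[OF DERIV_mult[OF density_derivative[OF that] density_derivative[OF that]]]) simp
    qed
    then have "((norm (U x))\<^sup>2)\<^sup>2 = (LINT s|half_line. indicator {..x} s *\<^sub>R (2 * ((norm (U s))\<^sup>2 * density_slope U D s)))"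
      using prof by (simp add: classical_profile_def)
    also have "\<dots> \<le> (LINT s|half_line. 2 * \<bar>(norm (U s))\<^sup>2 * density_slope U D s\<bar>)"
    proof (rule integral_mono)
      show "integrable half_line (\<lambda>s. indicator {..x} s *\<^sub>R (2 * ((norm (U s))\<^sup>2 * density_slope U D s)))"
        by (intro half_line_truncated_continuous continuous_intros continuous_on_subset[OF density_slope_continuous] continuous_on_subset[OF cont(1)]) auto
      show "integrable half_line (\<lambda>s. 2 * \<bar>(norm (U s))\<^sup>2 * density_slope U D s\<bar>)"
        by (intro integrable_mult_right integrable_abs Cauchy_Schwarz_integral(1)[OF _ _ i4 density_slope_square_integrable]) measurable
      show "indicator {..x} s *\<^sub>R (2 * ((norm (U s))\<^sup>2 * density_slope U D s)) \<le> 2 * \<bar>(norm (U s))\<^sup>2 * density_slope U D s\<bar>" for s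
        using abs_ge_self[of "(norm (U s))\<^sup>2 * density_slope U D s"] abs_ge_zero[of "(norm (U s))\<^sup>2 * density_slope U D s"]
        by (auto split: split_indicator)
    qed
    also have "\<dots> = 2 * (LINT s|half_line. \<bar>(norm (U s))\<^sup>2 * density_slope U D s\<bar>)" by simp
    also have "\<dots> \<le> 2 * sqrt (S * mass U * H)"
    proof -
      have "(LINT s|half_line. \<bar>(norm (U s))\<^sup>2 * density_slope U D s\<bar>)\<^sup>2 \<le> (LINT x|half_line. ((norm (U x))\<^sup>2)\<^sup>2) * H"
        unfolding H_def by (rule Cauchy_Schwarz_integral(2)[OF _ _ i4 density_slope_square_integrable]) measurable
      also have "\<dots> \<le> S * mass U * H" using m4 H0 by (rule mult_right_mono)
      finally show ?thesis by (intro mult_left_mono real_le_rsqrt) auto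
    qed
    finally show ?thesis .
  qed
  define M where "M = 2 * sqrt (S * mass U * H)"
  have M0: "0 \<le> M" using S0 mass_nonneg H0 by (simp add: M_def)
  have "S \<le> sqrt M"
    unfolding S_def by (rule cSUP_least) (use key in \<open>auto simp: M_def intro!: real_le_rsqrt\<close>)
  then have "S\<^sup>2 \<le> M" using S0 M0 by (metis power_mono real_sqrt_pow2)
  then have "(S\<^sup>2)\<^sup>2 \<le> M\<^sup>2" by (intro power_mono) auto
  also have "M\<^sup>2 = S * (4 * mass U * H)"
    using S0 mass_nonneg[of U] H0 by (simp add: M_def power_mult_distrib)
  finally have "S * S ^ 3 \<le> S * (4 * mass U * H)" by (simp add: power2_eq_square power3_eq_cube mult_ac)
  then have "S ^ 3 \<le> 4 * mass U * H"
    using S0 mass_nonneg[of U] H0 by (cases "S = 0") auto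
  moreover have "(norm (U y)) ^ 6 \<le> S ^ 3"
    using power_mono[OF US[OF y], of 3] by (simp flip: power_mult)
  ultimately show ?thesis by (simp add: H_def)
qed

end

lemma integrable_half_line_bound:
  fixes f :: "real \<Rightarrow> real"
  assumes "integrable half_line w" "continuous_on {0..} f" "\<And>x. 0 < x \<Longrightarrow> \<bar>f x\<bar> \<le> w x"
  shows "integrable half_line f"
proof (rule Bochner_Integration.integrable_bound[OF assms(1)])
  show "f \<in> borel_measurable half_line" by (rule borel_measurable_half_line_continuous) fact
  show "AE x in half_line. norm (f x) \<le> norm (w x)"
    using assms(3) by (intro AE_I2) (force simp: space_half_line)
qed

text \<open>Integrate the local identity over the half-line. All boundary terms vanish: at \<open>0\<close> because
  \<open>R\<close> and \<open>U\<close> do, which is why reflection at the boundary costs nothing, and at infinity by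
  integrability. The left-hand side will be the time derivative of \<open>\<integral> R j\<close>, as \<open>R\<^sub>t = j\<close> and \<open>j\<^sub>t = l\<close>.\<close>

lemma morawetz_identity:
  fixes U D G E K :: "real \<Rightarrow> complex"
  assumes h: "h > 0" and prof: "classical_profile h U D G" and prof': "classical_profile h G E K"
    and sqU: "square_integrable U" and sqG: "square_integrable G" and sqK: "square_integrable K"
  defines "R \<equiv> \<lambda>y. LINT x|half_line. indicator {..y} x *\<^sub>R (norm (U x))\<^sup>2"
    and "j \<equiv> \<lambda>y. 2 * h * (Re (U y) * Im (D y) - Im (U y) * Re (D y))"
    and "l \<equiv> \<lambda>y. 2 * h * ((Re (U y) * Im (E y) - Im (U y) * Re (E y)) - (Im (G y) * Re (D y) - Re (G y) * Im (D y)))"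
  shows "integrable half_line j" "integrable half_line l"
    "integrable half_line (\<lambda>y. (j y)\<^sup>2)" "integrable half_line (\<lambda>y. R y * l y)"
    "(LINT y|half_line. (j y)\<^sup>2 + R y * l y) = (mass U)\<^sup>2 - 2 * h\<^sup>2 * (LINT y|half_line. (density_slope U D y)\<^sup>2)"
proof -
  note [measurable] = profile_measurable[OF prof] profile_measurable[OF prof']
  note sqD = profile_energy(1)[OF h prof sqU sqG] and sqE = profile_energy(1)[OF h prof' sqG sqK]
  note xi = profile_energy(2)[OF h prof sqU sqG]
  note cU = profile_continuous[OF prof] and cG = profile_continuous[OF prof']
  note rc = profile_Re_Im_continuous[OF prof order_refl] profile_Re_Im_continuous[OF prof' order_refl]
  note ds = density_slope_square_integrable[OF h prof sqU sqG] density_slope_le[OF h prof sqU sqG]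
    density_slope_continuous[OF h prof sqU sqG]
  note prod = square_integrable_mult_norm(1)
  define B where "B = 2 * sqrt (mass U * mass D)"
  have UB: "(norm (U y))\<^sup>2 \<le> B" if "0 \<le> y" for y
    unfolding B_def by (rule profile_sup_bound[OF h prof sqU sqG that])
  have iU: "integrable half_line (\<lambda>x. (norm (U x))\<^sup>2)" and iD: "integrable half_line (\<lambda>x. (norm (D x))\<^sup>2)"
    using sqU sqD by (auto simp: square_integrable_def)
  have jc: "continuous_on {0..} j" and lc: "continuous_on {0..} l"
    unfolding j_def l_def by (intro continuous_intros rc)+
  have R: "R y = integral {0..y} (\<lambda>x. (norm (U x))\<^sup>2)" if "0 \<le> y" for y
    unfolding R_def
    by (rule half_line_truncated_integral(2)[OF half_line_truncated_continuous])
       (intro continuous_intros continuous_on_subset[OF cU(1)], auto)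
  have Rd: "(R has_real_derivative (norm (U x))\<^sup>2) (at x within {0..})" if x: "0 \<le> x" for x
  proof -
    have "((\<lambda>y. integral {0..y} (\<lambda>x. (norm (U x))\<^sup>2)) has_vector_derivative (norm (U x))\<^sup>2) (at x within {0..})"
      by (rule integral_has_vector_derivative_atLeast[OF _ x]) (intro continuous_intros cU)
    then have "(R has_vector_derivative (norm (U x))\<^sup>2) (at x within {0..})"
      by (rule has_vector_derivative_transform[rotated 2]) (use R x in auto)
    then show ?thesis by (simp add: has_real_derivative_iff_has_vector_derivative)
  qed
  have Rc: "continuous_on {0..} R"
    using Rd DERIV_continuous by (fastforce simp: continuous_on_eq_continuous_within)
  have R0: "0 \<le> R y" for y
    unfolding R_def by (rule integral_nonneg_AE) (auto split: split_indicator)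
  have Rm: "R y \<le> mass U" for y
    unfolding R_def mass_def
  proof (rule integral_mono[OF _ iU])
    show "integrable half_line (\<lambda>x. indicator {..y} x *\<^sub>R (norm (U x))\<^sup>2)"
      by (intro half_line_truncated_continuous continuous_intros continuous_on_subset[OF cU(1)]) auto
  qed (auto split: split_indicator)
  have jb: "\<bar>j x\<bar> \<le> 2 * h * (norm (U x) * norm (D x))" for x
    using abs_Re_Im_pairing_le(2)[of "U x" "D x"] h by (simp add: j_def abs_mult)
  have lb: "\<bar>l x\<bar> \<le> 2 * h * (norm (U x) * norm (E x) + norm (G x) * norm (D x))" for x
  proof -
    have "\<bar>(Re (U x) * Im (E x) - Im (U x) * Re (E x)) - (Im (G x) * Re (D x) - Re (G x) * Im (D x))\<bar>
        \<le> norm (U x) * norm (E x) + norm (G x) * norm (D x)"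
      using abs_Re_Im_pairing_le(2)[of "U x" "E x"] abs_Re_Im_pairing_le(2)[of "G x" "D x"] by linarith
    then show ?thesis using h by (simp add: l_def abs_mult)
  qed
  show ij: "integrable half_line j"
    by (rule integrable_half_line_bound[OF integrable_mult_right[OF prod[OF sqU sqD], of "2 * h"] jc jb])
  show il: "integrable half_line l"
    by (rule integrable_half_line_bound[OF integrable_mult_right[OF
          Bochner_Integration.integrable_add[OF prod[OF sqU sqE] prod[OF sqG sqD]], of "2 * h"] lc lb])
  show ij2: "integrable half_line (\<lambda>y. (j y)\<^sup>2)"
  proof (rule integrable_half_line_bound[OF integrable_mult_right[OF iD, of "4 * h\<^sup>2 * B"]])
    show "continuous_on {0..} (\<lambda>y. (j y)\<^sup>2)" by (intro continuous_intros jc)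
    fix x :: real assume x: "0 < x"
    have "(j x)\<^sup>2 \<le> (2 * h * (norm (U x) * norm (D x)))\<^sup>2"
      using jb[of x] by (metis abs_ge_zero power2_abs power_mono)
    also have "\<dots> = 4 * h\<^sup>2 * (norm (U x))\<^sup>2 * (norm (D x))\<^sup>2" by (simp add: power_mult_distrib)
    also have "\<dots> \<le> 4 * h\<^sup>2 * B * (norm (D x))\<^sup>2"
      using UB[of x] x by (intro mult_right_mono mult_left_mono) auto
    finally show "\<bar>(j x)\<^sup>2\<bar> \<le> 4 * h\<^sup>2 * B * (norm (D x))\<^sup>2" by simp
  qed
  have Rmult: "integrable half_line (\<lambda>y. R y * f y)" if "integrable half_line f" "continuous_on {0..} f" for f
  proof (rule integrable_half_line_bound[OF integrable_mult_right[OF integrable_abs[OF that(1)], of "mass U"]])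
    show "continuous_on {0..} (\<lambda>y. R y * f y)" by (intro continuous_intros Rc that)
    show "\<bar>R x * f x\<bar> \<le> mass U * \<bar>f x\<bar>" for x
      using R0[of x] Rm[of x] by (simp add: abs_mult mult_right_mono)
  qed
  show iRl: "integrable half_line (\<lambda>y. R y * l y)" by (rule Rmult[OF il lc])
  have iRU: "integrable half_line (\<lambda>y. R y * (norm (U y))\<^sup>2)"
    by (rule Rmult[OF iU]) (intro continuous_intros cU)
  define \<Phi> where "\<Phi> x = 2 * h * R x * (Re (U x) * Im (G x) - Im (U x) * Re (G x))
      + 2 * h\<^sup>2 * ((Re (U x))\<^sup>2 + (Im (U x))\<^sup>2) * (Re (U x) * Re (D x) + Im (U x) * Im (D x))
      + 2 * h\<^sup>2 * R x * ((Re (D x))\<^sup>2 + (Im (D x))\<^sup>2) - 2 * x * R x * ((Re (U x))\<^sup>2 + (Im (U x))\<^sup>2)" for x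
  define \<phi> where "\<phi> x = R x * l x + (j x)\<^sup>2 + 2 * h\<^sup>2 * (density_slope U D x)\<^sup>2 - 2 * (R x * (norm (U x))\<^sup>2)" for x
  have "(LINT x|half_line. \<phi> x) = - \<Phi> 0"
  proof (rule half_line_integral_derivative)
    fix x :: real assume x: "0 \<le> x"
    note d = profile_Re_Im_derivative[OF prof x] and d' = profile_Re_Im_derivative[OF prof' x]
    have "(\<Phi> has_real_derivative
      R x * (2 * h * ((Re (U x) * Im (E x) - Im (U x) * Re (E x)) - (Im (G x) * Re (D x) - Re (G x) * Im (D x))))
      + (2 * h * (Re (U x) * Im (D x) - Im (U x) * Re (D x)))\<^sup>2
      + 2 * h\<^sup>2 * (2 * (Re (U x) * Re (D x) + Im (U x) * Im (D x)))\<^sup>2 - 2 * R x * ((Re (U x))\<^sup>2 + (Im (U x))\<^sup>2)) (at x within {0..})"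
      unfolding \<Phi>_def[abs_def]
      by (rule morawetz_flux_derivative[OF d d'(1,2) Rd[OF x, unfolded norm_sq_Re_Im] refl])
         (use h in auto)
    then show "(\<Phi> has_vector_derivative \<phi> x) (at x within {0..})"
      by (simp add: has_real_derivative_iff_has_vector_derivative \<phi>_def l_def j_def density_slope_def norm_sq_Re_Im mult.assoc)
  next
    show "continuous_on {0..} \<phi>"
      unfolding \<phi>_def[abs_def] by (intro continuous_intros Rc lc jc ds(3) cU)
    show "integrable half_line \<phi>"
      unfolding \<phi>_def[abs_def]
      by (intro Bochner_Integration.integrable_diff Bochner_Integration.integrable_add iRl ij2 integrable_mult_right ds(1) iRU)
    have i1: "integrable half_line (\<lambda>x. R x * (Re (U x) * Im (G x) - Im (U x) * Re (G x)))"
      by (intro Rmult integrable_half_line_bound[OF prod[OF sqU sqG]] continuous_intros rc abs_Re_Im_pairing_le)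
    have i2: "integrable half_line (\<lambda>x. (norm (U x))\<^sup>2 * (Re (U x) * Re (D x) + Im (U x) * Im (D x)))"
    proof (rule integrable_half_line_bound[OF integrable_mult_right[OF prod[OF sqU sqD], of B]])
      show "continuous_on {0..} (\<lambda>x. (norm (U x))\<^sup>2 * (Re (U x) * Re (D x) + Im (U x) * Im (D x)))"
        by (intro continuous_intros rc cU)
      show "\<bar>(norm (U x))\<^sup>2 * (Re (U x) * Re (D x) + Im (U x) * Im (D x))\<bar> \<le> B * (norm (U x) * norm (D x))" if "0 < x" for x
        unfolding abs_mult[of "(norm (U x))\<^sup>2"]
        using UB[of x] that abs_Re_Im_pairing_le(1)[of "U x" "D x"] by (intro mult_mono) (auto intro: order_trans[of _ "(norm (U x))\<^sup>2"])
    qed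
    have i3: "integrable half_line (\<lambda>x. R x * (norm (D x))\<^sup>2)"
      by (rule Rmult[OF iD]) (intro continuous_intros cU)
    have i4: "integrable half_line (\<lambda>x. R x * (x * (norm (U x))\<^sup>2))"
      by (rule Rmult[OF xi]) (intro continuous_intros cU)
    have eq: "\<Phi> = (\<lambda>x. 2 * h * (R x * (Re (U x) * Im (G x) - Im (U x) * Re (G x)))
      + 2 * h\<^sup>2 * ((norm (U x))\<^sup>2 * (Re (U x) * Re (D x) + Im (U x) * Im (D x)))
      + 2 * h\<^sup>2 * (R x * (norm (D x))\<^sup>2) - 2 * (R x * (x * (norm (U x))\<^sup>2)))"
      by (simp add: \<Phi>_def fun_eq_iff norm_sq_Re_Im mult_ac)
    show "integrable half_line \<Phi>"
      unfolding eq
      by (intro Bochner_Integration.integrable_diff Bochner_Integration.integrable_add integrable_mult_right i1 i2 i3 i4)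
  qed
  moreover have "R 0 = 0" using R[of 0] by simp
  then have "\<Phi> 0 = 0" using prof by (simp add: \<Phi>_def classical_profile_def)
  moreover have "(LINT x|half_line. \<phi> x) = (LINT y|half_line. (j y)\<^sup>2 + R y * l y)
      + 2 * h\<^sup>2 * (LINT y|half_line. (density_slope U D y)\<^sup>2) - 2 * (LINT y|half_line. R y * (norm (U y))\<^sup>2)"
    unfolding \<phi>_def using iRl ij2 ds(1) iRU by simp
  moreover have "2 * (LINT y|half_line. R y * (norm (U y))\<^sup>2) = (mass U)\<^sup>2"
  proof -
    have "((\<lambda>y. LINT x|half_line. indicator {..y} x *\<^sub>R (2 * (R x * (norm (U x))\<^sup>2))) \<longlongrightarrow>
        (LINT x|half_line. 2 * (R x * (norm (U x))\<^sup>2))) at_top"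
      by (rule half_line_truncated_tendsto) (intro integrable_mult_right iRU)
    moreover have "eventually (\<lambda>y. (LINT x|half_line. indicator {..y} x *\<^sub>R (2 * (R x * (norm (U x))\<^sup>2))) = (R y)\<^sup>2) at_top"
      using eventually_ge_at_top[of 0]
    proof eventually_elim
      case (elim y)
      have "(LINT x|half_line. indicator {..y} x *\<^sub>R (2 * (R x * (norm (U x))\<^sup>2))) = (R y)\<^sup>2 - (R 0)\<^sup>2"
      proof (rule half_line_truncated_FTC[OF elim])
        show "continuous_on {0..y} (\<lambda>x. 2 * (R x * (norm (U x))\<^sup>2))"
          by (intro continuous_intros continuous_on_subset[OF Rc] continuous_on_subset[OF cU(1)]) auto
        show "((\<lambda>y. (R y)\<^sup>2) has_vector_derivative 2 * (R x * (norm (U x))\<^sup>2)) (at x within {0..})" if "0 \<le> x" for x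
          unfolding has_real_derivative_iff_has_vector_derivative[symmetric] power2_eq_square[of "R _"]
          by (rule DERIV_cong[OF DERIV_mult[OF Rd[OF that] Rd[OF that]]]) simp
      qed
      then show ?case using \<open>R 0 = 0\<close> by simp
    qed
    ultimately have "((\<lambda>y. (R y)\<^sup>2) \<longlongrightarrow> (LINT x|half_line. 2 * (R x * (norm (U x))\<^sup>2))) at_top"
      by (rule Lim_transform_eventually)
    moreover have "((\<lambda>y. (R y)\<^sup>2) \<longlongrightarrow> (mass U)\<^sup>2) at_top"
      unfolding R_def mass_def by (intro tendsto_power half_line_truncated_tendsto iU)
    ultimately show ?thesis
      using tendsto_unique[OF trivial_limit_at_top_linorder] by fastforce
  qed
  ultimately show "(LINT y|half_line. (j y)\<^sup>2 + R y * l y) =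
      (mass U)\<^sup>2 - 2 * h\<^sup>2 * (LINT y|half_line. (density_slope U D y)\<^sup>2)" by linarith
qed


section \<open>Time averages of a solution\<close>

lemma square_integrable_compact_support:
  fixes g :: "real \<Rightarrow> real"
  assumes "continuous_on {0..} g" "\<And>x. x > B \<Longrightarrow> g x = 0"
  shows "square_integrable (\<lambda>x. complex_of_real (g x))"
  unfolding square_integrable_def
proof
  show "(\<lambda>x. complex_of_real (g x)) \<in> borel_measurable half_line"
    by (intro borel_measurable_half_line_continuous continuous_intros assms)
  show "integrable half_line (\<lambda>x. (norm (complex_of_real (g x)))\<^sup>2)"
    by (rule half_line_integrable_compact_support[where B = B])
       (use assms in \<open>auto intro!: continuous_intros\<close>)
qed

lemma square_integrable_add:
  assumes "square_integrable f" "square_integrable g"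
  shows "square_integrable (\<lambda>x. f x + g x)"
  unfolding square_integrable_def
proof
  have [measurable]: "f \<in> borel_measurable half_line" "g \<in> borel_measurable half_line"
    using assms by (auto simp: square_integrable_def)
  show "(\<lambda>x. f x + g x) \<in> borel_measurable half_line" by measurable
  have i: "integrable half_line (\<lambda>x. 2 * (norm (f x))\<^sup>2 + 2 * (norm (g x))\<^sup>2)"
    using assms by (auto simp: square_integrable_def)
  show "integrable half_line (\<lambda>x. (norm (f x + g x))\<^sup>2)"
  proof (rule Bochner_Integration.integrable_bound[OF i])
    show "AE x in half_line. norm ((norm (f x + g x))\<^sup>2) \<le> norm (2 * (norm (f x))\<^sup>2 + 2 * (norm (g x))\<^sup>2)"
    proof (rule AE_I2)
      fix x
      have "(norm (f x + g x))\<^sup>2 \<le> (norm (f x) + norm (g x))\<^sup>2"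
        by (intro power_mono norm_triangle_ineq) simp
      also have "\<dots> \<le> 2 * (norm (f x))\<^sup>2 + 2 * (norm (g x))\<^sup>2"
        using sum_squares_bound[of "norm (f x)" "norm (g x)"] by (simp add: power2_sum)
      finally show "norm ((norm (f x + g x))\<^sup>2) \<le> norm (2 * (norm (f x))\<^sup>2 + 2 * (norm (g x))\<^sup>2)" by simp
    qed
  qed measurable
qed

lemma square_integrable_cmult:
  "square_integrable f \<Longrightarrow> square_integrable (\<lambda>x. c * f x)" "mass (\<lambda>x. c * f x) = (norm c)\<^sup>2 * mass f"
  by (auto simp: square_integrable_def mass_def norm_mult power_mult_distrib)

lemma square_integrable_diff:
  assumes "square_integrable f" "square_integrable g"
  shows "square_integrable (\<lambda>x. f x - g x)"
  using square_integrable_add[OF assms(1) square_integrable_cmult(1)[OF assms(2), of "-1"]] by simp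

lemma pairing_bound:
  assumes "square_integrable f" "square_integrable g"
  shows "integrable half_line (\<lambda>x. f x * g x)"
    and "norm (LINT x|half_line. f x * g x) \<le> sqrt (mass f * mass g)"
proof -
  have [measurable]: "f \<in> borel_measurable half_line" "g \<in> borel_measurable half_line"
    using assms by (auto simp: square_integrable_def)
  show "integrable half_line (\<lambda>x. f x * g x)"
    by (rule Bochner_Integration.integrable_bound[OF square_integrable_mult_norm(1)[OF assms]])
       (auto simp: norm_mult)
  have "norm (LINT x|half_line. f x * g x) \<le> (LINT x|half_line. norm (f x * g x))"
    by (rule integral_norm_bound)
  also have "\<dots> \<le> sqrt (mass f * mass g)"
    using square_integrable_mult_norm(2)[OF assms] by (simp add: norm_mult)
  finally show "norm (LINT x|half_line. f x * g x) \<le> sqrt (mass f * mass g)" .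
qed

text \<open>The bounds for averages in time do not involve the equation; they will also be applied to the
  translated curve \<open>v s - v t\<close>, which does not solve it.\<close>

locale L2_curve =
  fixes v :: "real \<Rightarrow> real \<Rightarrow> complex"
  assumes v_measurable: "(\<lambda>(t, x). v t x) \<in> borel_measurable (lborel \<Otimes>\<^sub>M half_line)"
    and v_square: "\<And>t. square_integrable (v t)"
    and v_continuous: "\<And>t. ((\<lambda>s. mass (\<lambda>x. v s x - v t x)) \<longlongrightarrow> 0) (at t)"
begin

lemma v_measurable_compose [measurable]:
  assumes [measurable]: "f \<in> borel_measurable M" "g \<in> measurable M half_line"
  shows "(\<lambda>p. v (f p) (g p)) \<in> borel_measurable M"
proof -
  have "(\<lambda>p. (f p, g p)) \<in> measurable M (lborel \<Otimes>\<^sub>M half_line)" by measurable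
  from measurable_compose[OF this v_measurable] show ?thesis by simp
qed

lemma mass_measurable [measurable]: "(\<lambda>s. mass (v s)) \<in> borel_measurable lborel"
  unfolding mass_def by measurable

text \<open>Under such a weight averages in time converge for almost every \<open>x\<close> and are square integrable.\<close>

definition weight :: "(real \<Rightarrow> real) \<Rightarrow> bool" where
  "weight w \<longleftrightarrow> w \<in> borel_measurable lborel \<and> (\<forall>s. 0 \<le> w s) \<and> integrable lborel w \<and>
     integrable lborel (\<lambda>s. w s * mass (v s))"

text \<open>A bound in space for all averages whose kernel is below \<open>w\<close>, hence uniform in time on
  bounded intervals; it makes dominated convergence in space possible.\<close>

definition majorant :: "(real \<Rightarrow> real) \<Rightarrow> real \<Rightarrow> real" where
  "majorant w x = (LINT s|lborel. w s * norm (v s x))"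

lemma weighted_square_integrable:
  assumes w: "weight w"
  shows "integrable (lborel \<Otimes>\<^sub>M half_line) (\<lambda>(s, x). w s * (norm (v s x))\<^sup>2)"
proof -
  have [measurable]: "w \<in> borel_measurable lborel" using w by (simp add: weight_def)
  show ?thesis
  proof (rule lborel_half_line.Fubini_integrable)
    show "(\<lambda>(s, x). w s * (norm (v s x))\<^sup>2) \<in> borel_measurable (lborel \<Otimes>\<^sub>M half_line)"
      by measurable
    have i: "integrable half_line (\<lambda>x. (norm (v s x))\<^sup>2)" for s
      using v_square by (simp add: square_integrable_def)
    show "AE s in lborel. integrable half_line (\<lambda>x. case (s, x) of (s, x) \<Rightarrow> w s * (norm (v s x))\<^sup>2)"
      using i by simp
    have "(LINT x|half_line. norm (case (s, x) of (s, x) \<Rightarrow> w s * (norm (v s x))\<^sup>2)) = w s * mass (v s)" for s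
      using w by (simp add: mass_def weight_def abs_mult)
    then show "integrable lborel (\<lambda>s. LINT x|half_line. norm (case (s, x) of (s, x) \<Rightarrow> w s * (norm (v s x))\<^sup>2))"
      using w by (simp only: weight_def)
  qed
qed

text \<open>Cauchy-Schwarz in time at fixed \<open>x\<close>, after Tonelli: the null set of \<open>x\<close> to be excluded
  depends on the weight only, so one set serves all kernels and times that the weight dominates.\<close>

lemma weighted_AE_integrable:
  assumes w: "weight w"
  shows "AE x in half_line. integrable lborel (\<lambda>s. w s * (norm (v s x))\<^sup>2) \<and>
    integrable lborel (\<lambda>s. w s * norm (v s x)) \<and>
    (majorant w x)\<^sup>2 \<le> (LINT s|lborel. w s) * (LINT s|lborel. w s * (norm (v s x))\<^sup>2)"
proof -
  have wm[measurable]: "w \<in> borel_measurable lborel" and w0: "\<And>s. 0 \<le> w s" and wi: "integrable lborel w"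
    using w by (auto simp: weight_def)
  have "AE x in half_line. integrable lborel (\<lambda>s. w s * (norm (v s x))\<^sup>2)"
    using lborel_half_line.AE_integrable_snd[OF weighted_square_integrable[OF w]] by simp
  moreover have "AE x in half_line. x \<in> space half_line" by (rule AE_space)
  ultimately show ?thesis
  proof eventually_elim
    case (elim x)
    have [measurable]: "(\<lambda>s. v s x) \<in> borel_measurable lborel"
      by (rule v_measurable_compose) (use elim in auto)
    have e1: "(sqrt (w s))\<^sup>2 = w s" for s using w0 by simp
    have e2: "(sqrt (w s) * norm (v s x))\<^sup>2 = w s * (norm (v s x))\<^sup>2" for s
      using w0 by (simp add: power_mult_distrib)
    have e3: "sqrt (w s) * (sqrt (w s) * norm (v s x)) = w s * norm (v s x)" for s
      using w0 by (simp add: mult.assoc[symmetric])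
    have m: "(\<lambda>s. sqrt (w s)) \<in> borel_measurable lborel" "(\<lambda>s. sqrt (w s) * norm (v s x)) \<in> borel_measurable lborel"
      by measurable
    note CS = Cauchy_Schwarz_integral[OF m, unfolded e1 e2 e3, OF wi elim(1)]
    have a: "(LINT s|lborel. \<bar>w s * norm (v s x)\<bar>) = majorant w x"
      unfolding majorant_def using w0 by (simp add: abs_mult)
    show ?case using elim(1) CS unfolding a by simp
  qed
qed

lemma majorant_measurable [measurable]:
  assumes [measurable]: "w \<in> borel_measurable lborel"
  shows "majorant w \<in> borel_measurable half_line"
  unfolding majorant_def[abs_def] by measurable

lemma majorant_square_integrable:
  assumes w: "weight w"
  shows "integrable half_line (\<lambda>x. (majorant w x)\<^sup>2)"
    and "(LINT x|half_line. (majorant w x)\<^sup>2) \<le> (LINT s|lborel. w s) * (LINT s|lborel. w s * mass (v s))"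
proof -
  have wm[measurable]: "w \<in> borel_measurable lborel" and w0: "\<And>s. 0 \<le> w s" and wi: "integrable lborel w"
    using w by (auto simp: weight_def)
  have sn: "integrable half_line (\<lambda>x. LINT s|lborel. w s * (norm (v s x))\<^sup>2)"
    using lborel_half_line.integrable_snd[OF weighted_square_integrable[OF w]] by simp
  have AE: "AE x in half_line. (majorant w x)\<^sup>2 \<le> (LINT s|lborel. w s) * (LINT s|lborel. w s * (norm (v s x))\<^sup>2)"
    using weighted_AE_integrable[OF w] by eventually_elim simp
  show i: "integrable half_line (\<lambda>x. (majorant w x)\<^sup>2)"
  proof (rule Bochner_Integration.integrable_bound[OF integrable_mult_right[OF sn, of "LINT s|lborel. w s"]])
    show "AE x in half_line. norm ((majorant w x)\<^sup>2) \<le> norm ((LINT s|lborel. w s) * (LINT s|lborel. w s * (norm (v s x))\<^sup>2))"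
      using AE by eventually_elim simp
  qed measurable
  have "(LINT x|half_line. (majorant w x)\<^sup>2) \<le> (LINT x|half_line. (LINT s|lborel. w s) * (LINT s|lborel. w s * (norm (v s x))\<^sup>2))"
    by (rule integral_mono_AE[OF i integrable_mult_right[OF sn] AE])
  also have "\<dots> = (LINT s|lborel. w s) * (LINT x|half_line. LINT s|lborel. w s * (norm (v s x))\<^sup>2)" by simp
  also have "(LINT x|half_line. LINT s|lborel. w s * (norm (v s x))\<^sup>2) = (LINT s|lborel. LINT x|half_line. w s * (norm (v s x))\<^sup>2)"
    by (rule lborel_half_line.Fubini_integral[OF weighted_square_integrable[OF w]])
  also have "\<dots> = (LINT s|lborel. w s * mass (v s))" by (simp add: mass_def)
  finally show "(LINT x|half_line. (majorant w x)\<^sup>2) \<le> (LINT s|lborel. w s) * (LINT s|lborel. w s * mass (v s))" .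
qed

lemma pairing_continuous:
  assumes g: "square_integrable g"
  shows "continuous_on UNIV (\<lambda>s. LINT x|half_line. v s x * g x)"
  unfolding continuous_on_eq_continuous_at[OF open_UNIV]
proof
  fix t
  have "((\<lambda>s. (LINT x|half_line. v s x * g x) - (LINT x|half_line. v t x * g x)) \<longlongrightarrow> 0) (at t)"
  proof (rule Lim_null_comparison)
    show "\<forall>\<^sub>F s in at t. norm ((LINT x|half_line. v s x * g x) - (LINT x|half_line. v t x * g x))
        \<le> sqrt (mass (\<lambda>x. v s x - v t x) * mass g)"
    proof (rule always_eventually, rule allI)
      fix s
      have "(LINT x|half_line. v s x * g x) - (LINT x|half_line. v t x * g x) = (LINT x|half_line. (v s x - v t x) * g x)"
        using pairing_bound(1)[OF v_square g] by (simp add: left_diff_distrib)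
      then show "norm ((LINT x|half_line. v s x * g x) - (LINT x|half_line. v t x * g x))
          \<le> sqrt (mass (\<lambda>x. v s x - v t x) * mass g)"
        using pairing_bound(2)[OF square_integrable_diff[OF v_square v_square] g] by simp
    qed
    have "((\<lambda>s. sqrt (mass (\<lambda>x. v s x - v t x) * mass g)) \<longlongrightarrow> sqrt (0 * mass g)) (at t)"
      by (intro tendsto_intros v_continuous)
    then show "((\<lambda>s. sqrt (mass (\<lambda>x. v s x - v t x) * mass g)) \<longlongrightarrow> 0) (at t)" by simp
  qed
  then show "isCont (\<lambda>s. LINT x|half_line. v s x * g x) t"
    unfolding isCont_def by (simp add: LIM_zero_iff)
qed

definition average :: "(real \<Rightarrow> complex) \<Rightarrow> real \<Rightarrow> real \<Rightarrow> complex" where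
  "average k t x = (LINT s|lborel. k (t - s) * v s x)"

lemma average_measurable_pair:
  assumes [measurable]: "k \<in> borel_measurable borel"
  shows "(\<lambda>(t, x). average k t x) \<in> borel_measurable (lborel \<Otimes>\<^sub>M half_line)"
  unfolding average_def by measurable

lemma average_measurable:
  assumes [measurable]: "k \<in> borel_measurable borel"
  shows "average k t \<in> borel_measurable half_line"
  unfolding average_def[abs_def] by measurable

lemma average_le_majorant:
  assumes w: "weight w"
  shows "AE x in half_line. \<forall>k t. (\<forall>s. norm (k (t - s)) \<le> w s) \<longrightarrow> norm (average k t x) \<le> majorant w x"
  using weighted_AE_integrable[OF w]
proof eventually_elim
  case (elim x)
  show ?case
  proof (intro allI impI)
    fix k :: "real \<Rightarrow> complex" and t assume k: "\<forall>s. norm (k (t - s)) \<le> w s"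
    show "norm (average k t x) \<le> majorant w x"
    proof -
      have "norm (average k t x) \<le> (LINT s|lborel. norm (k (t - s) * v s x))"
        unfolding average_def by (rule integral_norm_bound)
      also have "\<dots> \<le> majorant w x"
        unfolding majorant_def
        by (rule integral_mono') (use elim k w in \<open>auto simp: norm_mult mult_right_mono weight_def\<close>)
      finally show ?thesis .
    qed
  qed
qed

lemma average_square_integrable:
  assumes k[measurable]: "k \<in> borel_measurable borel" and w: "weight w" and le: "\<And>s. norm (k (t - s)) \<le> w s"
  shows "square_integrable (average k t)"
    and "mass (average k t) \<le> (LINT s|lborel. w s) * (LINT s|lborel. w s * mass (v s))"
proof -
  note [measurable] = average_measurable[OF k]
  have AE: "AE x in half_line. (norm (average k t x))\<^sup>2 \<le> (majorant w x)\<^sup>2"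
    using average_le_majorant[OF w] by eventually_elim (use le in \<open>auto intro!: power_mono\<close>)
  note m = majorant_square_integrable[OF w]
  have i: "integrable half_line (\<lambda>x. (norm (average k t x))\<^sup>2)"
  proof (rule Bochner_Integration.integrable_bound[OF m(1)])
    show "AE x in half_line. norm ((norm (average k t x))\<^sup>2) \<le> norm ((majorant w x)\<^sup>2)"
      using AE by eventually_elim simp
  qed measurable
  then show "square_integrable (average k t)"
    using average_measurable[OF k] by (simp add: square_integrable_def)
  have "mass (average k t) \<le> (LINT x|half_line. (majorant w x)\<^sup>2)"
    unfolding mass_def by (rule integral_mono_AE[OF i m(1) AE])
  then show "mass (average k t) \<le> (LINT s|lborel. w s) * (LINT s|lborel. w s * mass (v s))"
    using m(2) by linarith
qed

lemma average_pairing: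
  assumes k[measurable]: "k \<in> borel_measurable borel" and w: "weight w" and le: "\<And>s. norm (k (t - s)) \<le> w s"
    and g: "square_integrable g"
  shows "(LINT x|half_line. average k t x * g x) = (LINT s|lborel. k (t - s) * (LINT x|half_line. v s x * g x))"
    and "integrable lborel (\<lambda>s. k (t - s) * (LINT x|half_line. v s x * g x))"
proof -
  have [measurable]: "g \<in> borel_measurable half_line" using g by (simp add: square_integrable_def)
  have wm[measurable]: "w \<in> borel_measurable lborel" and w0: "\<And>s. 0 \<le> w s" and wi: "integrable lborel w"
    using w by (auto simp: weight_def)
  have gi: "integrable half_line (\<lambda>x. (norm (g x))\<^sup>2)" using g by (simp add: square_integrable_def)
  have i1: "integrable (lborel \<Otimes>\<^sub>M half_line) (\<lambda>(s, x). w s * (norm (g x))\<^sup>2)"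
  proof (rule lborel_half_line.Fubini_integrable)
    show "(\<lambda>(s, x). w s * (norm (g x))\<^sup>2) \<in> borel_measurable (lborel \<Otimes>\<^sub>M half_line)" by measurable
    show "AE s in lborel. integrable half_line (\<lambda>x. case (s, x) of (s, x) \<Rightarrow> w s * (norm (g x))\<^sup>2)"
      using gi by simp
    show "integrable lborel (\<lambda>s. LINT x|half_line. norm (case (s, x) of (s, x) \<Rightarrow> w s * (norm (g x))\<^sup>2))"
      using w0 wi by (simp add: abs_mult)
  qed
  have i: "integrable (lborel \<Otimes>\<^sub>M half_line) (\<lambda>(s, x). k (t - s) * v s x * g x)"
  proof (rule Bochner_Integration.integrable_bound[OF Bochner_Integration.integrable_add[OF weighted_square_integrable[OF w] i1]])
    show "(\<lambda>(s, x). k (t - s) * v s x * g x) \<in> borel_measurable (lborel \<Otimes>\<^sub>M half_line)" by measurable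
    show "AE p in lborel \<Otimes>\<^sub>M half_line. norm (case p of (s, x) \<Rightarrow> k (t - s) * v s x * g x) \<le>
        norm ((case p of (s, x) \<Rightarrow> w s * (norm (v s x))\<^sup>2) + (case p of (s, x) \<Rightarrow> w s * (norm (g x))\<^sup>2))"
    proof (rule AE_I2, clarify)
      fix s x
      have "norm (v s x) * norm (g x) \<le> (norm (v s x))\<^sup>2 + (norm (g x))\<^sup>2"
      proof -
        have "2 * (norm (v s x) * norm (g x)) \<le> (norm (v s x))\<^sup>2 + (norm (g x))\<^sup>2"
          using sum_squares_bound[of "norm (v s x)" "norm (g x)"] by simp
        moreover have "0 \<le> norm (v s x) * norm (g x)" by simp
        ultimately show ?thesis by linarith
      qed
      then have "norm (k (t - s)) * (norm (v s x) * norm (g x)) \<le> w s * ((norm (v s x))\<^sup>2 + (norm (g x))\<^sup>2)"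
        using le w0 by (intro mult_mono) auto
      then show "norm (k (t - s) * v s x * g x) \<le> norm (w s * (norm (v s x))\<^sup>2 + w s * (norm (g x))\<^sup>2)"
        using w0[of s] by (simp add: norm_mult algebra_simps)
    qed
  qed
  have "(LINT x|half_line. average k t x * g x) = (LINT x|half_line. LINT s|lborel. k (t - s) * v s x * g x)"
    by (simp add: average_def)
  also have "\<dots> = (LINT s|lborel. LINT x|half_line. k (t - s) * v s x * g x)"
    by (rule lborel_half_line.Fubini_integral[OF i])
  also have "\<dots> = (LINT s|lborel. k (t - s) * (LINT x|half_line. v s x * g x))"
    by (simp add: mult.assoc)
  finally show "(LINT x|half_line. average k t x * g x) = (LINT s|lborel. k (t - s) * (LINT x|half_line. v s x * g x))" .
  show "integrable lborel (\<lambda>s. k (t - s) * (LINT x|half_line. v s x * g x))"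
    using lborel_half_line.integrable_fst'[OF i] by (simp add: mult.assoc)
qed

end

text \<open>A solution, together with a smooth step \<open>\<theta>\<close> from which test functions are built.\<close>

locale dirichlet_curve = L2_curve v for v :: "real \<Rightarrow> real \<Rightarrow> complex" +
  fixes h :: real and \<theta> :: "real \<Rightarrow> real"
  assumes h: "h > 0"
    and \<theta>: "smooth_fun \<theta>" "\<And>x. 0 \<le> \<theta> x" "\<And>x. \<theta> x \<le> 1"
      "\<And>x. x \<le> 0 \<Longrightarrow> \<theta> x = 0" "\<And>x. 1 \<le> x \<Longrightarrow> \<theta> x = 1"
    and v_weak: "\<And>\<phi> t. \<phi> \<in> Cc_infinity UNIV \<Longrightarrow> \<phi> 0 = 0 \<Longrightarrow>
      \<exists>d. ((\<lambda>s. LINT x|half_line. v s x * of_real (\<phi> x)) has_vector_derivative d) (at t) \<and>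
         \<i> * of_real h * d - (of_real h)\<^sup>2 * (LINT x|half_line. v t x * of_real (deriv (deriv \<phi>) x))
           + (LINT x|half_line. of_real x * v t x * of_real (\<phi> x)) = 0"

text \<open>A convolution kernel \<open>k 0\<close> in time with its derivatives \<open>k n\<close>. The weights \<open>W n T\<close> dominate the
  translates of \<open>k n\<close> by times up to \<open>T\<close>. Keeping them abstract covers two cases: bumps, for which
  nothing is known yet about \<open>mass (v s)\<close> for large \<open>s\<close>, and the rapidly decreasing kernel of the
  frequency cut-off, once the mass is known to be conserved.\<close>

locale kernel_sequence = dirichlet_curve v h \<theta>
  for v :: "real \<Rightarrow> real \<Rightarrow> complex" and h :: real and \<theta> :: "real \<Rightarrow> real" +
  fixes k :: "nat \<Rightarrow> real \<Rightarrow> complex" and W :: "nat \<Rightarrow> nat \<Rightarrow> real \<Rightarrow> real"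
  assumes k_deriv: "\<And>n t. (k n has_vector_derivative k (Suc n) t) (at t)"
    and W: "\<And>n T. weight (W n T)"
    and k_le: "\<And>n T t s. \<bar>t\<bar> \<le> real T \<Longrightarrow> norm (k n (t - s)) \<le> W n T s"
begin

lemma k_continuous: "continuous_on S (k n)"
  using has_vector_derivative_continuous[OF k_deriv] continuous_at_imp_continuous_on by blast

lemma k_measurable [measurable]: "k n \<in> borel_measurable borel"
  by (rule borel_measurable_continuous_onI) (rule k_continuous)

abbreviation U :: "nat \<Rightarrow> real \<Rightarrow> real \<Rightarrow> complex" where
  "U n \<equiv> average (k n)"

lemma k_le_nat: "norm (k n (t - s)) \<le> W n (nat \<lceil>\<bar>t\<bar>\<rceil>) s"
  by (rule k_le) linarith

lemma U_square: "square_integrable (U n t)"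
  by (rule average_square_integrable(1)[OF k_measurable W k_le_nat])

lemma U_le: "AE x in half_line. \<forall>n T t. \<bar>t\<bar> \<le> real T \<longrightarrow> norm (U n t x) \<le> majorant (W n T) x"
proof -
  have "AE x in half_line. \<forall>n T. \<forall>k t. (\<forall>s. norm (k (t - s)) \<le> W n T s) \<longrightarrow> norm (average k t x) \<le> majorant (W n T) x"
    unfolding AE_all_countable using average_le_majorant[OF W] by blast
  then show ?thesis by eventually_elim (use k_le in blast)
qed

text \<open>The exceptional null set is independent of time and of the order of differentiation.\<close>

lemma U_time_derivative:
  "AE x in half_line. \<forall>n t. ((\<lambda>t. U n t x) has_vector_derivative U (Suc n) t x) (at t)"
proof -
  have "AE x in half_line. \<forall>n T. integrable lborel (\<lambda>s. W n T s * norm (v s x))"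
    unfolding AE_all_countable using weighted_AE_integrable[OF W] by (auto elim: eventually_mono)
  moreover have "AE x in half_line. x \<in> space half_line" by (rule AE_space)
  ultimately show ?thesis
  proof eventually_elim
    case (elim x)
    have vm: "(\<lambda>s. v s x) \<in> borel_measurable lborel"
      by (rule v_measurable_compose[where f = "\<lambda>s. s" and g = "\<lambda>_. x"])
         (simp, rule measurable_const[OF elim(2)])
    have km: "(\<lambda>s. k n (t - s) * v s x) \<in> borel_measurable lborel" for n t
    proof -
      have "(\<lambda>s. t - s) \<in> borel_measurable lborel" by simp
      from measurable_compose[OF this k_measurable]
      have "(\<lambda>s. k n (t - s)) \<in> borel_measurable lborel" .
      from borel_measurable_times[OF this vm] show ?thesis .
    qed
    show ?case
    proof (intro allI)
      fix n t
      obtain T :: nat where T: "\<bar>t\<bar> < real T" using reals_Archimedean2 by blast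
      have int: "integrable lborel (\<lambda>s. k n (t' - s) * v s x)" if "\<bar>t'\<bar> \<le> real T" for n t'
      proof (rule Bochner_Integration.integrable_bound)
        show "integrable lborel (\<lambda>s. W n T s * norm (v s x))" using elim by blast
        show "AE s in lborel. norm (k n (t' - s) * v s x) \<le> norm (W n T s * norm (v s x))"
          by (intro AE_I2) (auto simp: norm_mult abs_mult intro!: mult_right_mono order_trans[OF k_le[OF that] abs_ge_self])
      qed (rule km)
      show "((\<lambda>t. U n t x) has_vector_derivative U (Suc n) t x) (at t)"
        unfolding average_def
      proof (rule has_vector_derivative_integral_dominated[where a = "- real T" and b = "real T"
            and w = "\<lambda>s. W (Suc n) T s * norm (v s x)"])
        show "integrable lborel (\<lambda>s. W (Suc n) T s * norm (v s x))" using elim by blast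
        show "(\<lambda>s. k (Suc n) (t - s) * v s x) \<in> borel_measurable lborel" by (rule km)
        show "AE s in lborel. \<forall>t\<in>{- real T<..<real T}.
            ((\<lambda>t. k n (t - s) * v s x) has_vector_derivative k (Suc n) (t - s) * v s x) (at t) \<and>
            norm (k (Suc n) (t - s) * v s x) \<le> W (Suc n) T s * norm (v s x)"
        proof (rule AE_I2, rule ballI)
          fix s t' assume t': "t' \<in> {- real T<..<real T}"
          have "((\<lambda>t. k n (t - s)) has_vector_derivative 1 *\<^sub>R k (Suc n) (t' - s)) (at t')"
          proof -
            have "((\<lambda>t. t - s) has_real_derivative 1) (at t')" by (auto intro!: derivative_eq_intros)
            from vector_diff_chain_at[OF this[unfolded has_real_derivative_iff_has_vector_derivative] k_deriv]
            show ?thesis by (simp add: o_def)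
          qed
          then have "((\<lambda>t. k n (t - s) * v s x) has_vector_derivative k (Suc n) (t' - s) * v s x) (at t')"
            by (intro has_vector_derivative_mult_left) simp
          moreover have "norm (k (Suc n) (t' - s) * v s x) \<le> W (Suc n) T s * norm (v s x)"
            unfolding norm_mult by (intro mult_right_mono k_le) (use t' in auto)
          ultimately show "((\<lambda>t. k n (t - s) * v s x) has_vector_derivative k (Suc n) (t' - s) * v s x) (at t') \<and>
            norm (k (Suc n) (t' - s) * v s x) \<le> W (Suc n) T s * norm (v s x)" ..
        qed
      qed (use T int in auto)
    qed
  qed
qed

text \<open>Testing the equation and integrating by parts in time moves the time derivative onto the kernel,
  so that at each time the average solves the stationary equation with the next average as
  right-hand side.\<close>

lemma U_weak:
  assumes \<phi>: "\<phi> \<in> Cc_infinity UNIV" "\<phi> 0 = 0"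
  shows "(of_real h)\<^sup>2 * (LINT x|half_line. U n t x * of_real (deriv (deriv \<phi>) x)) =
      (LINT x|half_line. of_real x * U n t x * of_real (\<phi> x)) + \<i> * of_real h * (LINT x|half_line. U (Suc n) t x * of_real (\<phi> x))"
proof -
  obtain B where B: "smooth_fun \<phi>" "\<And>x. \<bar>x\<bar> \<ge> B \<Longrightarrow> \<phi> x = 0" "B > 0"
    using Cc_infinityE[OF \<phi>(1)] by metis
  have B1: "deriv \<phi> x = 0" if "x > B" for x
    by (rule smooth_fun_deriv_eq_0[OF B(1), of B]) (use B that in auto)
  have B2: "deriv (deriv \<phi>) x = 0" if "x > B + 1" for x
    by (rule smooth_fun_deriv_eq_0[OF smooth_fun_deriv[OF B(1)], of "B + 1"]) (use B1 that in auto)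
  have g0: "square_integrable (\<lambda>x. complex_of_real (\<phi> x))"
    by (rule square_integrable_compact_support[where B = B]) (use B in \<open>auto intro!: smooth_fun_continuous\<close>)
  have g1: "square_integrable (\<lambda>x. complex_of_real (x * \<phi> x))"
    by (rule square_integrable_compact_support[where B = B])
       (use B in \<open>auto intro!: smooth_fun_continuous smooth_fun_mult smooth_fun_ident\<close>)
  have g2: "square_integrable (\<lambda>x. complex_of_real (deriv (deriv \<phi>) x))"
    by (rule square_integrable_compact_support[where B = "B + 1"])
       (use B B2 in \<open>auto intro!: smooth_fun_continuous smooth_fun_deriv\<close>)
  define a where "a s = (LINT x|half_line. v s x * of_real (\<phi> x))" for s
  define b where "b s = (LINT x|half_line. v s x * of_real (deriv (deriv \<phi>) x))" for s
  define c where "c s = (LINT x|half_line. v s x * of_real (x * \<phi> x))" for s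
  have c: "c s = (LINT x|half_line. of_real x * v s x * of_real (\<phi> x))" for s
    unfolding c_def by (rule Bochner_Integration.integral_cong) auto
  note P = average_pairing[OF k_measurable W k_le_nat]
  define d where "d s = ((of_real h)\<^sup>2 * b s - c s) / (\<i> * of_real h)" for s
  have ad: "(a has_vector_derivative d s) (at s)" for s
  proof -
    obtain d' where d': "(a has_vector_derivative d') (at s)" "\<i> * of_real h * d' - (of_real h)\<^sup>2 * b s + c s = 0"
      using v_weak[OF \<phi>, of s] unfolding c a_def[symmetric] b_def[symmetric] by blast
    have "d' = d s" using d'(2) h by (simp add: d_def field_simps)
    then show ?thesis using d'(1) by simp
  qed
  have dc: "continuous_on UNIV d"
    unfolding d_def b_def c_def using h by (intro continuous_intros pairing_continuous g1 g2) auto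
  have ac: "continuous_on UNIV a" unfolding a_def by (intro pairing_continuous g0)
  have ia: "integrable lborel (\<lambda>s. k m (t - s) * a s)" for m unfolding a_def by (rule P(2)[OF g0])
  have ib: "integrable lborel (\<lambda>s. k m (t - s) * b s)" for m unfolding b_def by (rule P(2)[OF g2])
  have ic: "integrable lborel (\<lambda>s. k m (t - s) * c s)" for m unfolding c_def by (rule P(2)[OF g1])
  have id: "integrable lborel (\<lambda>s. k m (t - s) * d s)" for m
  proof -
    have "integrable lborel (\<lambda>s. ((of_real h)\<^sup>2 * (k m (t - s) * b s) - k m (t - s) * c s) / (\<i> * of_real h))"
      by (intro integrable_divide_zero Bochner_Integration.integrable_diff integrable_mult_right ib ic)
    moreover have "((of_real h)\<^sup>2 * (k m (t - s) * b s) - k m (t - s) * c s) / (\<i> * of_real h) = k m (t - s) * d s" for s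
      by (simp add: d_def algebra_simps diff_divide_distrib)
    ultimately show ?thesis by (simp only:)
  qed
  have "(LINT s|lborel. k n (t - s) * d s + (- k (Suc n) (t - s)) * a s) = 0"
  proof (rule integral_derivative_eq_0)
    show "((\<lambda>s. k n (t - s) * a s) has_vector_derivative k n (t - s) * d s + (- k (Suc n) (t - s)) * a s) (at s)" for s
    proof -
      have "((\<lambda>s. k n (t - s)) has_vector_derivative (-1) *\<^sub>R k (Suc n) (t - s)) (at s)"
      proof -
        have "((\<lambda>s. t - s) has_real_derivative -1) (at s)" by (auto intro!: derivative_eq_intros)
        from vector_diff_chain_at[OF this[unfolded has_real_derivative_iff_has_vector_derivative] k_deriv]
        show ?thesis by (simp add: o_def)
      qed
      from has_vector_derivative_mult[OF this ad[of s]] show ?thesis by simp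
    qed
    have kc: "continuous_on UNIV (\<lambda>s. k m (t - s))" for m
      by (rule continuous_on_compose2[OF k_continuous[of UNIV]]) (auto intro!: continuous_intros)
    show "continuous_on UNIV (\<lambda>s. k n (t - s) * d s + (- k (Suc n) (t - s)) * a s)"
      by (intro continuous_intros kc dc ac)
    show "integrable lborel (\<lambda>s. k n (t - s) * a s)" by (rule ia)
    show "integrable lborel (\<lambda>s. k n (t - s) * d s + (- k (Suc n) (t - s)) * a s)"
      using Bochner_Integration.integrable_diff[OF id[of n] ia[of "Suc n"]] by simp
  qed
  then have e: "(LINT s|lborel. k n (t - s) * d s) = (LINT s|lborel. k (Suc n) (t - s) * a s)"
    using id[of n] ia[of "Suc n"] by simp
  have "(LINT x|half_line. U (Suc n) t x * of_real (\<phi> x)) = (LINT s|lborel. k n (t - s) * d s)"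
    unfolding e a_def by (rule P(1)[OF g0])
  moreover have "\<i> * of_real h * (LINT s|lborel. k n (t - s) * d s) =
      (LINT s|lborel. (of_real h)\<^sup>2 * (k n (t - s) * b s) - k n (t - s) * c s)"
    unfolding integral_mult_right_zero[symmetric]
    by (rule Bochner_Integration.integral_cong) (use h in \<open>auto simp: d_def field_simps\<close>)
  moreover have "\<dots> = (of_real h)\<^sup>2 * (LINT s|lborel. k n (t - s) * b s) - (LINT s|lborel. k n (t - s) * c s)"
    using ib[of n] ic[of n] by simp
  moreover have "(LINT s|lborel. k n (t - s) * b s) = (LINT x|half_line. U n t x * of_real (deriv (deriv \<phi>) x))"
    unfolding b_def by (rule P(1)[OF g2, symmetric])
  moreover have "(LINT s|lborel. k n (t - s) * c s) = (LINT x|half_line. of_real x * U n t x * of_real (\<phi> x))"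
  proof -
    have "(LINT s|lborel. k n (t - s) * c s) = (LINT x|half_line. U n t x * of_real (x * \<phi> x))"
      unfolding c_def by (rule P(1)[OF g1, symmetric])
    also have "\<dots> = (LINT x|half_line. of_real x * U n t x * of_real (\<phi> x))"
      by (rule Bochner_Integration.integral_cong) auto
    finally show ?thesis .
  qed
  ultimately show ?thesis by (simp add: algebra_simps)
qed

text \<open>The representatives are first obtained for each order separately; the continuity of the one of
  order \<open>n + 1\<close> then makes the one of order \<open>n\<close> a classical solution.\<close>

lemma U_profiles:
  obtains C E where "\<And>n t. AE x in half_line. U n t x = C n t x"
    "\<And>n t. classical_profile h (C n t) (E n t) (C (Suc n) t)"
proof -
  have "\<exists>C D. (AE x in half_line. U n t x = C x) \<and> continuous_on {0..} C \<and>
      (\<forall>G. continuous_on {0..} G \<longrightarrow> (AE x in half_line. U (Suc n) t x = G x) \<longrightarrow> classical_profile h C D G)" for n t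
  proof -
    obtain C D where CD: "AE x in half_line. U n t x = C x" "C 0 = 0"
      "\<And>x. 0 \<le> x \<Longrightarrow> (C has_vector_derivative D x) (at x within {0..})" "continuous_on {0..} D"
      "\<And>G. continuous_on {0..} G \<Longrightarrow> AE x in half_line. U (Suc n) t x = G x \<Longrightarrow> classical_profile h C D G"
      using dirichlet_regularity[OF \<theta> h U_square U_square U_weak[of _ n t]] by blast
    have "continuous_on {0..} C"
      using has_vector_derivative_continuous[OF CD(3)] by (simp add: continuous_on_eq_continuous_within)
    then show ?thesis using CD by blast
  qed
  then obtain C E where CE: "\<And>n t. AE x in half_line. U n t x = C n t x" "\<And>n t. continuous_on {0..} (C n t)"
    "\<And>n t G. continuous_on {0..} G \<Longrightarrow> (AE x in half_line. U (Suc n) t x = G x) \<Longrightarrow> classical_profile h (C n t) (E n t) G"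
    by metis
  show thesis
    by (rule that[of C E]) (use CE in blast)+
qed

end


section \<open>The interaction Morawetz estimate\<close>

text \<open>The real part of \<open>cnj z * w\<close>, i.e. the inner product of the plane.\<close>

definition real_pairing :: "complex \<Rightarrow> complex \<Rightarrow> real" where
  "real_pairing z w = Re z * Re w + Im z * Im w"

lemma real_pairing_self: "real_pairing z z = (norm z)\<^sup>2"
  unfolding real_pairing_def norm_sq_Re_Im by (simp add: power2_eq_square)

lemma real_pairing_commute: "real_pairing z w = real_pairing w z"
  by (simp add: real_pairing_def mult.commute)

lemma real_pairing_le: "\<bar>real_pairing z w\<bar> \<le> norm z * norm w"
  unfolding real_pairing_def by (rule abs_Re_Im_pairing_le)

lemma real_pairing_measurable [measurable]:
  assumes [measurable]: "f \<in> borel_measurable M" "g \<in> borel_measurable M"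
  shows "(\<lambda>x. real_pairing (f x) (g x)) \<in> borel_measurable M"
  unfolding real_pairing_def by measurable

lemma real_pairing_has_derivative:
  assumes "(f has_vector_derivative f') (at t)" "(g has_vector_derivative g') (at t)"
  shows "((\<lambda>t. real_pairing (f t) (g t)) has_vector_derivative
    (real_pairing f' (g t) + real_pairing (f t) g')) (at t)"
proof -
  note * = bounded_linear.has_vector_derivative[OF bounded_linear_Re] bounded_linear.has_vector_derivative[OF bounded_linear_Im]
  have d: "((\<lambda>t. Re (f t)) has_real_derivative Re f') (at t)" "((\<lambda>t. Im (f t)) has_real_derivative Im f') (at t)"
    "((\<lambda>t. Re (g t)) has_real_derivative Re g') (at t)" "((\<lambda>t. Im (g t)) has_real_derivative Im g') (at t)"
    using *[OF assms(1)] *[OF assms(2)] by (simp_all add: has_real_derivative_iff_has_vector_derivative)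
  show ?thesis
    unfolding real_pairing_def has_real_derivative_iff_has_vector_derivative[symmetric]
    by (rule DERIV_cong[OF real_product_derivatives(1)[OF d]]) simp
qed

context kernel_sequence
begin

lemma U_pair_measurable [measurable]: "(\<lambda>(t, x). U n t x) \<in> borel_measurable (lborel \<Otimes>\<^sub>M half_line)"
  by (rule average_measurable_pair[OF k_measurable])

lemma U_measurable: "U n t \<in> borel_measurable half_line"
  by (rule average_measurable[OF k_measurable])

text \<open>All quantities to be differentiated in time (mass, partial mass, flux and its rate) are of this
  form, and the time derivative stays within this form.\<close>

definition pair_integral :: "real set \<Rightarrow> nat \<Rightarrow> nat \<Rightarrow> real \<Rightarrow> real" where
  "pair_integral S a b t = (LINT x|half_line. indicator S x *\<^sub>R real_pairing (U a t x) (U b t x))"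

lemma pair_integral_commute: "pair_integral S a b t = pair_integral S b a t"
  by (simp add: pair_integral_def real_pairing_commute)

lemma mass_U_eq: "mass (U n t) = pair_integral UNIV n n t"
  by (simp add: mass_def pair_integral_def real_pairing_self)

lemma pair_integrable:
  assumes [measurable]: "indicat_real S \<in> borel_measurable half_line"
  shows "integrable half_line (\<lambda>x. indicator S x *\<^sub>R real_pairing (U a t x) (U b t x))"
proof (rule Bochner_Integration.integrable_bound[OF square_integrable_mult_norm(1)[OF U_square U_square]])
  note [measurable] = U_measurable
  show "(\<lambda>x. indicator S x *\<^sub>R real_pairing (U a t x) (U b t x)) \<in> borel_measurable half_line" by measurable
  show "AE x in half_line. norm (indicator S x *\<^sub>R real_pairing (U a t x) (U b t x)) \<le> norm (norm (U a t x) * norm (U b t x))"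
    using real_pairing_le by (intro AE_I2) (auto split: split_indicator)
qed

lemma pair_integral_le:
  assumes S: "indicat_real S \<in> borel_measurable half_line"
  shows "\<bar>pair_integral S a b t\<bar> \<le> sqrt (mass (U a t) * mass (U b t))"
proof -
  have "\<bar>pair_integral S a b t\<bar> \<le> (LINT x|half_line. norm (U a t x) * norm (U b t x))"
    unfolding pair_integral_def real_norm_def[symmetric]
    by (rule Bochner_Integration.integral_norm_bound_integral[OF pair_integrable[OF S] square_integrable_mult_norm(1)[OF U_square U_square]])
       (use real_pairing_le in \<open>auto split: split_indicator\<close>)
  then show ?thesis using square_integrable_mult_norm(2)[OF U_square U_square] order_trans by blast
qed

lemma pair_integral_has_derivative:
  assumes S[measurable]: "indicat_real S \<in> borel_measurable half_line"
  shows "(pair_integral S a b has_real_derivative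
    (pair_integral S (Suc a) b t + pair_integral S a (Suc b) t)) (at t)"
proof -
  obtain T :: nat where T: "\<bar>t\<bar> < real T" using reals_Archimedean2 by blast
  note [measurable] = U_measurable
  define f' where "f' s x = indicator S x *\<^sub>R (real_pairing (U (Suc a) s x) (U b s x) + real_pairing (U a s x) (U (Suc b) s x))" for s x
  define w where "w x = majorant (W (Suc a) T) x * majorant (W b T) x + majorant (W a T) x * majorant (W (Suc b) T) x" for x
  have wm: "W n T \<in> borel_measurable lborel" for n using W by (simp add: weight_def)
  have mm: "integrable half_line (\<lambda>x. majorant (W m T) x * majorant (W n T) x)" for m n
    by (rule Cauchy_Schwarz_integral(1)[OF majorant_measurable[OF wm] majorant_measurable[OF wm]
          majorant_square_integrable(1)[OF W] majorant_square_integrable(1)[OF W]])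
  have "((\<lambda>t. LINT x|half_line. indicator S x *\<^sub>R real_pairing (U a t x) (U b t x)) has_vector_derivative (LINT x|half_line. f' t x)) (at t)"
  proof (rule has_vector_derivative_integral_dominated[where a = "- real T" and b = "real T" and w = w])
    show "integrable half_line w"
      unfolding w_def[abs_def] by (intro Bochner_Integration.integrable_add mm)
    show "f' t \<in> borel_measurable half_line" unfolding f'_def[abs_def] by measurable
    show "AE x in half_line. \<forall>s\<in>{- real T<..<real T}.
        ((\<lambda>s. indicator S x *\<^sub>R real_pairing (U a s x) (U b s x)) has_vector_derivative f' s x) (at s) \<and> norm (f' s x) \<le> w x"
      using U_time_derivative U_le
    proof eventually_elim
      case (elim x)
      show ?case
      proof (rule ballI, rule conjI)
        fix s assume s: "s \<in> {- real T<..<real T}"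
        have "((\<lambda>s. indicator S x * real_pairing (U a s x) (U b s x)) has_vector_derivative
            indicator S x * (real_pairing (U (Suc a) s x) (U b s x) + real_pairing (U a s x) (U (Suc b) s x))) (at s)"
          by (rule has_vector_derivative_mult_right) (intro real_pairing_has_derivative elim(1)[rule_format])
        then show "((\<lambda>s. indicator S x *\<^sub>R real_pairing (U a s x) (U b s x)) has_vector_derivative f' s x) (at s)"
          by (simp add: f'_def)
        have le: "norm (U n s x) \<le> majorant (W n T) x" for n using elim(2) s by auto
        have "norm (real_pairing (U (Suc a) s x) (U b s x) + real_pairing (U a s x) (U (Suc b) s x)) \<le> w x"
        proof -
          have p: "\<bar>real_pairing (U m s x) (U n s x)\<bar> \<le> majorant (W m T) x * majorant (W n T) x" for m n
            by (rule order_trans[OF real_pairing_le]) (intro mult_mono le norm_ge_zero order_trans[OF norm_ge_zero le])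
          show ?thesis using p[of "Suc a" b] p[of a "Suc b"] unfolding w_def real_norm_def by linarith
        qed
        moreover then have "0 \<le> w x" using norm_ge_zero order_trans by blast
        ultimately show "norm (f' s x) \<le> w x" by (auto simp: f'_def split: split_indicator)
      qed
    qed
  qed (use T pair_integrable[OF S] in auto)
  moreover have "(LINT x|half_line. f' t x) = pair_integral S (Suc a) b t + pair_integral S a (Suc b) t"
    unfolding f'_def pair_integral_def scaleR_add_right
    by (rule Bochner_Integration.integral_add[OF pair_integrable[OF S] pair_integrable[OF S]])
  ultimately show ?thesis
    by (simp add: has_real_derivative_iff_has_vector_derivative pair_integral_def[abs_def])
qed

lemma pair_integral_continuous:
  assumes S: "indicat_real S \<in> borel_measurable half_line"
  shows "continuous_on X (pair_integral S a b)"
  using DERIV_isCont[OF pair_integral_has_derivative[OF S]] continuous_at_imp_continuous_on by blast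

lemma pair_integral_profile:
  assumes C: "AE x in half_line. U a t x = C x" "AE x in half_line. U b t x = C' x"
    and c: "continuous_on {0..} C" "continuous_on {0..} C'" and S[measurable]: "indicat_real S \<in> borel_measurable half_line"
  shows "pair_integral S a b t = (LINT x|half_line. indicator S x *\<^sub>R real_pairing (C x) (C' x))"
  unfolding pair_integral_def
proof (rule integral_cong_AE)
  note [measurable] = U_measurable c[THEN borel_measurable_half_line_continuous]
  show "(\<lambda>x. indicator S x *\<^sub>R real_pairing (U a t x) (U b t x)) \<in> borel_measurable half_line"
    "(\<lambda>x. indicator S x *\<^sub>R real_pairing (C x) (C' x)) \<in> borel_measurable half_line"
    by measurable
  show "AE x in half_line. indicator S x *\<^sub>R real_pairing (U a t x) (U b t x) = indicator S x *\<^sub>R real_pairing (C x) (C' x)"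
    using C by eventually_elim simp
qed

text \<open>The time derivative of the mass is the integral of the derivative of the current.\<close>

lemma mass_U_constant: "mass (U n t) = mass (U n 0)"
proof -
  obtain C E where CE: "\<And>n t. AE x in half_line. U n t x = C n t x"
    "\<And>n t. classical_profile h (C n t) (E n t) (C (Suc n) t)"
    using U_profiles by metis
  have um: "indicat_real UNIV \<in> borel_measurable half_line" by simp
  have zero: "pair_integral UNIV n (Suc n) t = 0" for t
  proof -
    note c = profile_continuous[OF CE(2)]
    have sq: "square_integrable (C n t)" for n
      by (rule square_integrable_AE_cong(1)[OF U_square CE(1) profile_measurable(1)[OF CE(2)]])
    note sqE = profile_energy(1)[OF h CE(2) sq sq]
    have "(LINT x|half_line. 2 * real_pairing (C n t x) (C (Suc n) t x)) =
        - (2 * h * (Re (C n t 0) * Im (E n t 0) - Im (C n t 0) * Re (E n t 0)))"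
    proof (rule half_line_integral_derivative)
      fix x :: real assume x: "0 \<le> x"
      show "((\<lambda>x. 2 * h * (Re (C n t x) * Im (E n t x) - Im (C n t x) * Re (E n t x))) has_vector_derivative
          2 * real_pairing (C n t x) (C (Suc n) t x)) (at x within {0..})"
        unfolding has_real_derivative_iff_has_vector_derivative[symmetric]
        by (rule DERIV_cong[OF DERIV_cmult[OF real_product_derivatives(2)[OF profile_Re_Im_derivative[OF CE(2) x]]]])
           (use h in \<open>simp add: field_simps power2_eq_square real_pairing_def\<close>)
    next
      show "continuous_on {0..} (\<lambda>x. 2 * real_pairing (C n t x) (C (Suc n) t x))"
        unfolding real_pairing_def by (intro continuous_intros profile_Re_Im_continuous[OF CE(2) order_refl])
      show "integrable half_line (\<lambda>x. 2 * h * (Re (C n t x) * Im (E n t x) - Im (C n t x) * Re (E n t x)))"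
        by (intro integrable_mult_right integrable_half_line_bound[OF square_integrable_mult_norm(1)[OF sq[of n] sqE[of n]]]
            continuous_intros c abs_Re_Im_pairing_le)
      show "integrable half_line (\<lambda>x. 2 * real_pairing (C n t x) (C (Suc n) t x))"
        unfolding real_pairing_def
        by (intro integrable_mult_right integrable_half_line_bound[OF square_integrable_mult_norm(1)[OF sq[of n] sq[of "Suc n"]]]
            continuous_intros c abs_Re_Im_pairing_le)
    qed
    also have "\<dots> = 0" using CE(2)[of n t] by (simp add: classical_profile_def)
    finally show ?thesis
      using pair_integral_profile[OF CE(1) CE(1) c(1) c(1) um] by simp
  qed
  have "(pair_integral UNIV n n has_real_derivative 0) (at t)" for t
    using pair_integral_has_derivative[OF um, of n n t] zero[of t] pair_integral_commute[of UNIV n "Suc n" t] by simp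
  then have "pair_integral UNIV n n t = pair_integral UNIV n n 0"
    by (intro DERIV_isconst_all) blast
  then show ?thesis by (simp add: mass_U_eq)
qed

definition mass_up_to :: "real \<Rightarrow> real \<Rightarrow> real" where
  "mass_up_to t y = pair_integral {..y} 0 0 t"

definition flux :: "real \<Rightarrow> real \<Rightarrow> real" where
  "flux t y = 2 * pair_integral {..y} 0 1 t"

text \<open>In these terms the current \<open>j = 2h Im (cnj u u\<^sub>x)\<close> needs no space derivative; neither does its
  time derivative.\<close>

definition flux_rate :: "real \<Rightarrow> real \<Rightarrow> real" where
  "flux_rate t y = 2 * (pair_integral {..y} 1 1 t + pair_integral {..y} 0 2 t)"

lemma mass_up_to_derivative: "((\<lambda>t. mass_up_to t y) has_real_derivative flux t y) (at t)"
  using pair_integral_has_derivative[OF indicator_atMost_measurable_half_line, of y 0 0 t]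
  by (simp add: mass_up_to_def[abs_def] flux_def pair_integral_commute[of _ "Suc 0" 0])

lemma flux_derivative: "((\<lambda>t. flux t y) has_real_derivative flux_rate t y) (at t)"
  unfolding flux_def[abs_def] flux_rate_def
  by (rule DERIV_cmult)
     (use pair_integral_has_derivative[OF indicator_atMost_measurable_half_line, of y 0 1 t] in \<open>simp add: numeral_2_eq_2\<close>)

lemma flux_rate_continuous: "continuous_on X (\<lambda>t. flux_rate t y)"
  unfolding flux_rate_def
  by (intro continuous_intros pair_integral_continuous[OF indicator_atMost_measurable_half_line])

lemma pair_integral_atMost_measurable:
  "(\<lambda>(t, y). pair_integral {..y} a b t) \<in> borel_measurable (lborel \<Otimes>\<^sub>M half_line)"
proof -
  have [measurable]: "Measurable.pred ((lborel \<Otimes>\<^sub>M half_line) \<Otimes>\<^sub>M half_line) (\<lambda>p. snd p \<le> snd (fst p))"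
    unfolding pred_def
    by (intro borel_measurable_le measurable_compose[OF _ ident_measurable_half_line]) measurable
  have Um: "(\<lambda>p. U n (fst (fst p)) (snd p)) \<in> borel_measurable ((lborel \<Otimes>\<^sub>M half_line) \<Otimes>\<^sub>M half_line)" for n
  proof -
    have "(\<lambda>p. (fst (fst p), snd p)) \<in> measurable ((lborel \<Otimes>\<^sub>M half_line) \<Otimes>\<^sub>M half_line) (lborel \<Otimes>\<^sub>M half_line)"
      by measurable
    from measurable_compose[OF this U_pair_measurable[of n]] show ?thesis by simp
  qed
  have "(\<lambda>p. if snd p \<le> snd (fst p) then real_pairing (U a (fst (fst p)) (snd p)) (U b (fst (fst p)) (snd p)) else 0)
      \<in> borel_measurable ((lborel \<Otimes>\<^sub>M half_line) \<Otimes>\<^sub>M half_line)"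
    by (intro measurable_If real_pairing_measurable Um) measurable
  also have "(\<lambda>p. if snd p \<le> snd (fst p) then real_pairing (U a (fst (fst p)) (snd p)) (U b (fst (fst p)) (snd p)) else 0) =
      (\<lambda>(q, x). indicator {..snd q} x *\<^sub>R real_pairing (U a (fst q) x) (U b (fst q) x))"
    by (auto simp: fun_eq_iff split: split_indicator)
  finally show ?thesis
    using half_line.borel_measurable_lebesgue_integral[of
      "\<lambda>q x. indicator {..snd q} x *\<^sub>R real_pairing (U a (fst q) x) (U b (fst q) x)" "lborel \<Otimes>\<^sub>M half_line"]
    by (simp add: pair_integral_def case_prod_unfold)
qed

lemma flux_measurable:
  "(\<lambda>(t, y). mass_up_to t y) \<in> borel_measurable (lborel \<Otimes>\<^sub>M half_line)"
  "(\<lambda>(t, y). flux t y) \<in> borel_measurable (lborel \<Otimes>\<^sub>M half_line)"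
  "(\<lambda>(t, y). flux_rate t y) \<in> borel_measurable (lborel \<Otimes>\<^sub>M half_line)"
proof -
  note [measurable] = pair_integral_atMost_measurable[unfolded case_prod_unfold]
  show "(\<lambda>(t, y). mass_up_to t y) \<in> borel_measurable (lborel \<Otimes>\<^sub>M half_line)"
    "(\<lambda>(t, y). flux t y) \<in> borel_measurable (lborel \<Otimes>\<^sub>M half_line)"
    "(\<lambda>(t, y). flux_rate t y) \<in> borel_measurable (lborel \<Otimes>\<^sub>M half_line)"
    unfolding mass_up_to_def flux_def flux_rate_def case_prod_unfold by measurable
qed

text \<open>Integrate the Morawetz identity in time. The function \<open>\<integral> R j\<close> is bounded by \<open>m \<integral> \<bar>j\<bar>\<close>, and
  \<open>\<integral> \<bar>j\<bar> \<le> 2 h \<parallel>u\<parallel> \<parallel>u\<^sub>x\<parallel>\<close> is controlled by the energy. The function \<open>H\<close> is \<open>\<integral> (\<rho>\<^sub>x)\<^sup>2 dx\<close>; it is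
  measurable in time on \<open>[-T, T]\<close> because the identity expresses it by averages of \<open>v\<close>, although
  \<open>u\<^sub>x\<close> is only given at each time separately.\<close>

theorem morawetz_estimate:
  fixes T :: real
  assumes T: "T > 0"
  defines "m \<equiv> mass (U 0 0)" and "m1 \<equiv> mass (U 1 0)"
  shows "\<exists>H. (\<forall>t. 0 \<le> H t) \<and> (\<lambda>t. indicator {-T..T} t *\<^sub>R H t) \<in> borel_measurable lborel \<and>
    (\<integral>\<^sup>+t\<in>{-T..T}. ennreal (H t) \<partial>lborel) \<le> ennreal ((2 * T * m\<^sup>2 + 4 * m * sqrt (m * h * sqrt (m * m1))) / (2 * h\<^sup>2)) \<and>
    (\<forall>t. \<exists>S\<ge>0. (AE x in half_line. norm (U 0 t x) \<le> S) \<and> S ^ 6 \<le> 4 * m * H t \<and>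
       S\<^sup>2 \<le> 2 * sqrt (m * sqrt (m * m1) / h))"
proof -
  obtain C E where CE: "\<And>n t. AE x in half_line. U n t x = C n t x"
    "\<And>n t. classical_profile h (C n t) (E n t) (C (Suc n) t)"
    using U_profiles by metis
  have sq: "square_integrable (C n t)" and mC: "mass (C n t) = mass (U n 0)" for n t
    using square_integrable_AE_cong[OF U_square CE(1) profile_measurable(1)[OF CE(2)]] mass_U_constant by auto
  note P = CE(2)[of 0] and P' = CE(2)[of "Suc 0"]
  note en = profile_energy[OF h CE(2) sq sq, unfolded mC]
  note c = profile_continuous(1)[OF CE(2)]
  have R: "mass_up_to t y = (LINT x|half_line. indicator {..y} x *\<^sub>R (norm (C 0 t x))\<^sup>2)" for t y
    unfolding mass_up_to_def
    by (subst pair_integral_profile[OF CE(1) CE(1) c c]) (simp_all add: real_pairing_self indicator_atMost_measurable_half_line)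
  have j: "flux t y = 2 * h * (Re (C 0 t y) * Im (E 0 t y) - Im (C 0 t y) * Re (E 0 t y))" if "0 \<le> y" for t y
  proof -
    have "flux t y = 2 * (LINT x|half_line. indicator {..y} x *\<^sub>R real_pairing (C 0 t x) (C (Suc 0) t x))"
      unfolding flux_def
      by (subst pair_integral_profile[OF CE(1) CE(1) c c]) (simp_all add: indicator_atMost_measurable_half_line)
    also have "\<dots> = (LINT x|half_line. indicator {..y} x *\<^sub>R (2 * (Re (C 0 t x) * Re (C (Suc 0) t x) + Im (C 0 t x) * Im (C (Suc 0) t x))))"
      unfolding integral_mult_right_zero[symmetric] real_pairing_def
      by (rule Bochner_Integration.integral_cong) auto
    also have "\<dots> = 2 * h * (Re (C 0 t y) * Im (E 0 t y) - Im (C 0 t y) * Re (E 0 t y))"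
      by (rule profile_mass_flux[OF h P that])
    finally show ?thesis .
  qed
  have l: "flux_rate t y = 2 * h * ((Re (C 0 t y) * Im (E 1 t y) - Im (C 0 t y) * Re (E 1 t y)) -
      (Im (C 1 t y) * Re (E 0 t y) - Re (C 1 t y) * Im (E 0 t y)))" if "0 \<le> y" for t y
  proof -
    have i: "integrable half_line (\<lambda>x. indicator {..y} x *\<^sub>R real_pairing (C a t x) (C b t x))" for a b
      unfolding real_pairing_def
      by (intro half_line_truncated_continuous continuous_intros profile_Re_Im_continuous[OF CE(2)]) auto
    have "flux_rate t y = 2 * ((LINT x|half_line. indicator {..y} x *\<^sub>R real_pairing (C 1 t x) (C 1 t x))
        + (LINT x|half_line. indicator {..y} x *\<^sub>R real_pairing (C 0 t x) (C 2 t x)))"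
      unfolding flux_rate_def
      by (subst (1 2) pair_integral_profile[OF CE(1) CE(1) c c]) (simp_all add: indicator_atMost_measurable_half_line)
    also have "\<dots> = (LINT x|half_line. 2 * (indicator {..y} x *\<^sub>R real_pairing (C 1 t x) (C 1 t x)
        + indicator {..y} x *\<^sub>R real_pairing (C 0 t x) (C 2 t x)))"
      unfolding integral_mult_right_zero Bochner_Integration.integral_add[OF i i] ..
    also have "\<dots> = (LINT x|half_line. indicator {..y} x *\<^sub>R
      (2 * ((norm (C (Suc 0) t x))\<^sup>2 + (Re (C 0 t x) * Re (C (Suc (Suc 0)) t x) + Im (C 0 t x) * Im (C (Suc (Suc 0)) t x)))))"
      by (rule Bochner_Integration.integral_cong) (auto simp: real_pairing_self real_pairing_def[of "C 0 t _"] numeral_2_eq_2 split: split_indicator)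
    also have "\<dots> = 2 * h * ((Re (C 0 t y) * Im (E (Suc 0) t y) - Im (C 0 t y) * Re (E (Suc 0) t y)) -
      (Im (C (Suc 0) t y) * Re (E 0 t y) - Re (C (Suc 0) t y) * Im (E 0 t y)))"
      by (rule profile_second_flux[OF h P P' that])
    finally show ?thesis by simp
  qed
  have m0: "0 \<le> m" and m10: "0 \<le> m1" by (simp_all add: m_def m1_def mass_nonneg)
  note MI = morawetz_identity[OF h P P' sq sq sq, folded R]
  have cong: "(LINT y|half_line. f y) = (LINT y|half_line. g y)" if "\<And>y. 0 \<le> y \<Longrightarrow> f y = g y" for f g :: "real \<Rightarrow> real"
    by (rule Bochner_Integration.integral_cong) (use that in \<open>auto simp: space_half_line\<close>)
  have icong: "integrable half_line f \<longleftrightarrow> integrable half_line g" if "\<And>y. 0 \<le> y \<Longrightarrow> f y = g y" for f g :: "real \<Rightarrow> real"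
    by (rule Bochner_Integration.integrable_cong) (use that in \<open>auto simp: space_half_line\<close>)
  have ij: "integrable half_line (flux t)" and il: "integrable half_line (flux_rate t)"
    and ij2: "integrable half_line (\<lambda>y. (flux t y)\<^sup>2)" and iRl: "integrable half_line (\<lambda>y. mass_up_to t y * flux_rate t y)" for t
    using MI(1-4)[of t] by (simp_all add: j l cong: icong)
  define e where "e t = (LINT y|half_line. (flux t y)\<^sup>2 + mass_up_to t y * flux_rate t y)" for t
  define H where "H t = (LINT y|half_line. (density_slope (C 0 t) (E 0 t) y)\<^sup>2)" for t
  have eH: "e t = m\<^sup>2 - 2 * h\<^sup>2 * H t" for t
  proof -
    have "e t = (LINT y|half_line. (2 * h * (Re (C 0 t y) * Im (E 0 t y) - Im (C 0 t y) * Re (E 0 t y)))\<^sup>2 +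
        mass_up_to t y * (2 * h * ((Re (C 0 t y) * Im (E (Suc 0) t y) - Im (C 0 t y) * Re (E (Suc 0) t y)) -
      (Im (C (Suc 0) t y) * Re (E 0 t y) - Re (C (Suc 0) t y) * Im (E 0 t y)))))"
      unfolding e_def by (rule cong) (simp add: j l)
    also have "\<dots> = (mass (C 0 t))\<^sup>2 - 2 * h\<^sup>2 * H t" unfolding H_def by (rule MI(5))
    finally show ?thesis by (simp add: mC m_def)
  qed
  have Rb: "\<bar>mass_up_to t y\<bar> \<le> m" for t y
    using pair_integral_le[OF indicator_atMost_measurable_half_line[of y], of 0 0 t] mass_U_constant[of 0 t] m0
    by (simp add: mass_up_to_def m_def)
  define J where "J = 2 * sqrt (m * m1)"
  have jJ: "\<bar>flux t y\<bar> \<le> J" for t y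
    using pair_integral_le[OF indicator_atMost_measurable_half_line[of y], of 0 1 t] mass_U_constant[of 0 t] mass_U_constant[of 1 t]
    by (simp add: flux_def J_def m_def m1_def abs_mult)
  define e0 where "e0 = sqrt (m * m1) / h"
  define e1 where "e1 = sqrt (m1 * mass (U 2 0)) / h"
  have E0: "mass (E 0 t) \<le> e0" and E1: "mass (E 1 t) \<le> e1" for t
  proof -
    have "h * (h * mass (E 0 t)) \<le> h * sqrt (m * m1)" "h * (h * mass (E 1 t)) \<le> h * sqrt (m1 * mass (U 2 0))"
      using en(3)[of 0 t] en(3)[of 1 t] by (simp_all add: m_def m1_def power2_eq_square mult.assoc numeral_2_eq_2)
    then show "mass (E 0 t) \<le> e0" "mass (E 1 t) \<le> e1"
      using h by (simp_all add: e0_def e1_def pos_le_divide_eq mult.commute)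
  qed
  have e00: "0 \<le> e0" and e10: "0 \<le> e1" using mass_nonneg E0 E1 order_trans by blast+
  define J1 where "J1 = 2 * h * sqrt (m * e0)"
  have J1: "(LINT y|half_line. \<bar>flux t y\<bar>) \<le> J1" for t
  proof -
    note sm = square_integrable_mult_norm[OF sq[of 0 t] en(1)[of 0 t]]
    have "(LINT y|half_line. \<bar>flux t y\<bar>) \<le> (LINT y|half_line. 2 * h * (norm (C 0 t y) * norm (E 0 t y)))"
    proof (rule integral_mono[OF integrable_abs[OF ij] integrable_mult_right[OF sm(1)]])
      fix y assume "y \<in> space half_line"
      then have y: "0 \<le> y" by (simp add: space_half_line)
      show "\<bar>flux t y\<bar> \<le> 2 * h * (norm (C 0 t y) * norm (E 0 t y))"
        using abs_Re_Im_pairing_le(2)[of "C 0 t y" "E 0 t y"] h by (simp add: j[OF y] abs_mult)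
    qed
    also have "\<dots> \<le> 2 * h * sqrt (mass (C 0 t) * mass (E 0 t))"
      using sm(2) h by simp
    also have "\<dots> \<le> J1"
      unfolding J1_def mC m_def[symmetric] using E0 h m0 by (intro mult_left_mono real_sqrt_le_mono) auto
    finally show ?thesis .
  qed
  define L1 where "L1 = 2 * h * (sqrt (m * e1) + sqrt (m1 * e0))"
  have L1: "(LINT y|half_line. \<bar>flux_rate t y\<bar>) \<le> L1" for t
  proof -
    note sm = square_integrable_mult_norm[OF sq[of 0 t] en(1)[of 1 t]]
    note sm' = square_integrable_mult_norm[OF sq[of 1 t] en(1)[of 0 t]]
    have "(LINT y|half_line. \<bar>flux_rate t y\<bar>) \<le>
        (LINT y|half_line. 2 * h * (norm (C 0 t y) * norm (E 1 t y) + norm (C 1 t y) * norm (E 0 t y)))"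
    proof (rule integral_mono[OF integrable_abs[OF il] integrable_mult_right[OF Bochner_Integration.integrable_add[OF sm(1) sm'(1)]]])
      fix y assume "y \<in> space half_line"
      then have y: "0 \<le> y" by (simp add: space_half_line)
      have "\<bar>(Re (C 0 t y) * Im (E 1 t y) - Im (C 0 t y) * Re (E 1 t y)) - (Im (C 1 t y) * Re (E 0 t y) - Re (C 1 t y) * Im (E 0 t y))\<bar>
          \<le> norm (C 0 t y) * norm (E 1 t y) + norm (C 1 t y) * norm (E 0 t y)"
        using abs_Re_Im_pairing_le(2)[of "C 0 t y" "E 1 t y"] abs_Re_Im_pairing_le(2)[of "C 1 t y" "E 0 t y"] by linarith
      then show "\<bar>flux_rate t y\<bar> \<le> 2 * h * (norm (C 0 t y) * norm (E 1 t y) + norm (C 1 t y) * norm (E 0 t y))"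
        using h unfolding l[OF y] abs_mult by simp
    qed
    also have "\<dots> = 2 * h * ((LINT y|half_line. norm (C 0 t y) * norm (E 1 t y)) + (LINT y|half_line. norm (C 1 t y) * norm (E 0 t y)))"
      unfolding integral_mult_right_zero Bochner_Integration.integral_add[OF sm(1) sm'(1)] ..
    also have "\<dots> \<le> 2 * h * (sqrt (mass (C 0 t) * mass (E 1 t)) + sqrt (mass (C 1 t) * mass (E 0 t)))"
      using sm(2) sm'(2) h by (intro mult_left_mono add_mono) auto
    also have "\<dots> \<le> L1"
      unfolding L1_def mC m_def[symmetric] m1_def[symmetric] using E0 E1 h m0 m10
      by (intro mult_left_mono add_mono real_sqrt_le_mono) auto
    finally show ?thesis .
  qed
  \<comment> \<open>The time derivative of \<open>R j\<close> at the point \<open>y\<close>; Fubini needs its integral over \<open>y\<close> to be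
    bounded uniformly in time, which holds as all masses are constant.\<close>
  define d where "d t y = (flux t y)\<^sup>2 + mass_up_to t y * flux_rate t y" for t y
  have id: "integrable half_line (d t)" for t
    unfolding d_def[abs_def] by (intro Bochner_Integration.integrable_add ij2 iRl)
  have dK: "(LINT y|half_line. norm (d t y)) \<le> J * J1 + m * L1" for t
  proof -
    have "(LINT y|half_line. norm (d t y)) \<le> (LINT y|half_line. J * \<bar>flux t y\<bar> + m * \<bar>flux_rate t y\<bar>)"
    proof (rule integral_mono)
      show "norm (d t y) \<le> J * \<bar>flux t y\<bar> + m * \<bar>flux_rate t y\<bar>" for y
      proof -
        have "\<bar>flux t y\<bar> * \<bar>flux t y\<bar> \<le> J * \<bar>flux t y\<bar>" by (intro mult_right_mono jJ) simp
        moreover have "\<bar>mass_up_to t y\<bar> * \<bar>flux_rate t y\<bar> \<le> m * \<bar>flux_rate t y\<bar>" by (intro mult_right_mono Rb) simp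
        ultimately show ?thesis
          using abs_triangle_ineq[of "(flux t y)\<^sup>2" "mass_up_to t y * flux_rate t y"]
          by (simp add: d_def power2_eq_square abs_mult)
      qed
    qed (use id ij il in auto)
    also have "\<dots> = J * (LINT y|half_line. \<bar>flux t y\<bar>) + m * (LINT y|half_line. \<bar>flux_rate t y\<bar>)"
      using ij[of t] il[of t] by simp
    also have "\<dots> \<le> J * J1 + m * L1"
      using J1 L1 m0 m10 by (intro add_mono mult_left_mono) (auto simp: J_def)
    finally show ?thesis .
  qed
  have dm: "(\<lambda>(t, y). indicator {-T..T} t *\<^sub>R d t y) \<in> borel_measurable (lborel \<Otimes>\<^sub>M half_line)"
  proof -
    note [measurable] = flux_measurable[unfolded case_prod_unfold]
    show ?thesis unfolding d_def case_prod_unfold by measurable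
  qed
  have em: "(\<lambda>t. LINT y|half_line. norm (indicator {-T..T} t *\<^sub>R d t y)) \<in> borel_measurable lborel"
    using dm by (intro half_line.borel_measurable_lebesgue_integral) (simp add: case_prod_unfold)
  have int: "integrable (lborel \<Otimes>\<^sub>M half_line) (\<lambda>(t, y). indicator {-T..T} t *\<^sub>R d t y)"
  proof (rule lborel_half_line.Fubini_integrable[OF dm])
    show "AE t in lborel. integrable half_line (\<lambda>y. case (t, y) of (t, y) \<Rightarrow> indicator {-T..T} t *\<^sub>R d t y)"
      using id by simp
    have "integrable lborel (\<lambda>t. indicator {-T..T} t *\<^sub>R (J * J1 + m * L1))"
      by (rule borel_integrable_compact[OF compact_Icc]) simp
    then show "integrable lborel (\<lambda>t. LINT y|half_line. norm (case (t, y) of (t, y) \<Rightarrow> indicator {-T..T} t *\<^sub>R d t y))"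
    proof (rule Bochner_Integration.integrable_bound)
      show "AE t in lborel. norm (LINT y|half_line. norm (case (t, y) of (t, y) \<Rightarrow> indicator {-T..T} t *\<^sub>R d t y))
          \<le> norm (indicator {-T..T} t *\<^sub>R (J * J1 + m * L1))"
        using dK by (intro AE_I2) (auto split: split_indicator intro!: order_trans[OF _ abs_ge_self] simp: integral_nonneg_AE)
    qed (use em in simp)
  qed
  have FTC: "(LINT t|lborel. indicator {-T..T} t *\<^sub>R d t y) = mass_up_to T y * flux T y - mass_up_to (-T) y * flux (-T) y" for y
  proof (rule integral_FTC_atLeastAtMost)
    show "((\<lambda>t. mass_up_to t y * flux t y) has_vector_derivative d t y) (at t within {-T..T})" for t
      unfolding has_real_derivative_iff_has_vector_derivative[symmetric]
      by (rule has_field_derivative_at_within, rule DERIV_cong[OF DERIV_mult[OF mass_up_to_derivative flux_derivative]])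
         (simp add: d_def power2_eq_square)
    show "continuous_on {-T..T} (\<lambda>t. d t y)"
      unfolding d_def mass_up_to_def flux_def
      by (intro continuous_intros flux_rate_continuous pair_integral_continuous[OF indicator_atMost_measurable_half_line])
  qed (use T in simp)
  have ed: "e t = (LINT y|half_line. d t y)" for t by (simp add: e_def d_def)
  have "(LINT t|lborel. indicator {-T..T} t *\<^sub>R e t) = (LINT t|lborel. LINT y|half_line. indicator {-T..T} t *\<^sub>R d t y)"
    by (simp add: ed)
  also have "\<dots> = (LINT y|half_line. LINT t|lborel. indicator {-T..T} t *\<^sub>R d t y)"
    by (rule lborel_half_line.Fubini_integral[OF int, symmetric])
  also have "\<dots> = (LINT y|half_line. mass_up_to T y * flux T y - mass_up_to (-T) y * flux (-T) y)"
    by (simp only: FTC)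
  finally have eq: "(LINT t|lborel. indicator {-T..T} t *\<^sub>R e t) =
      (LINT y|half_line. mass_up_to T y * flux T y - mass_up_to (-T) y * flux (-T) y)" .
  have iRj: "integrable half_line (\<lambda>y. mass_up_to t y * flux t y)" and bRj: "\<bar>LINT y|half_line. mass_up_to t y * flux t y\<bar> \<le> m * J1" for t
  proof -
    have b: "norm (mass_up_to t y * flux t y) \<le> m * \<bar>flux t y\<bar>" for y
      using Rb[of t y] by (simp add: abs_mult mult_right_mono)
    have i: "integrable half_line (\<lambda>y. m * \<bar>flux t y\<bar>)" using ij by simp
    show iRj: "integrable half_line (\<lambda>y. mass_up_to t y * flux t y)"
    proof (rule Bochner_Integration.integrable_bound[OF i])
      show "(\<lambda>y. mass_up_to t y * flux t y) \<in> borel_measurable half_line"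
        using borel_measurable_times[OF measurable_compose[OF measurable_Pair1' flux_measurable(1)]
            borel_measurable_integrable[OF ij], of t t] by simp
      show "AE y in half_line. norm (mass_up_to t y * flux t y) \<le> norm (m * \<bar>flux t y\<bar>)"
        by (intro AE_I2 order_trans[OF b]) simp
    qed
    have "\<bar>LINT y|half_line. mass_up_to t y * flux t y\<bar> \<le> (LINT y|half_line. m * \<bar>flux t y\<bar>)"
      unfolding real_norm_def[symmetric] by (rule Bochner_Integration.integral_norm_bound_integral[OF iRj]) (use i b in auto)
    also have "\<dots> \<le> m * J1" using J1 m0 by (simp add: mult_left_mono)
    finally show "\<bar>LINT y|half_line. mass_up_to t y * flux t y\<bar> \<le> m * J1" .
  qed
  have ie: "integrable lborel (\<lambda>t. indicator {-T..T} t *\<^sub>R e t)"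
    using lborel_half_line.integrable_fst'[OF int] by (simp add: ed)
  have lower: "- (2 * m * J1) \<le> (LINT t|lborel. indicator {-T..T} t *\<^sub>R e t)"
    unfolding eq Bochner_Integration.integral_diff[OF iRj iRj] using bRj[of T] bRj[of "-T"] by linarith
  have H0: "0 \<le> H t" for t unfolding H_def by (rule integral_nonneg_AE) simp
  have Hind: "indicator {-T..T} t *\<^sub>R H t = (indicator {-T..T} t *\<^sub>R m\<^sup>2 - indicator {-T..T} t *\<^sub>R e t) / (2 * h\<^sup>2)" for t
    using eH[of t] h by (auto split: split_indicator)
  have i1: "integrable lborel (\<lambda>t. indicator {-T..T} t *\<^sub>R m\<^sup>2)"
    by (rule borel_integrable_compact[OF compact_Icc]) simp
  have iH: "integrable lborel (\<lambda>t. indicator {-T..T} t *\<^sub>R H t)"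
    unfolding Hind by (intro integrable_divide_zero Bochner_Integration.integrable_diff i1 ie)
  have "(LINT t|lborel. indicator {-T..T} t *\<^sub>R H t) =
      ((LINT t|lborel. indicator {-T..T} t *\<^sub>R m\<^sup>2) - (LINT t|lborel. indicator {-T..T} t *\<^sub>R e t)) / (2 * h\<^sup>2)"
    unfolding Hind integral_divide_zero Bochner_Integration.integral_diff[OF i1 ie] ..
  also have "(LINT t|lborel. indicator {-T..T} t *\<^sub>R m\<^sup>2) = 2 * T * m\<^sup>2" using T by simp
  also have "(2 * T * m\<^sup>2 - (LINT t|lborel. indicator {-T..T} t *\<^sub>R e t)) / (2 * h\<^sup>2) \<le> (2 * T * m\<^sup>2 + 2 * m * J1) / (2 * h\<^sup>2)"
    using lower h by (intro divide_right_mono) auto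
  also have "2 * m * J1 = 4 * m * sqrt (m * h * sqrt (m * m1))"
  proof -
    have "h * sqrt (m * e0) = sqrt (h\<^sup>2 * (m * e0))" using h by (simp add: real_sqrt_mult)
    also have "h\<^sup>2 * (m * e0) = m * h * sqrt (m * m1)" using h by (simp add: e0_def power2_eq_square)
    finally show ?thesis by (simp add: J1_def)
  qed
  finally have Hle: "(LINT t|lborel. indicator {-T..T} t *\<^sub>R H t) \<le>
      (2 * T * m\<^sup>2 + 4 * m * sqrt (m * h * sqrt (m * m1))) / (2 * h\<^sup>2)" .
  have "(\<integral>\<^sup>+t\<in>{-T..T}. ennreal (H t) \<partial>lborel) = (\<integral>\<^sup>+t. ennreal (indicator {-T..T} t *\<^sub>R H t) \<partial>lborel)"
    by (rule nn_integral_cong) (auto split: split_indicator)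
  also have "\<dots> = ennreal (LINT t|lborel. indicator {-T..T} t *\<^sub>R H t)"
    by (rule nn_integral_eq_integral[OF iH]) (auto simp: H0 split: split_indicator)
  also have "\<dots> \<le> ennreal ((2 * T * m\<^sup>2 + 4 * m * sqrt (m * h * sqrt (m * m1))) / (2 * h\<^sup>2))"
    by (rule ennreal_leI[OF Hle])
  finally have nn: "(\<integral>\<^sup>+t\<in>{-T..T}. ennreal (H t) \<partial>lborel) \<le> ennreal ((2 * T * m\<^sup>2 + 4 * m * sqrt (m * h * sqrt (m * m1))) / (2 * h\<^sup>2))" .
  have "\<exists>S\<ge>0. (AE x in half_line. norm (U 0 t x) \<le> S) \<and> S ^ 6 \<le> 4 * m * H t \<and> S\<^sup>2 \<le> 2 * sqrt (m * sqrt (m * m1) / h)" for t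
  proof -
    define A where "A = 2 * sqrt (m * e0)"
    define S where "S = min (sqrt A) (root 6 (4 * m * H t))"
    have A0: "0 \<le> A" using m0 e00 by (simp add: A_def)
    have mH: "0 \<le> 4 * m * H t" using m0 H0 by simp
    have S0: "0 \<le> S" using A0 mH by (simp add: S_def)
    have CS: "norm (C 0 t x) \<le> S" if x: "0 \<le> x" for x
    proof -
      have "(norm (C 0 t x))\<^sup>2 \<le> 2 * sqrt (m * mass (E 0 t))"
        using profile_sup_bound[OF h P sq sq x] by (simp add: mC m_def)
      also have "\<dots> \<le> A" unfolding A_def using E0 m0 by (intro mult_left_mono real_sqrt_le_mono) auto
      finally have 1: "norm (C 0 t x) \<le> sqrt A" by (rule real_le_rsqrt)
      have "norm (C 0 t x) ^ 6 \<le> 4 * m * H t"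
        using profile_sup_sixth_power[OF h P sq sq x] by (simp add: mC m_def H_def)
      then have "root 6 (norm (C 0 t x) ^ 6) \<le> root 6 (4 * m * H t)" by (intro real_root_le_mono) auto
      then have 2: "norm (C 0 t x) \<le> root 6 (4 * m * H t)" by (simp add: real_root_power_cancel)
      show ?thesis using 1 2 by (simp add: S_def)
    qed
    have AE: "AE x in half_line. norm (U 0 t x) \<le> S"
      using CE(1)[of 0 t] AE_space by eventually_elim (auto simp: space_half_line CS)
    have "S ^ 6 \<le> root 6 (4 * m * H t) ^ 6" using S0 by (intro power_mono) (auto simp: S_def)
    then have S6: "S ^ 6 \<le> 4 * m * H t" using mH by simp
    have "S\<^sup>2 \<le> (sqrt A)\<^sup>2" using S0 by (intro power_mono) (auto simp: S_def)
    then have "S\<^sup>2 \<le> 2 * sqrt (m * sqrt (m * m1) / h)" using A0 by (simp add: A_def e0_def)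
    then show ?thesis using S0 AE S6 by blast
  qed
  then show ?thesis using H0 nn borel_measurable_integrable[OF iH] by blast
qed

end


section \<open>Conservation of mass\<close>

lemma mass_diff_le:
  assumes f: "square_integrable f" and g: "square_integrable g"
  shows "\<bar>mass f - mass g\<bar> \<le> mass (\<lambda>x. f x - g x) + 2 * sqrt (mass g * mass (\<lambda>x. f x - g x))"
proof -
  let ?d = "\<lambda>x. f x - g x"
  have d: "square_integrable ?d" by (rule square_integrable_diff[OF f g])
  have i: "integrable half_line (\<lambda>x. (norm (f x))\<^sup>2)" "integrable half_line (\<lambda>x. (norm (g x))\<^sup>2)"
    "integrable half_line (\<lambda>x. (norm (?d x))\<^sup>2)"
    using f g d by (auto simp: square_integrable_def)
  note p = square_integrable_mult_norm[OF g d]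
  have i2: "integrable half_line (\<lambda>x. (norm (?d x))\<^sup>2 + 2 * (norm (g x) * norm (?d x)))"
    by (intro Bochner_Integration.integrable_add integrable_mult_right p(1) i)
  have "\<bar>mass f - mass g\<bar> = norm (LINT x|half_line. (norm (f x))\<^sup>2 - (norm (g x))\<^sup>2)"
    using i by (simp add: mass_def)
  also have "\<dots> \<le> (LINT x|half_line. (norm (?d x))\<^sup>2 + 2 * (norm (g x) * norm (?d x)))"
  proof (rule Bochner_Integration.integral_norm_bound_integral[OF Bochner_Integration.integrable_diff[OF i(1,2)] i2])
    fix x
    have "\<bar>norm (f x) - norm (g x)\<bar> \<le> norm (?d x)" by (rule norm_triangle_ineq3)
    then have "\<bar>norm (f x) - norm (g x)\<bar> * \<bar>norm (f x) + norm (g x)\<bar> \<le> norm (?d x) * (norm (?d x) + 2 * norm (g x))"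
      by (intro mult_mono) auto
    moreover have "(norm (f x))\<^sup>2 - (norm (g x))\<^sup>2 = (norm (f x) - norm (g x)) * (norm (f x) + norm (g x))"
      by (simp add: power2_eq_square algebra_simps)
    moreover have "norm (?d x) * (norm (?d x) + 2 * norm (g x)) = (norm (?d x))\<^sup>2 + 2 * (norm (g x) * norm (?d x))"
      by (simp add: power2_eq_square algebra_simps)
    ultimately show "norm ((norm (f x))\<^sup>2 - (norm (g x))\<^sup>2) \<le> (norm (?d x))\<^sup>2 + 2 * (norm (g x) * norm (?d x))"
      by (simp only: real_norm_def abs_mult)
  qed
  also have "\<dots> = mass ?d + 2 * (LINT x|half_line. norm (g x) * norm (?d x))"
    using i(3) p(1) by (simp add: mass_def)
  also have "\<dots> \<le> mass ?d + 2 * sqrt (mass g * mass ?d)" using p(2) by simp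
  finally show ?thesis .
qed

lemma mass_tendsto:
  assumes "\<And>i. square_integrable (f i)" "square_integrable g" "((\<lambda>i. mass (\<lambda>x. f i x - g x)) \<longlongrightarrow> 0) F"
  shows "((\<lambda>i. mass (f i)) \<longlongrightarrow> mass g) F"
proof -
  have "((\<lambda>i. mass (f i) - mass g) \<longlongrightarrow> 0) F"
  proof (rule Lim_null_comparison)
    show "\<forall>\<^sub>F i in F. norm (mass (f i) - mass g) \<le> mass (\<lambda>x. f i x - g x) + 2 * sqrt (mass g * mass (\<lambda>x. f i x - g x))"
      using mass_diff_le[OF assms(1,2)] by simp
    have "((\<lambda>i. mass (\<lambda>x. f i x - g x) + 2 * sqrt (mass g * mass (\<lambda>x. f i x - g x))) \<longlongrightarrow> 0 + 2 * sqrt (mass g * 0)) F"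
      by (intro tendsto_intros assms(3))
    then show "((\<lambda>i. mass (\<lambda>x. f i x - g x) + 2 * sqrt (mass g * mass (\<lambda>x. f i x - g x))) \<longlongrightarrow> 0) F" by simp
  qed
  then show ?thesis by (simp add: LIM_zero_iff)
qed

lemma smooth_fun_deriv_eq_0_outside:
  assumes "smooth_fun f" "\<And>x. x \<notin> {a..b} \<Longrightarrow> f x = 0" "x \<notin> {a..b}"
  shows "deriv f x = 0"
proof -
  have "(f has_real_derivative 0) (at x)"
    by (rule has_field_derivative_transform_within_open[where f = "\<lambda>_. 0" and S = "- {a..b}"]) (use assms in auto)
  then show ?thesis by (rule DERIV_imp_deriv)
qed

lemma bounded_if_compact_support:
  fixes f :: "real \<Rightarrow> real"
  assumes "continuous_on UNIV f" "\<And>x. x \<notin> {a..b} \<Longrightarrow> f x = 0"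
  obtains C where "0 \<le> C" "\<And>x. \<bar>f x\<bar> \<le> C"
proof -
  have "bounded (f ` {a..b})"
    by (intro compact_imp_bounded compact_continuous_image continuous_on_subset[OF assms(1)]) auto
  then obtain C where C: "\<And>x. x \<in> {a..b} \<Longrightarrow> \<bar>f x\<bar> \<le> C"
    unfolding bounded_iff by (metis imageI real_norm_def)
  show thesis
  proof (rule that[of "max C 0"])
    show "\<bar>f x\<bar> \<le> max C 0" for x using C[of x] assms(2)[of x] by (cases "x \<in> {a..b}") auto
  qed simp
qed

lemma integrable_if_compact_support:
  fixes f :: "real \<Rightarrow> 'a::euclidean_space"
  assumes "continuous_on UNIV f" "\<And>x. x \<notin> {a..b} \<Longrightarrow> f x = 0"
  shows "integrable lborel f"
proof -
  have "integrable lborel (\<lambda>x. indicator {a..b} x *\<^sub>R f x)"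
    by (rule borel_integrable_compact[OF compact_Icc]) (rule continuous_on_subset[OF assms(1)], simp)
  moreover have "(\<lambda>x. indicator {a..b} x *\<^sub>R f x) = f"
    using assms(2) by (auto simp: fun_eq_iff split: split_indicator)
  ultimately show ?thesis by simp
qed

context L2_curve
begin

lemma L2_curve_diff: "L2_curve (\<lambda>s x. v s x - v t x)"
proof
  have [measurable]: "v t \<in> borel_measurable half_line" using v_square by (simp add: square_integrable_def)
  note [measurable] = v_measurable[unfolded case_prod_unfold]
  show "(\<lambda>(s, x). v s x - v t x) \<in> borel_measurable (lborel \<Otimes>\<^sub>M half_line)"
    unfolding case_prod_unfold by measurable
  show "square_integrable (\<lambda>x. v s x - v t x)" for s by (rule square_integrable_diff[OF v_square v_square])
  show "((\<lambda>s. mass (\<lambda>x. v s x - v t x - (v t' x - v t x))) \<longlongrightarrow> 0) (at t')" for t'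
    using v_continuous[of t'] by simp
qed

lemma mass_continuous: "continuous_on S (\<lambda>s. mass (v s))"
proof (rule continuous_at_imp_continuous_on, rule ballI)
  fix t show "isCont (\<lambda>s. mass (v s)) t"
    unfolding isCont_def by (rule mass_tendsto[OF v_square v_square v_continuous])
qed

lemma weight_compact_support:
  assumes "0 \<le> C"
  shows "weight (\<lambda>s. C * indicator {a..b} s)"
  unfolding weight_def
proof (intro conjI allI)
  have "integrable lborel (\<lambda>s. indicator {a..b} s *\<^sub>R C)"
    by (rule borel_integrable_compact[OF compact_Icc]) simp
  then show "integrable lborel (\<lambda>s. C * indicator {a..b} s)" by (simp add: mult.commute)
  have "integrable lborel (\<lambda>s. indicator {a..b} s *\<^sub>R (C * mass (v s)))"
    by (rule borel_integrable_compact[OF compact_Icc]) (intro continuous_intros mass_continuous)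
  then show "integrable lborel (\<lambda>s. C * indicator {a..b} s * mass (v s))" by (simp add: mult_ac)
  show "(\<lambda>s. C * indicator {a..b} s) \<in> borel_measurable lborel" by measurable
  show "0 \<le> C * indicator {a..b} s" for s using assms by simp
qed

end

context dirichlet_curve
begin

text \<open>For merely weak solutions the mass cannot be differentiated. Averages against a smooth approximate
  identity have constant mass by the preceding section, and they converge to \<open>v t\<close> in \<open>L\<^sup>2\<close> at
  every time by continuity of the curve.\<close>

theorem mass_conserved: "mass (v t) = mass (v 0)"
proof -
  \<comment> \<open>The derivative of the smooth step is a bump on \<open>[0, 1]\<close> of integral 1.\<close>
  define \<kappa> where "\<kappa> n = (deriv ^^ n) (deriv \<theta>)" for n
  have s: "smooth_fun (\<kappa> n)" for n
  proof (induction n)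
    case 0
    show ?case using smooth_fun_deriv[OF \<theta>(1)] by (simp add: \<kappa>_def)
  next
    case (Suc n)
    then show ?case using smooth_fun_deriv[OF Suc] by (simp add: \<kappa>_def)
  qed
  have supp: "\<kappa> n x = 0" if "x \<notin> {0..1}" for n x
    using that
  proof (induction n arbitrary: x)
    case 0
    have "x < 0 \<or> 1 < x" using 0 by auto
    then have "(\<theta> has_real_derivative 0) (at x)"
    proof
      assume "x < 0"
      show ?thesis
        by (rule has_field_derivative_transform_within_open[where f = "\<lambda>_. 0" and S = "{..<0}"]) (use \<theta>(4) \<open>x < 0\<close> in auto)
    next
      assume "1 < x"
      show ?thesis
        by (rule has_field_derivative_transform_within_open[where f = "\<lambda>_. 1" and S = "{1<..}"]) (use \<theta>(5) \<open>1 < x\<close> in auto)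
    qed
    then show ?case by (simp add: \<kappa>_def DERIV_imp_deriv)
  next
    case (Suc n)
    then show ?case using smooth_fun_deriv_eq_0_outside[OF s[of n] Suc.IH Suc.prems] by (simp add: \<kappa>_def)
  qed
  have "\<exists>B. \<forall>n. 0 \<le> B n \<and> (\<forall>x. \<bar>\<kappa> n x\<bar> \<le> B n)"
    by (rule choice, rule allI) (metis bounded_if_compact_support[OF smooth_fun_continuous[OF s] supp])
  then obtain B where B: "\<And>n. 0 \<le> B n" "\<And>n x. \<bar>\<kappa> n x\<bar> \<le> B n" by blast
  have ki: "integrable lborel (\<kappa> n)" for n
    by (rule integrable_if_compact_support[OF smooth_fun_continuous[OF s] supp])
  have k1: "(LINT x|lborel. \<kappa> 0 x) = 1"
  proof -
    have "(LINT x|lborel. indicator {0..1} x *\<^sub>R \<kappa> 0 x) = \<theta> 1 - \<theta> 0"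
    proof (rule integral_FTC_atLeastAtMost)
      show "(\<theta> has_vector_derivative \<kappa> 0 x) (at x within {0..1})" for x
        unfolding has_real_derivative_iff_has_vector_derivative[symmetric] \<kappa>_def
        by (simp add: has_field_derivative_at_within smooth_fun_has_derivative \<theta>(1))
    qed (auto intro: smooth_fun_continuous s)
    moreover have "(\<lambda>x. indicator {0..1} x *\<^sub>R \<kappa> 0 x) = \<kappa> 0"
      using supp by (auto simp: fun_eq_iff split: split_indicator)
    ultimately show ?thesis using \<theta>(4)[of 0] \<theta>(5)[of 1] by simp
  qed
  define \<epsilon> where "\<epsilon> i = 1 / real (Suc i)" for i
  have \<epsilon>: "0 < \<epsilon> i" "\<epsilon> i \<le> 1" for i by (auto simp: \<epsilon>_def)
  define k where "k i n t = complex_of_real ((1 / \<epsilon> i) ^ Suc n * \<kappa> n (t / \<epsilon> i))" for i n t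
  define W where "W i n T s = ((1 / \<epsilon> i) ^ Suc n * B n) * indicator {- real T - 1..real T + 1} s" for i n T s
  have k0: "k i n t = 0" if "t \<notin> {0..\<epsilon> i}" for i n t
    using supp[of "t / \<epsilon> i" n] that \<epsilon>[of i] by (auto simp: k_def field_simps)
  have KS: "kernel_sequence v h \<theta> (k i) (W i)" for i
  proof
    show "(k i n has_vector_derivative k i (Suc n) t) (at t)" for n t
    proof -
      have "((\<lambda>t. t / \<epsilon> i) has_real_derivative 1 / \<epsilon> i) (at t)"
        by (rule DERIV_cdivide[OF DERIV_ident])
      from DERIV_cmult[OF DERIV_chain2[OF smooth_fun_has_derivative[OF s] this], of "(1 / \<epsilon> i) ^ Suc n"]
      have "((\<lambda>t. (1 / \<epsilon> i) ^ Suc n * \<kappa> n (t / \<epsilon> i)) has_real_derivative (1 / \<epsilon> i) ^ Suc (Suc n) * \<kappa> (Suc n) (t / \<epsilon> i)) (at t)"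
        by (simp add: \<kappa>_def mult_ac)
      then show ?thesis unfolding k_def by (rule has_vector_derivative_of_real)
    qed
    show "weight (W i n T)" for n T
      unfolding W_def[abs_def] using B(1) \<epsilon>(1)[of i] by (intro weight_compact_support) (simp add: less_imp_le)
    show "norm (k i n (t - s)) \<le> W i n T s" if t: "\<bar>t\<bar> \<le> real T" for n T t s
    proof (cases "t - s \<in> {0..\<epsilon> i}")
      case True
      then have "s \<in> {- real T - 1..real T + 1}" using t \<epsilon>(2)[of i] by auto
      moreover have "norm (k i n (t - s)) \<le> (1 / \<epsilon> i) ^ Suc n * B n"
        using B(2)[of n] \<epsilon>(1)[of i] by (auto simp: k_def abs_mult norm_mult norm_divide norm_power power_divide intro!: divide_right_mono)
      ultimately show ?thesis by (simp add: W_def)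
    next
      case False
      then show ?thesis using k0[OF False, of n] B(1) \<epsilon>(1)[of i] by (simp add: W_def less_imp_le)
    qed
  qed
  have const: "mass (average (k i 0) t) = mass (average (k i 0) 0)" for i t
    by (rule kernel_sequence.mass_U_constant[OF KS])
  have sqa: "square_integrable (average (k i 0) t)" for i t
    by (rule kernel_sequence.U_square[OF KS])
  define A where "A = (LINT x|lborel. \<bar>\<kappa> 0 x\<bar>)"
  have A0: "0 \<le> A" unfolding A_def by (rule integral_nonneg_AE) simp
  have kI: "integrable lborel (\<lambda>s. k i 0 (t - s))" and kI1: "(LINT s|lborel. k i 0 (t - s)) = 1"
    and kA: "integrable lborel (\<lambda>s. norm (k i 0 (t - s)))" "(LINT s|lborel. norm (k i 0 (t - s))) = A" for i t
  proof -
    have e: "(t - s) / \<epsilon> i = t / \<epsilon> i + (- 1 / \<epsilon> i) * s" for s using \<epsilon>(1)[of i] by (simp add: field_simps)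
    have c: "- 1 / \<epsilon> i \<noteq> 0" using \<epsilon>(1)[of i] by simp
    have a: "\<bar>- 1 / \<epsilon> i\<bar> = 1 / \<epsilon> i" using \<epsilon>(1)[of i] by simp
    have i0: "integrable lborel (\<lambda>s. \<kappa> 0 ((t - s) / \<epsilon> i))"
      unfolding e by (rule lborel_integrable_real_affine[OF ki c])
    show "integrable lborel (\<lambda>s. k i 0 (t - s))"
      unfolding k_def by (intro integrable_of_real integrable_mult_right i0)
    then show "integrable lborel (\<lambda>s. norm (k i 0 (t - s)))" by (rule integrable_norm)
    have "1 = (1 / \<epsilon> i) * (LINT s|lborel. \<kappa> 0 ((t - s) / \<epsilon> i))"
      unfolding e using lborel_integral_real_affine[OF c, of "\<kappa> 0" "t / \<epsilon> i"] k1 a by simp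
    then have "(LINT s|lborel. (1 / \<epsilon> i) ^ Suc 0 * \<kappa> 0 ((t - s) / \<epsilon> i)) = 1" by simp
    then show "(LINT s|lborel. k i 0 (t - s)) = 1"
      unfolding k_def integral_complex_of_real by simp
    have "A = (1 / \<epsilon> i) * (LINT s|lborel. \<bar>\<kappa> 0 ((t - s) / \<epsilon> i)\<bar>)"
      unfolding e A_def using lborel_integral_real_affine[OF c, of "\<lambda>x. \<bar>\<kappa> 0 x\<bar>" "t / \<epsilon> i"] a by simp
    also have "\<dots> = (LINT s|lborel. (1 / \<epsilon> i) * \<bar>\<kappa> 0 ((t - s) / \<epsilon> i)\<bar>)" by simp
    also have "\<dots> = (LINT s|lborel. norm (k i 0 (t - s)))"
      by (rule Bochner_Integration.integral_cong) (use \<epsilon>(1)[of i] in \<open>auto simp: k_def abs_mult norm_mult norm_divide\<close>)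
    finally show "(LINT s|lborel. norm (k i 0 (t - s))) = A" ..
  qed
  have kc: "continuous_on S (\<lambda>s. k i 0 (t - s))" for i t S
    unfolding k_def using \<epsilon>(1)[of i]
    by (intro continuous_intros continuous_on_compose2[OF smooth_fun_continuous[OF s[of 0], of UNIV]]) auto
  have km: "k i 0 \<in> borel_measurable borel" for i
    by (rule kernel_sequence.k_measurable[OF KS])
  have lim: "(\<lambda>i. mass (average (k i 0) t)) \<longlonglongrightarrow> mass (v t)" for t
  proof (rule mass_tendsto[OF sqa v_square])
    \<comment> \<open>The error is the average of the translated curve \<open>v s - v t\<close>, so the general bound applies.\<close>
    interpret d: L2_curve "\<lambda>s x. v s x - v t x" by (rule L2_curve_diff)
    have eq: "mass (\<lambda>x. average (k i 0) t x - v t x) = mass (d.average (k i 0) t)" for i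
    proof (rule square_integrable_AE_cong(2)[symmetric])
      show "square_integrable (\<lambda>x. average (k i 0) t x - v t x)" by (rule square_integrable_diff[OF sqa v_square])
      show "d.average (k i 0) t \<in> borel_measurable half_line" by (rule d.average_measurable[OF km])
      obtain T :: nat where T: "\<bar>t\<bar> \<le> real T" using real_arch_simple by blast
      show "AE x in half_line. average (k i 0) t x - v t x = d.average (k i 0) t x"
        using weighted_AE_integrable[OF kernel_sequence.W[OF KS[of i]], of 0 T] AE_space
      proof eventually_elim
        case (elim x)
        have vm: "(\<lambda>s. v s x) \<in> borel_measurable lborel"
          by (rule v_measurable_compose[where f = "\<lambda>s. s" and g = "\<lambda>_. x"])
             (simp, rule measurable_const[OF elim(2)])
        have i1: "integrable lborel (\<lambda>s. k i 0 (t - s) * v s x)"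
        proof (rule Bochner_Integration.integrable_bound)
          show "integrable lborel (\<lambda>s. W i 0 T s * norm (v s x))" using elim by blast
          show "(\<lambda>s. k i 0 (t - s) * v s x) \<in> borel_measurable lborel"
            using borel_measurable_times[OF borel_measurable_integrable[OF kI] vm] .
          show "AE s in lborel. norm (k i 0 (t - s) * v s x) \<le> norm (W i 0 T s * norm (v s x))"
            by (intro AE_I2) (auto simp: norm_mult abs_mult intro!: mult_right_mono order_trans[OF kernel_sequence.k_le[OF KS T] abs_ge_self])
        qed
        have "d.average (k i 0) t x = (LINT s|lborel. k i 0 (t - s) * v s x - k i 0 (t - s) * v t x)"
          unfolding d.average_def by (rule Bochner_Integration.integral_cong) (auto simp: algebra_simps)
        also have "\<dots> = average (k i 0) t x - v t x"
          using i1 kI kI1 by (simp add: average_def)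
        finally show ?case ..
      qed
    qed
    have bound: "mass (d.average (k i 0) t) \<le> A * (A * e)"
      if e: "\<And>s. \<bar>s - t\<bar> \<le> \<epsilon> i \<Longrightarrow> mass (\<lambda>x. v s x - v t x) \<le> e" "0 \<le> e" for i e
    proof -
      let ?w = "\<lambda>s. norm (k i 0 (t - s))"
      have le: "?w s * mass (\<lambda>x. v s x - v t x) \<le> ?w s * e" for s
      proof (cases "t - s \<in> {0..\<epsilon> i}")
        case True
        then show ?thesis by (intro mult_left_mono e) auto
      qed (use k0 in simp)
      have wi: "integrable lborel (\<lambda>s. ?w s * mass (\<lambda>x. v s x - v t x))"
      proof (rule Bochner_Integration.integrable_bound[OF integrable_mult_left[OF kA(1), of i t e]])
        show "(\<lambda>s. ?w s * mass (\<lambda>x. v s x - v t x)) \<in> borel_measurable lborel"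
          by (rule borel_measurable_times[OF borel_measurable_integrable[OF kA(1)] d.mass_measurable])
        show "AE s in lborel. norm (?w s * mass (\<lambda>x. v s x - v t x)) \<le> norm (?w s * e)"
          using le mass_nonneg e(2) by (intro AE_I2) (simp add: abs_mult)
      qed
      have w: "d.weight ?w"
        unfolding d.weight_def using kA(1)[of i t] wi by auto
      have "mass (d.average (k i 0) t) \<le> (LINT s|lborel. ?w s) * (LINT s|lborel. ?w s * mass (\<lambda>x. v s x - v t x))"
        by (rule d.average_square_integrable(2)[OF km w]) simp
      also have "(LINT s|lborel. ?w s * mass (\<lambda>x. v s x - v t x)) \<le> (LINT s|lborel. ?w s * e)"
        by (rule integral_mono[OF wi integrable_mult_left[OF kA(1)] le])
      also have "(LINT s|lborel. ?w s * e) = A * e" using kA[of i t] by simp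
      finally show ?thesis using kA(2)[of i t] A0 by (simp add: mult_left_mono)
    qed
    show "(\<lambda>i. mass (\<lambda>x. average (k i 0) t x - v t x)) \<longlonglongrightarrow> 0"
      unfolding eq
    proof (rule LIMSEQ_I)
      fix r :: real assume r: "0 < r"
      define X where "X = A * A + 1"
      define e where "e = r / (2 * X)"
      have AA: "0 < X" using A0 by (simp add: X_def add_nonneg_pos)
      have e0: "0 < e" using r AA by (simp add: e_def)
      have "eventually (\<lambda>s. mass (\<lambda>x. v s x - v t x) < e) (at t)"
        using order_tendstoD(2)[OF v_continuous e0] .
      then obtain \<delta> where \<delta>: "\<delta> > 0" "\<And>s. s \<noteq> t \<Longrightarrow> dist s t < \<delta> \<Longrightarrow> mass (\<lambda>x. v s x - v t x) < e"
        unfolding eventually_at by auto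
      have small: "mass (\<lambda>x. v s x - v t x) \<le> e" if "\<bar>s - t\<bar> < \<delta>" for s
        using \<delta>(2)[of s] that e0 by (cases "s = t") (auto simp: dist_real_def mass_def)
      have "\<epsilon> \<longlonglongrightarrow> 0" unfolding \<epsilon>_def[abs_def] using LIMSEQ_Suc[OF lim_1_over_n[where 'a = real]] by simp
      from order_tendstoD(2)[OF this \<delta>(1)] obtain N where N: "\<And>i. i \<ge> N \<Longrightarrow> \<epsilon> i < \<delta>"
        unfolding eventually_sequentially by blast
      show "\<exists>N. \<forall>i\<ge>N. norm (mass (d.average (k i 0) t) - 0) < r"
      proof (intro exI[of _ N] allI impI)
        fix i assume "i \<ge> N"
        then have "mass (d.average (k i 0) t) \<le> A * (A * e)"
          using N[of i] e0 by (intro bound small) auto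
        also have "\<dots> \<le> X * e" using e0 by (simp add: X_def algebra_simps)
        also have "\<dots> < r" using r AA by (simp add: e_def)
        finally show "norm (mass (d.average (k i 0) t) - 0) < r" using mass_nonneg by simp
      qed
    qed
  qed
  have "(\<lambda>i. mass (average (k i 0) t)) \<longlonglongrightarrow> mass (v 0)"
    unfolding const[of _ t] by (rule lim)
  then show ?thesis using lim[of t] LIMSEQ_unique by blast
qed

end


section \<open>The kernel of the frequency cut-off\<close>

definition fourier_kernel :: "(real \<Rightarrow> real) \<Rightarrow> real \<Rightarrow> complex" where
  "fourier_kernel p t =
     1 / (2 * of_real pi) * (\<integral>\<tau>. exp (\<i> * of_real (t * \<tau>)) * of_real (p \<tau>) \<partial>lborel)"

lemma Cc_infinity_subset: "p \<in> Cc_infinity K \<Longrightarrow> p \<in> Cc_infinity UNIV"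
  by (simp add: Cc_infinity_def)

lemma Cc_infinity_mult_ident:
  assumes "p \<in> Cc_infinity UNIV"
  shows "(\<lambda>\<tau>. \<tau> * p \<tau>) \<in> Cc_infinity UNIV"
proof -
  obtain B where B: "smooth_fun p" "B > 0" "\<And>x. \<bar>x\<bar> \<ge> B \<Longrightarrow> p x = 0"
    using Cc_infinityE[OF assms] by metis
  show ?thesis
  proof (rule Cc_infinityI[of _ "-B" B])
    show "smooth_fun (\<lambda>\<tau>. \<tau> * p \<tau>)" by (intro smooth_fun_mult smooth_fun_ident B)
    fix x assume "x * p x \<noteq> 0"
    then have "\<not> \<bar>x\<bar> \<ge> B" using B(3) by auto
    then show "-B \<le> x \<and> x \<le> B" by auto
  qed
qed

lemma Cc_infinity_deriv:
  assumes "p \<in> Cc_infinity UNIV"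
  shows "deriv p \<in> Cc_infinity UNIV"
proof -
  obtain B where B: "smooth_fun p" "B > 0" "\<And>x. \<bar>x\<bar> \<ge> B \<Longrightarrow> p x = 0"
    using Cc_infinityE[OF assms] by metis
  have z: "p x = 0" if "x \<notin> {-B..B}" for x using that B(3)[of x] by (auto simp: abs_if split: if_splits)
  show ?thesis
  proof (rule Cc_infinityI[of _ "-B" B])
    show "smooth_fun (deriv p)" by (intro smooth_fun_deriv B)
    fix x assume "deriv p x \<noteq> 0"
    then have "x \<in> {-B..B}"
      using smooth_fun_deriv_eq_0_outside[where a = "-B" and b = B, OF B(1) z] by blast
    then show "-B \<le> x \<and> x \<le> B" by simp
  qed
qed

lemma Cc_infinity_dilate:
  assumes "p \<in> Cc_infinity UNIV" "h > 0"
  shows "(\<lambda>\<tau>. p (h * \<tau>)) \<in> Cc_infinity UNIV"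
proof -
  obtain B where B: "smooth_fun p" "B > 0" "\<And>x. \<bar>x\<bar> \<ge> B \<Longrightarrow> p x = 0"
    using Cc_infinityE[OF assms(1)] by metis
  show ?thesis
  proof (rule Cc_infinityI[of _ "-(B/h)" "B/h"])
    show "smooth_fun (\<lambda>\<tau>. p (h * \<tau>))" using smooth_fun_affine[OF B(1), of h 0] by simp
    fix x assume "p (h * x) \<noteq> 0"
    then have "\<bar>h * x\<bar> < B" using B(3)[of "h * x"] by force
    then have "h * x < B" "- B < h * x" by linarith+
    then show "-(B/h) \<le> x \<and> x \<le> B/h" using assms(2) by (simp add: field_simps)
  qed
qed

lemma Cc_infinity_integrable:
  assumes p: "p \<in> Cc_infinity UNIV"
  shows "integrable lborel p"
    and "integrable lborel (\<lambda>\<tau>. exp (\<i> * of_real (t * \<tau>)) * of_real (p \<tau>))"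
proof -
  obtain B where B: "smooth_fun p" "B > 0" "\<And>x. \<bar>x\<bar> \<ge> B \<Longrightarrow> p x = 0"
    using Cc_infinityE[OF p] by metis
  have z: "p x = 0" if "x \<notin> {-B..B}" for x using that B(3)[of x] by (auto simp: abs_if split: if_splits)
  show "integrable lborel p"
    by (rule integrable_if_compact_support[OF smooth_fun_continuous[OF B(1)] z])
  show "integrable lborel (\<lambda>\<tau>. exp (\<i> * of_real (t * \<tau>)) * of_real (p \<tau>))"
    by (rule integrable_if_compact_support[where a = "-B" and b = B])
       (use z in \<open>auto intro!: continuous_intros smooth_fun_continuous[OF B(1)]\<close>)
qed

lemma norm_exp_i_real: "norm (exp (\<i> * complex_of_real x)) = 1"
  by (simp add: norm_exp_eq_Re)

lemma fourier_kernel_le: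
  assumes p: "p \<in> Cc_infinity UNIV"
  shows "norm (fourier_kernel p t) \<le> (LINT \<tau>|lborel. \<bar>p \<tau>\<bar>)"
proof -
  have "norm (\<integral>\<tau>. exp (\<i> * of_real (t * \<tau>)) * of_real (p \<tau>) \<partial>lborel) \<le> (LINT \<tau>|lborel. \<bar>p \<tau>\<bar>)"
    by (rule Bochner_Integration.integral_norm_bound_integral[OF Cc_infinity_integrable(2)[OF p]])
       (use Cc_infinity_integrable(1)[OF p] norm_exp_i_real in \<open>auto simp: norm_mult simp del: of_real_mult\<close>)
  moreover have "1 \<le> 2 * pi" using pi_gt3 by linarith
  ultimately show ?thesis
    unfolding fourier_kernel_def norm_mult
    using mult_mono[of "norm (1 / (2 * complex_of_real pi))" 1 "norm (\<integral>\<tau>. exp (\<i> * of_real (t * \<tau>)) * of_real (p \<tau>) \<partial>lborel)" "LINT \<tau>|lborel. \<bar>p \<tau>\<bar>"]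
    by (simp add: norm_divide norm_mult divide_le_eq)
qed

lemma fourier_kernel_deriv:
  assumes p: "p \<in> Cc_infinity UNIV"
  shows "fourier_kernel (deriv p) t = - (\<i> * of_real t) * fourier_kernel p t"
proof -
  have sp: "smooth_fun p" using p by (simp add: Cc_infinity_def)
  let ?e = "\<lambda>\<tau>. exp (\<i> * complex_of_real (t * \<tau>))"
  note i1 = Cc_infinity_integrable(2)[OF p, of t] and i2 = Cc_infinity_integrable(2)[OF Cc_infinity_deriv[OF p], of t]
  have "(LINT \<tau>|lborel. ?e \<tau> * of_real (deriv p \<tau>) + (\<i> * of_real t) * (?e \<tau> * of_real (p \<tau>))) = 0"
  proof (rule integral_derivative_eq_0)
    show "((\<lambda>\<tau>. ?e \<tau> * of_real (p \<tau>)) has_vector_derivative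
        ?e \<tau> * of_real (deriv p \<tau>) + (\<i> * of_real t) * (?e \<tau> * of_real (p \<tau>))) (at \<tau>)" for \<tau>
    proof -
      have "((\<lambda>\<tau>. ?e \<tau>) has_vector_derivative (\<i> * of_real t) * ?e \<tau>) (at \<tau>)"
      proof -
        have "((\<lambda>z. exp (\<i> * (of_real t * z))) has_field_derivative (\<i> * of_real t) * exp (\<i> * (of_real t * of_real \<tau>))) (at (of_real \<tau>))"
          by (auto intro!: derivative_eq_intros)
        from has_vector_derivative_real_field[OF this] show ?thesis by simp
      qed
      from has_vector_derivative_mult[OF this has_vector_derivative_of_real[OF smooth_fun_has_derivative[OF sp]]]
      show ?thesis by (simp add: algebra_simps)
    qed
    show "continuous_on UNIV (\<lambda>\<tau>. ?e \<tau> * of_real (deriv p \<tau>) + (\<i> * of_real t) * (?e \<tau> * of_real (p \<tau>)))"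
      by (intro continuous_intros smooth_fun_continuous sp smooth_fun_deriv)
    show "integrable lborel (\<lambda>\<tau>. ?e \<tau> * of_real (p \<tau>))" by (rule i1)
    show "integrable lborel (\<lambda>\<tau>. ?e \<tau> * of_real (deriv p \<tau>) + (\<i> * of_real t) * (?e \<tau> * of_real (p \<tau>)))"
      by (intro Bochner_Integration.integrable_add integrable_mult_right i1 i2)
  qed
  then have "(LINT \<tau>|lborel. ?e \<tau> * of_real (deriv p \<tau>)) = - ((\<i> * of_real t) * (LINT \<tau>|lborel. ?e \<tau> * of_real (p \<tau>)))"
    unfolding Bochner_Integration.integral_add[OF i2 integrable_mult_right[OF i1]] integral_mult_right_zero
    by (simp only: eq_neg_iff_add_eq_0)
  then show ?thesis by (simp add: fourier_kernel_def del: of_real_mult)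
qed

text \<open>Two integrations by parts.\<close>

lemma fourier_kernel_decay:
  assumes p: "p \<in> Cc_infinity UNIV"
  obtains D where "0 \<le> D" "\<And>t. norm (fourier_kernel p t) \<le> D / (1 + t\<^sup>2)"
proof -
  note p1 = Cc_infinity_deriv[OF p]
  note p2 = Cc_infinity_deriv[OF p1]
  define D where "D = (LINT \<tau>|lborel. \<bar>p \<tau>\<bar>) + (LINT \<tau>|lborel. \<bar>deriv (deriv p) \<tau>\<bar>)"
  show thesis
  proof (rule that[of D])
    show "0 \<le> D" unfolding D_def by (intro add_nonneg_nonneg integral_nonneg_AE) auto
    fix t
    have "fourier_kernel (deriv (deriv p)) t = - (of_real (t\<^sup>2)) * fourier_kernel p t"
      unfolding fourier_kernel_deriv[OF p1] fourier_kernel_deriv[OF p] by (simp add: power2_eq_square algebra_simps)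
    then have "norm (fourier_kernel (deriv (deriv p)) t) = t\<^sup>2 * norm (fourier_kernel p t)"
      by (simp add: norm_mult norm_power)
    then have "(1 + t\<^sup>2) * norm (fourier_kernel p t) \<le> D"
      using fourier_kernel_le[OF p, of t] fourier_kernel_le[OF p2, of t] by (simp add: D_def algebra_simps)
    moreover have "0 < 1 + t\<^sup>2" by (simp add: add_pos_nonneg)
    ultimately show "norm (fourier_kernel p t) \<le> D / (1 + t\<^sup>2)" by (simp add: pos_le_divide_eq mult.commute)
  qed
qed

lemma fourier_kernel_has_derivative:
  assumes p: "p \<in> Cc_infinity UNIV"
  shows "(fourier_kernel p has_vector_derivative \<i> * fourier_kernel (\<lambda>\<tau>. \<tau> * p \<tau>) t) (at t)"
proof -
  note q = Cc_infinity_mult_ident[OF p]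
  have "((\<lambda>t. \<integral>\<tau>. exp (\<i> * of_real (t * \<tau>)) * of_real (p \<tau>) \<partial>lborel) has_vector_derivative
      (\<integral>\<tau>. \<i> * (exp (\<i> * of_real (t * \<tau>)) * of_real (\<tau> * p \<tau>)) \<partial>lborel)) (at t)"
  proof (rule has_vector_derivative_integral_dominated[where a = "t - 1" and b = "t + 1" and w = "\<lambda>\<tau>. \<bar>\<tau> * p \<tau>\<bar>"])
    show "integrable lborel (\<lambda>\<tau>. \<bar>\<tau> * p \<tau>\<bar>)" by (intro integrable_abs Cc_infinity_integrable(1) q)
    show "(\<lambda>\<tau>. \<i> * (exp (\<i> * of_real (t * \<tau>)) * of_real (\<tau> * p \<tau>))) \<in> borel_measurable lborel"
      by (rule borel_measurable_integrable[OF integrable_mult_right[OF Cc_infinity_integrable(2)[OF q]]])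
    show "AE \<tau> in lborel. \<forall>t\<in>{t - 1<..<t + 1}.
        ((\<lambda>t. exp (\<i> * of_real (t * \<tau>)) * of_real (p \<tau>)) has_vector_derivative
          \<i> * (exp (\<i> * of_real (t * \<tau>)) * of_real (\<tau> * p \<tau>))) (at t) \<and>
        norm (\<i> * (exp (\<i> * of_real (t * \<tau>)) * of_real (\<tau> * p \<tau>))) \<le> \<bar>\<tau> * p \<tau>\<bar>"
    proof (rule AE_I2, rule ballI, rule conjI)
      fix \<tau> s
      have "((\<lambda>z. exp (\<i> * (z * of_real \<tau>)) * of_real (p \<tau>)) has_field_derivative
          \<i> * (exp (\<i> * (of_real s * of_real \<tau>)) * of_real (\<tau> * p \<tau>))) (at (of_real s))"
        by (auto intro!: derivative_eq_intros simp: algebra_simps)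
      from has_vector_derivative_real_field[OF this]
      show "((\<lambda>t. exp (\<i> * of_real (t * \<tau>)) * of_real (p \<tau>)) has_vector_derivative
          \<i> * (exp (\<i> * of_real (s * \<tau>)) * of_real (\<tau> * p \<tau>))) (at s)" by simp
      show "norm (\<i> * (exp (\<i> * of_real (s * \<tau>)) * of_real (\<tau> * p \<tau>))) \<le> \<bar>\<tau> * p \<tau>\<bar>"
        unfolding norm_mult norm_exp_i_real by (simp add: norm_mult abs_mult)
    qed
  qed (use Cc_infinity_integrable(2)[OF p] in auto)
  from has_vector_derivative_mult_right[OF this, of "1 / (2 * of_real pi)"]
  show ?thesis
    unfolding fourier_kernel_def[abs_def] integral_mult_right_zero by (simp add: mult_ac del: of_real_mult)
qed

lemma fourier_kernel_dilate:
  assumes h: "h > 0"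
  shows "fourier_kernel (\<lambda>\<tau>. p (h * \<tau>)) t = of_real (1 / h) * fourier_kernel p (t / h)"
proof -
  have "(LINT \<tau>|lborel. exp (\<i> * of_real (t / h * \<tau>)) * of_real (p \<tau>)) =
      \<bar>h\<bar> *\<^sub>R (LINT \<tau>|lborel. exp (\<i> * of_real (t / h * (0 + h * \<tau>))) * of_real (p (0 + h * \<tau>)))"
    by (rule lborel_integral_real_affine) (use h in simp)
  also have "\<dots> = of_real h * (LINT \<tau>|lborel. exp (\<i> * of_real (t * \<tau>)) * of_real (p (h * \<tau>)))"
    using h by (simp add: scaleR_conv_of_real)
  finally show ?thesis using h by (simp add: fourier_kernel_def del: of_real_mult)
qed

text \<open>The profile by which all rapidly decreasing kernels below are dominated.\<close>

definition lorentz :: "real \<Rightarrow> real" where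
  "lorentz s = 1 / (1 + s\<^sup>2)"

lemma lorentz_pos: "0 < lorentz s"
  by (simp add: lorentz_def add_pos_nonneg)

lemma lorentz_integrable: "integrable lborel lorentz"
  using integrable_inverse_1_plus_square
  by (simp add: set_integrable_def lorentz_def[abs_def] inverse_eq_divide)

lemma lorentz_shift:
  "lorentz (t - s) \<le> 2 * (1 + t\<^sup>2) * lorentz s"
proof -
  have "0 \<le> (s - 2 * t)\<^sup>2 + 2 * t\<^sup>2 * (t - s)\<^sup>2 + 1 + 0 * s" by (simp add: sum_power2_ge_zero)
  then have "1 + s\<^sup>2 \<le> 2 * (1 + t\<^sup>2) * (1 + (t - s)\<^sup>2)" by (simp add: power2_eq_square algebra_simps)
  moreover have "0 < 1 + s\<^sup>2" "0 < 1 + (t - s)\<^sup>2" by (simp_all add: add_pos_nonneg)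
  ultimately show ?thesis by (simp add: lorentz_def field_simps)
qed

lemma lorentz_dilate:
  assumes h: "h > 0"
  shows "integrable lborel (\<lambda>s. lorentz ((t - s) / h))" "(LINT s|lborel. lorentz ((t - s) / h)) = h * (LINT s|lborel. lorentz s)"
proof -
  have e: "(t - s) / h = t / h + (- 1 / h) * s" for s by (simp add: diff_divide_distrib)
  have c: "- 1 / h \<noteq> 0" "\<bar>- 1 / h\<bar> = 1 / h" using h by auto
  show "integrable lborel (\<lambda>s. lorentz ((t - s) / h))"
    unfolding e by (rule lborel_integrable_real_affine[OF lorentz_integrable c(1)])
  show "(LINT s|lborel. lorentz ((t - s) / h)) = h * (LINT s|lborel. lorentz s)"
    unfolding e using lborel_integral_real_affine[OF c(1), of lorentz "t / h"] c(2) h by simp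
qed

lemma time_cutoff_eq_average:
  assumes "L2_curve v"
  shows "time_cutoff \<psi> h v t x = L2_curve.average v (fourier_kernel (\<lambda>\<tau>. \<psi> (h * \<tau>))) t x"
  unfolding time_cutoff_def fourier_multiplier_def L2_curve.average_def[OF assms] fourier_kernel_def ..

context dirichlet_curve
begin

lemma weight_lorentz:
  assumes "0 \<le> C"
  shows "weight (\<lambda>s. C * lorentz s)"
  unfolding weight_def
proof (intro conjI allI)
  define M where "M = mass (v 0)"
  have M: "mass (v s) = M" for s unfolding M_def by (rule mass_conserved)
  show i: "integrable lborel (\<lambda>s. C * lorentz s)" by (rule integrable_mult_right[OF lorentz_integrable])
  show "(\<lambda>s. C * lorentz s) \<in> borel_measurable lborel" by (rule borel_measurable_integrable[OF i])
  show "integrable lborel (\<lambda>s. C * lorentz s * mass (v s))" unfolding M by (rule integrable_mult_left[OF i])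
  show "0 \<le> C * lorentz s" for s using assms lorentz_pos[of s] by simp
qed

text \<open>Young's inequality: the \<open>L\<^sup>1\<close> norm of the kernel is that of the undilated profile, independently
  of \<open>h\<close>.\<close>

lemma mass_average_dilated:
  assumes k: "k \<in> borel_measurable borel" and C: "0 \<le> C"
    and le: "\<And>t. norm (k t) \<le> C / h * lorentz (t / h)"
  shows "mass (average k t) \<le> (C * (LINT s|lborel. lorentz s))\<^sup>2 * mass (v 0)"
proof -
  note L = lorentz_dilate[OF h, of t]
  define w where "w s = C / h * lorentz ((t - s) / h)" for s
  have wi: "integrable lborel w" unfolding w_def[abs_def] by (intro integrable_mult_right L)
  have wI: "(LINT s|lborel. w s) = C * (LINT s|lborel. lorentz s)"
    unfolding w_def using L(2) h by simp
  define M where "M = mass (v 0)"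
  have M: "mass (v s) = M" for s unfolding M_def by (rule mass_conserved)
  have "weight w"
    unfolding weight_def M
  proof (intro conjI allI wi borel_measurable_integrable[OF wi] integrable_mult_left[OF wi])
    show "0 \<le> w s" for s using C h lorentz_pos[of "(t - s) / h"] by (simp add: w_def)
  qed
  then have "mass (average k t) \<le> (LINT s|lborel. w s) * (LINT s|lborel. w s * mass (v s))"
    by (rule average_square_integrable(2)[OF k]) (unfold w_def, rule le)
  also have "(LINT s|lborel. w s * mass (v s)) = (LINT s|lborel. w s) * M"
    unfolding M using wi by simp
  finally show ?thesis unfolding wI by (simp add: M_def power2_eq_square mult_ac)
qed

end

text \<open>Dilation shows that the kernel of \<open>\<psi>(h D\<^sub>t)\<close> has \<open>L\<^sup>1\<close> norm independent of \<open>h\<close>, and its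
  derivative one of order \<open>1/h\<close>. So \<open>u = \<psi>(h D\<^sub>t) v\<close> and \<open>h u\<^sub>t\<close> are bounded in \<open>L\<^sup>2\<close> by the data, and the
  Morawetz estimate yields bounds of order \<open>1/h\<close> for \<open>sup \<bar>u\<bar>\<^sup>2\<close> and \<open>1/h\<^sup>2\<close> for
  \<open>\<integral> sup \<bar>u\<bar>\<^sup>6 dt\<close>. The supremum need not be measurable in time, hence the measurable bound \<open>H\<close>.\<close>

lemma cutoff_estimates:
  fixes \<psi> :: "real \<Rightarrow> real"
  assumes \<psi>: "\<psi> \<in> Cc_infinity UNIV"
  shows "\<exists>K\<ge>1. \<forall>v h \<theta>. dirichlet_curve v h \<theta> \<longrightarrow>
    (\<forall>t. square_integrable (time_cutoff \<psi> h v t) \<and> mass (time_cutoff \<psi> h v t) \<le> K * mass (v 0)) \<and>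
    (\<lambda>(t, x). time_cutoff \<psi> h v t x) \<in> borel_measurable (lborel \<Otimes>\<^sub>M half_line) \<and>
    (\<exists>S H. (\<forall>t. 0 \<le> S t \<and> (AE x in half_line. norm (time_cutoff \<psi> h v t x) \<le> S t) \<and> (S t)\<^sup>2 \<le> K * mass (v 0) / h) \<and>
      (\<forall>t\<in>{-1..1}. S t ^ 6 \<le> H t) \<and> H \<in> borel_measurable lborel \<and>
      (\<integral>\<^sup>+t. ennreal (H t) \<partial>lborel) \<le> ennreal (K * mass (v 0) ^ 3 / h\<^sup>2))"
proof -
  define P where "P n = (\<lambda>\<tau>. \<tau> ^ n * \<psi> \<tau>)" for n
  have PC: "P n \<in> Cc_infinity UNIV" for n
  proof (induction n)
    case 0
    show ?case using \<psi> by (simp add: P_def)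
  next
    case (Suc n)
    then show ?case using Cc_infinity_mult_ident[OF Suc] by (simp add: P_def mult.assoc)
  qed
  have "\<exists>D. \<forall>n. 0 \<le> D n \<and> (\<forall>t. norm (fourier_kernel (P n) t) \<le> D n / (1 + t\<^sup>2))"
    by (rule choice, rule allI) (metis fourier_kernel_decay[OF PC])
  then obtain D where D0: "\<And>n. 0 \<le> D n" and D: "\<And>n t. norm (fourier_kernel (P n) t) \<le> D n * lorentz t"
    by (auto simp: lorentz_def)
  define I where "I = (LINT s|lborel. lorentz s)"
  have I0: "0 \<le> I" unfolding I_def by (rule integral_nonneg_AE) (simp add: less_imp_le[OF lorentz_pos])
  define a where "a = D 0 * I"
  define b where "b = D 1 * I"
  have ab0: "0 \<le> a" "0 \<le> b" using D0 I0 by (auto simp: a_def b_def)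
  define K1 where "K1 = 2 * sqrt (a\<^sup>2 * (a * b))"
  define K2 where "K2 = 4 * a\<^sup>2 * ((2 * (a\<^sup>2)\<^sup>2 + 4 * a\<^sup>2 * sqrt (a\<^sup>2 * (a * b))) / 2)"
  define K where "K = 1 + a\<^sup>2 + K1 + K2"
  have K12: "0 \<le> K1" "0 \<le> K2" using ab0 by (auto simp: K1_def K2_def)
  have K: "1 \<le> K" "a\<^sup>2 \<le> K" "K1 \<le> K" "K2 \<le> K" using K12 by (auto simp: K_def)
  show ?thesis
  proof (intro exI[of _ K] conjI K(1) allI impI)
    fix v h \<theta> assume DC: "dirichlet_curve v h \<theta>"
    interpret dirichlet_curve v h \<theta> by (rule DC)
    define M where "M = mass (v 0)"
    have M0: "0 \<le> M" by (simp add: M_def mass_nonneg)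
    \<comment> \<open>The \<open>n\<close>-th derivative of the kernel: each one multiplies the symbol by \<open>i \<tau>\<close>.\<close>
    define k where "k n t = \<i> ^ n * fourier_kernel (\<lambda>\<tau>. \<tau> ^ n * \<psi> (h * \<tau>)) t" for n t
    have dil: "fourier_kernel (\<lambda>\<tau>. \<tau> ^ n * \<psi> (h * \<tau>)) t = of_real ((1 / h) ^ Suc n) * fourier_kernel (P n) (t / h)" for n t
    proof -
      have "fourier_kernel (P n) (t / h) = of_real h * fourier_kernel (\<lambda>\<tau>. P n (h * \<tau>)) t"
        using fourier_kernel_dilate[OF h, of "P n" t] h by simp
      also have "fourier_kernel (\<lambda>\<tau>. P n (h * \<tau>)) t = of_real (h ^ n) * fourier_kernel (\<lambda>\<tau>. \<tau> ^ n * \<psi> (h * \<tau>)) t"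
      proof -
        have "(LINT \<tau>|lborel. exp (\<i> * of_real (t * \<tau>)) * of_real (P n (h * \<tau>))) =
            (LINT \<tau>|lborel. of_real (h ^ n) * (exp (\<i> * of_real (t * \<tau>)) * of_real (\<tau> ^ n * \<psi> (h * \<tau>))))"
          by (rule Bochner_Integration.integral_cong) (auto simp: P_def power_mult_distrib)
        then show ?thesis unfolding fourier_kernel_def integral_mult_right_zero by simp
      qed
      finally show ?thesis using h by (simp add: power_divide field_simps)
    qed
    have kle: "norm (k n t) \<le> (1 / h) ^ Suc n * D n * lorentz (t / h)" for n t
    proof -
      have "norm (k n t) = (1 / h) ^ Suc n * norm (fourier_kernel (P n) (t / h))"
        unfolding k_def dil using h by (simp add: norm_mult norm_power norm_divide)
      also have "\<dots> \<le> (1 / h) ^ Suc n * (D n * lorentz (t / h))"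
        by (rule mult_left_mono[OF D]) (use h in simp)
      finally show ?thesis by simp
    qed
    have hk: "(\<lambda>\<tau>. \<tau> ^ n * \<psi> (h * \<tau>)) \<in> Cc_infinity UNIV" for n
    proof (induction n)
      case 0
      show ?case using Cc_infinity_dilate[OF \<psi> h] by simp
    next
      case (Suc n)
      then show ?case using Cc_infinity_mult_ident[OF Suc] by (simp add: mult.assoc)
    qed
    have "\<exists>C. \<forall>n. 0 \<le> C n \<and> (\<forall>t. norm (fourier_kernel (\<lambda>\<tau>. \<tau> ^ n * \<psi> (h * \<tau>)) t) \<le> C n / (1 + t\<^sup>2))"
      by (rule choice, rule allI) (metis fourier_kernel_decay[OF hk])
    then obtain C where C0: "\<And>n. 0 \<le> C n" and C: "\<And>n t. norm (k n t) \<le> C n * lorentz t"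
      by (auto simp: lorentz_def k_def norm_mult norm_power)
    define W where "W n T s = (C n * (2 * (1 + (real T)\<^sup>2))) * lorentz s" for n T s
    have KS: "kernel_sequence v h \<theta> k W"
    proof
      show "(k n has_vector_derivative k (Suc n) t) (at t)" for n t
      proof -
        have "((\<lambda>t. \<i> ^ n * fourier_kernel (\<lambda>\<tau>. \<tau> ^ n * \<psi> (h * \<tau>)) t) has_vector_derivative
            \<i> ^ n * (\<i> * fourier_kernel (\<lambda>\<tau>. \<tau> * (\<tau> ^ n * \<psi> (h * \<tau>))) t)) (at t)"
          by (rule has_vector_derivative_mult_right[OF fourier_kernel_has_derivative[OF hk]])
        moreover have "k n = (\<lambda>t. \<i> ^ n * fourier_kernel (\<lambda>\<tau>. \<tau> ^ n * \<psi> (h * \<tau>)) t)"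
          by (simp add: k_def fun_eq_iff)
        ultimately show ?thesis by (simp add: k_def mult_ac)
      qed
      show "weight (W n T)" for n T
        unfolding W_def[abs_def] by (intro weight_lorentz mult_nonneg_nonneg add_nonneg_nonneg C0) simp_all
      show "norm (k n (t - s)) \<le> W n T s" if t: "\<bar>t\<bar> \<le> real T" for n T t s
      proof -
        have "norm (k n (t - s)) \<le> C n * lorentz (t - s)" by (rule C)
        also have "\<dots> \<le> C n * (2 * (1 + t\<^sup>2) * lorentz s)"
          by (intro mult_left_mono lorentz_shift C0)
        also have "\<dots> \<le> C n * (2 * (1 + (real T)\<^sup>2) * lorentz s)"
          using t C0 lorentz_pos[of s] by (intro mult_left_mono mult_right_mono add_mono) (auto simp: abs_le_square_iff[symmetric] less_imp_le)
        finally show ?thesis by (simp add: W_def mult.assoc)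
      qed
    qed
    interpret KS: kernel_sequence v h \<theta> k W by (rule KS)
    have cut: "time_cutoff \<psi> h v t = average (k 0) t" for t
      by (rule ext) (simp add: time_cutoff_eq_average[OF L2_curve_axioms] k_def[abs_def])
    have m: "mass (average (k 0) t) \<le> a\<^sup>2 * M" for t
      unfolding a_def M_def I_def
      by (rule mass_average_dilated[OF KS.k_measurable D0]) (use kle[of 0] in simp)
    have m1: "mass (average (k 1) t) \<le> (b / h)\<^sup>2 * M" for t
    proof -
      have "mass (average (k 1) t) \<le> (D 1 / h * (LINT s|lborel. lorentz s))\<^sup>2 * mass (v 0)"
        by (rule mass_average_dilated[OF KS.k_measurable]) (use kle[of 1] D0 h in \<open>auto simp: field_simps power2_eq_square\<close>)
      then show ?thesis by (simp add: b_def I_def M_def)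
    qed
    show "square_integrable (time_cutoff \<psi> h v t)" for t unfolding cut by (rule KS.U_square)
    show "mass (time_cutoff \<psi> h v t) \<le> K * mass (v 0)" for t
    proof -
      have "mass (time_cutoff \<psi> h v t) \<le> a\<^sup>2 * M" unfolding cut by (rule m)
      also have "\<dots> \<le> K * M" by (intro mult_right_mono K M0)
      finally show ?thesis by (simp add: M_def)
    qed
    show "(\<lambda>(t, x). time_cutoff \<psi> h v t x) \<in> borel_measurable (lborel \<Otimes>\<^sub>M half_line)"
      unfolding cut by (rule KS.U_pair_measurable)
    define \<mu> where "\<mu> = mass (average (k 0) 0)"
    define \<mu>1 where "\<mu>1 = mass (average (k 1) 0)"
    have \<mu>0: "0 \<le> \<mu>" "0 \<le> \<mu>1" by (simp_all add: \<mu>_def \<mu>1_def mass_nonneg)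
    have \<mu>: "\<mu> \<le> a\<^sup>2 * M" and \<mu>1: "\<mu>1 \<le> (b / h)\<^sup>2 * M" using m m1 by (auto simp: \<mu>_def \<mu>1_def)
    have s1: "sqrt (\<mu> * \<mu>1) \<le> a * b * M / h"
    proof (rule real_le_lsqrt)
      show "0 \<le> a * b * M / h" using ab0 M0 h by simp
      have "\<mu> * \<mu>1 \<le> (a\<^sup>2 * M) * ((b / h)\<^sup>2 * M)" using \<mu> \<mu>1 \<mu>0 M0 by (intro mult_mono) auto
      also have "\<dots> = (a * b * M / h)\<^sup>2" using h by (simp add: field_simps power2_eq_square)
      finally show "\<mu> * \<mu>1 \<le> (a * b * M / h)\<^sup>2" .
    qed
    have s2: "\<mu> * sqrt (\<mu> * \<mu>1) \<le> a\<^sup>2 * (a * b) * M\<^sup>2 / h"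
    proof -
      have "\<mu> * sqrt (\<mu> * \<mu>1) \<le> (a\<^sup>2 * M) * (a * b * M / h)" using \<mu> s1 \<mu>0 M0 by (intro mult_mono) auto
      then show ?thesis by (simp add: power2_eq_square mult_ac)
    qed
    have sq: "sqrt (X * M\<^sup>2) = sqrt X * M" for X using M0 by (simp add: real_sqrt_mult)
    from KS.morawetz_estimate[of 1, folded \<mu>_def \<mu>1_def] obtain H where Hm: "(\<lambda>t. indicator {-1..1} t *\<^sub>R H t) \<in> borel_measurable lborel" and H: "\<And>t. 0 \<le> H t"
      "(\<integral>\<^sup>+t\<in>{-1..1}. ennreal (H t) \<partial>lborel) \<le> ennreal ((2 * 1 * \<mu>\<^sup>2 + 4 * \<mu> * sqrt (\<mu> * h * sqrt (\<mu> * \<mu>1))) / (2 * h\<^sup>2))"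
      "\<forall>t. \<exists>S\<ge>0. (AE x in half_line. norm (average (k 0) t x) \<le> S) \<and> S ^ 6 \<le> 4 * \<mu> * H t \<and> S\<^sup>2 \<le> 2 * sqrt (\<mu> * sqrt (\<mu> * \<mu>1) / h)"
      by auto
    from choice[OF H(3)[unfolded Bex_def]] obtain S where S: "\<And>t. 0 \<le> S t"
      "\<And>t. AE x in half_line. norm (average (k 0) t x) \<le> S t" "\<And>t. S t ^ 6 \<le> 4 * \<mu> * H t"
      "\<And>t. (S t)\<^sup>2 \<le> 2 * sqrt (\<mu> * sqrt (\<mu> * \<mu>1) / h)" by blast
    have Ssup: "(S t)\<^sup>2 \<le> K * M / h" for t
    proof -
      have "\<mu> * sqrt (\<mu> * \<mu>1) / h \<le> a\<^sup>2 * (a * b) * M\<^sup>2 / h / h" by (rule divide_right_mono[OF s2]) (use h in simp)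
      also have "\<dots> = (a\<^sup>2 * (a * b)) * (M / h)\<^sup>2" by (simp add: power2_eq_square)
      finally have "sqrt (\<mu> * sqrt (\<mu> * \<mu>1) / h) \<le> sqrt ((a\<^sup>2 * (a * b)) * (M / h)\<^sup>2)"
        by (rule real_sqrt_le_mono)
      also have "\<dots> = sqrt (a\<^sup>2 * (a * b)) * (M / h)" using M0 h by (simp add: real_sqrt_mult)
      finally have "sqrt (\<mu> * sqrt (\<mu> * \<mu>1) / h) \<le> sqrt (a\<^sup>2 * (a * b)) * (M / h)" .
      then have "(S t)\<^sup>2 \<le> K1 * (M / h)" using S(4)[of t] by (simp add: K1_def)
      also have "\<dots> \<le> K * (M / h)" using K M0 h by (intro mult_right_mono) auto
      finally show ?thesis by simp
    qed
    have Hb: "4 * \<mu> * ((2 * 1 * \<mu>\<^sup>2 + 4 * \<mu> * sqrt (\<mu> * h * sqrt (\<mu> * \<mu>1))) / (2 * h\<^sup>2)) \<le> K * M ^ 3 / h\<^sup>2"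
    proof -
      have "\<mu> * h * sqrt (\<mu> * \<mu>1) \<le> h * (a\<^sup>2 * (a * b) * M\<^sup>2 / h)"
        using mult_left_mono[OF s2, of h] h by (simp add: mult_ac)
      also have "\<dots> = a\<^sup>2 * (a * b) * M\<^sup>2" using h by simp
      finally have r: "sqrt (\<mu> * h * sqrt (\<mu> * \<mu>1)) \<le> sqrt (a\<^sup>2 * (a * b)) * M"
        using sq[of "a\<^sup>2 * (a * b)"] real_sqrt_le_mono by metis
      have r0: "0 \<le> sqrt (\<mu> * h * sqrt (\<mu> * \<mu>1))" using \<mu>0 h by simp
      have "2 * 1 * \<mu>\<^sup>2 + 4 * \<mu> * sqrt (\<mu> * h * sqrt (\<mu> * \<mu>1)) \<le> 2 * 1 * (a\<^sup>2 * M)\<^sup>2 + 4 * (a\<^sup>2 * M) * (sqrt (a\<^sup>2 * (a * b)) * M)"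
        using \<mu> \<mu>0 r r0 M0 by (intro add_mono mult_mono mult_left_mono power_mono) auto
      then have "4 * \<mu> * ((2 * 1 * \<mu>\<^sup>2 + 4 * \<mu> * sqrt (\<mu> * h * sqrt (\<mu> * \<mu>1))) / (2 * h\<^sup>2))
          \<le> 4 * (a\<^sup>2 * M) * ((2 * 1 * (a\<^sup>2 * M)\<^sup>2 + 4 * (a\<^sup>2 * M) * (sqrt (a\<^sup>2 * (a * b)) * M)) / (2 * h\<^sup>2))"
        using \<mu> \<mu>0 r0 h M0 by (intro mult_mono divide_right_mono) auto
      also have "\<dots> = K2 * (M ^ 3 / h\<^sup>2)"
        using h by (simp add: K2_def field_simps power2_eq_square power3_eq_cube)
      also have "\<dots> \<le> K * (M ^ 3 / h\<^sup>2)" using K M0 by (intro mult_right_mono) auto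
      finally show ?thesis by simp
    qed
    define G where "G t = 4 * \<mu> * (indicator {-1..1} t *\<^sub>R H t)" for t
    have Gm: "G \<in> borel_measurable lborel"
      unfolding G_def[abs_def] by (intro borel_measurable_times borel_measurable_const Hm)
    have SG: "S t ^ 6 \<le> G t" if "t \<in> {-1..1}" for t using S(3)[of t] that by (simp add: G_def)
    have "(\<integral>\<^sup>+t. ennreal (G t) \<partial>lborel) = (\<integral>\<^sup>+t. ennreal (4 * \<mu>) * (ennreal (H t) * indicator {-1..1} t) \<partial>lborel)"
      using \<mu>0 H(1) by (intro nn_integral_cong) (auto simp: G_def ennreal_mult split: split_indicator)
    also have "\<dots> = ennreal (4 * \<mu>) * (\<integral>\<^sup>+t\<in>{-1..1}. ennreal (H t) \<partial>lborel)"
    proof (rule nn_integral_cmult)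
      have "(\<lambda>t. ennreal (indicator {-1..1} t *\<^sub>R H t)) \<in> borel_measurable lborel" using Hm by measurable
      also have "(\<lambda>t. ennreal (indicator {-1..1} t *\<^sub>R H t)) = (\<lambda>t. ennreal (H t) * indicator {-1..1} t)"
        by (auto simp: fun_eq_iff split: split_indicator)
      finally show "(\<lambda>t. ennreal (H t) * indicator {-1..1} t) \<in> borel_measurable lborel" .
    qed
    also have "\<dots> \<le> ennreal (4 * \<mu>) * ennreal ((2 * 1 * \<mu>\<^sup>2 + 4 * \<mu> * sqrt (\<mu> * h * sqrt (\<mu> * \<mu>1))) / (2 * h\<^sup>2))"
      by (rule mult_left_mono[OF H(2)]) simp
    also have "\<dots> \<le> ennreal (K * M ^ 3 / h\<^sup>2)"
      using Hb \<mu>0 h by (subst ennreal_mult[symmetric]) (auto intro!: ennreal_leI)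
    finally have "(\<integral>\<^sup>+t. ennreal (G t) \<partial>lborel) \<le> ennreal (K * M ^ 3 / h\<^sup>2)" .
    then show "\<exists>S H. (\<forall>t. 0 \<le> S t \<and> (AE x in half_line. norm (time_cutoff \<psi> h v t x) \<le> S t) \<and> (S t)\<^sup>2 \<le> K * mass (v 0) / h) \<and>
      (\<forall>t\<in>{-1..1}. S t ^ 6 \<le> H t) \<and> H \<in> borel_measurable lborel \<and>
      (\<integral>\<^sup>+t. ennreal (H t) \<partial>lborel) \<le> ennreal (K * mass (v 0) ^ 3 / h\<^sup>2)"
      unfolding cut M_def[symmetric] using S Ssup SG Gm by blast
  qed
qed


section \<open>Interpolation and the Strichartz bounds\<close>

lemma epowr_ennreal: "0 \<le> x \<Longrightarrow> epowr (ennreal x) p = ennreal (x powr p)"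
  by (simp add: epowr_def)

lemma epowr_mono:
  assumes "a \<le> b" "0 \<le> p"
  shows "epowr a p \<le> epowr b p"
proof (cases "b = top")
  case False
  then have "a \<noteq> top" using assms(1) top_unique by auto
  then show ?thesis
    using assms False
    by (auto simp: epowr_def enn2real_mono less_top intro!: ennreal_leI powr_mono2)
qed (simp add: epowr_def)

lemma epowr_measurable [measurable]:
  assumes [measurable]: "f \<in> borel_measurable M"
  shows "(\<lambda>x. epowr (f x) p) \<in> borel_measurable M"
  unfolding epowr_def by measurable

lemma Lp_norm_2:
  assumes f: "square_integrable f"
  shows "Lp_norm half_line 2 f = ennreal (sqrt (mass f))"
proof -
  have "(\<integral>\<^sup>+x. epowr (ennreal (norm (f x))) (enn2real 2) \<partial>half_line) = (\<integral>\<^sup>+x. ennreal ((norm (f x))\<^sup>2) \<partial>half_line)"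
    by (rule nn_integral_cong) (simp add: epowr_ennreal powr_numeral)
  also have "\<dots> = ennreal (mass f)"
    unfolding mass_def using f by (intro nn_integral_eq_integral) (auto simp: square_integrable_def)
  finally show ?thesis
    unfolding Lp_norm_def eLp_norm_def using mass_nonneg[of f]
    by (simp add: epowr_ennreal powr_half_sqrt)
qed

lemma square_integrable_iff_L2: "f \<in> L2_functions half_line \<longleftrightarrow> square_integrable f"
proof
  assume f: "f \<in> L2_functions half_line"
  then have m[measurable]: "f \<in> borel_measurable half_line" and l: "Lp_norm half_line 2 f < top"
    by (auto simp: L2_functions_def)
  have "(\<integral>\<^sup>+x. epowr (ennreal (norm (f x))) (enn2real 2) \<partial>half_line) = (\<integral>\<^sup>+x. ennreal ((norm (f x))\<^sup>2) \<partial>half_line)"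
    by (rule nn_integral_cong) (simp add: epowr_ennreal powr_numeral)
  then have "(\<integral>\<^sup>+x. ennreal ((norm (f x))\<^sup>2) \<partial>half_line) < top"
    using l unfolding Lp_norm_def eLp_norm_def by (auto simp: epowr_def less_top split: if_splits)
  then show "square_integrable f"
    using m by (simp add: square_integrable_def integrable_iff_bounded)
next
  assume f: "square_integrable f"
  then show "f \<in> L2_functions half_line"
    using Lp_norm_2[OF f] by (simp add: L2_functions_def square_integrable_def)
qed

lemma dirichlet_curve_if_solution:
  assumes sol: "dirichlet_solution h v0 v" and h: "h > 0"
    and \<theta>: "smooth_fun \<theta>" "\<And>x. 0 \<le> \<theta> x" "\<And>x. \<theta> x \<le> 1"
      "\<And>x. x \<le> 0 \<Longrightarrow> \<theta> x = 0" "\<And>x. 1 \<le> x \<Longrightarrow> \<theta> x = 1"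
  shows "dirichlet_curve v h \<theta>"
proof
  show "(\<lambda>(t, x). v t x) \<in> borel_measurable (lborel \<Otimes>\<^sub>M half_line)"
    using sol by (simp add: dirichlet_solution_def)
  show sq: "square_integrable (v t)" for t
    using sol by (simp add: dirichlet_solution_def square_integrable_iff_L2)
  show "((\<lambda>s. mass (\<lambda>x. v s x - v t x)) \<longlongrightarrow> 0) (at t)" for t
  proof -
    have "((\<lambda>s. Lp_norm half_line 2 (\<lambda>x. v s x - v t x)) \<longlongrightarrow> 0) (at t)"
      using sol by (simp add: dirichlet_solution_def)
    then have "((\<lambda>s. ennreal (sqrt (mass (\<lambda>x. v s x - v t x)))) \<longlongrightarrow> ennreal 0) (at t)"
      unfolding Lp_norm_2[OF square_integrable_diff[OF sq sq]] by simp
    then have "((\<lambda>s. sqrt (mass (\<lambda>x. v s x - v t x))) \<longlongrightarrow> 0) (at t)"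
      by (subst (asm) tendsto_ennreal_iff) (auto simp: mass_nonneg)
    then have "((\<lambda>s. (sqrt (mass (\<lambda>x. v s x - v t x)))\<^sup>2) \<longlongrightarrow> 0\<^sup>2) (at t)"
      by (rule tendsto_power)
    then show ?thesis by (simp add: mass_nonneg)
  qed
  show "\<exists>d. ((\<lambda>s. LINT x|half_line. v s x * of_real (\<phi> x)) has_vector_derivative d) (at t) \<and>
         \<i> * of_real h * d - (of_real h)\<^sup>2 * (LINT x|half_line. v t x * of_real (deriv (deriv \<phi>) x))
           + (LINT x|half_line. of_real x * v t x * of_real (\<phi> x)) = 0"
    if "\<phi> \<in> Cc_infinity UNIV" "\<phi> 0 = 0" for \<phi> t
    using sol that unfolding dirichlet_solution_def by blast
qed (use h \<theta> in auto)

text \<open>The essential supremum is at most \<open>c\<close> iff the set where \<open>c\<close> is exceeded is null, and the measure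
  of that set is measurable in time. Measurability matters: the essential supremum of a nonmeasurable
  function is infinite by definition.\<close>

lemma esssup_measurable:
  fixes F :: "real \<Rightarrow> real \<Rightarrow> complex"
  assumes F: "(\<lambda>(t, x). F t x) \<in> borel_measurable (lborel \<Otimes>\<^sub>M half_line)"
  shows "(\<lambda>t. esssup half_line (\<lambda>x. ennreal (norm (F t x)))) \<in> borel_measurable lborel"
proof (rule borel_measurableI_le)
  fix c :: ennreal
  have Fx: "(\<lambda>x. ennreal (norm (F t x))) \<in> borel_measurable half_line" for t
  proof -
    have "F t \<in> borel_measurable half_line"
      using measurable_compose[OF measurable_Pair1' F, of t] by simp
    then show ?thesis by measurable
  qed
  have eq: "esssup half_line (\<lambda>x. ennreal (norm (F t x))) \<le> c \<longleftrightarrow>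
      (\<integral>\<^sup>+x. indicator {c<..} (ennreal (norm (F t x))) \<partial>half_line) = 0" for t
  proof -
    have "esssup half_line (\<lambda>x. ennreal (norm (F t x))) \<le> c \<longleftrightarrow> (AE x in half_line. ennreal (norm (F t x)) \<le> c)"
    proof
      assume c: "esssup half_line (\<lambda>x. ennreal (norm (F t x))) \<le> c"
      show "AE x in half_line. ennreal (norm (F t x)) \<le> c"
        using esssup_AE[of "\<lambda>x. ennreal (norm (F t x))" half_line] by eventually_elim (use c in auto)
    qed (rule esssup_I[OF Fx])
    also have "\<dots> \<longleftrightarrow> (AE x in half_line. indicator {c<..} (ennreal (norm (F t x))) = (0::ennreal))"
      by (auto simp: indicator_def not_less)
    also have "\<dots> \<longleftrightarrow> (\<integral>\<^sup>+x. indicator {c<..} (ennreal (norm (F t x))) \<partial>half_line) = 0"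
    proof (rule nn_integral_0_iff_AE[symmetric])
      note [measurable] = Fx
      show "(\<lambda>x. indicator {c<..} (ennreal (norm (F t x)))) \<in> borel_measurable half_line" by measurable
    qed
    finally show ?thesis .
  qed
  have "(\<lambda>t. \<integral>\<^sup>+x. indicator {c<..} (ennreal (norm (F t x))) \<partial>half_line) \<in> borel_measurable lborel"
  proof (rule half_line.borel_measurable_nn_integral)
    note [measurable] = F[unfolded case_prod_unfold]
    show "(\<lambda>(t, x). indicator {c<..} (ennreal (norm (F t x)))) \<in> borel_measurable (lborel \<Otimes>\<^sub>M half_line)"
      unfolding case_prod_unfold by measurable
  qed
  then show "{t \<in> space lborel. esssup half_line (\<lambda>x. ennreal (norm (F t x))) \<le> c} \<in> sets lborel"
    unfolding eq by measurable
qed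

lemma Lp_norm_measurable:
  fixes F :: "real \<Rightarrow> real \<Rightarrow> complex"
  assumes F: "(\<lambda>(t, x). F t x) \<in> borel_measurable (lborel \<Otimes>\<^sub>M half_line)"
  shows "(\<lambda>t. Lp_norm half_line r (F t)) \<in> borel_measurable lborel"
proof (cases "r = top")
  case True
  then show ?thesis using esssup_measurable[OF F] by (simp add: Lp_norm_def eLp_norm_def)
next
  case False
  have "(\<lambda>t. \<integral>\<^sup>+x. epowr (ennreal (norm (F t x))) (enn2real r) \<partial>half_line) \<in> borel_measurable lborel"
  proof (rule half_line.borel_measurable_nn_integral)
    note [measurable] = F[unfolded case_prod_unfold]
    show "(\<lambda>(t, x). epowr (ennreal (norm (F t x))) (enn2real r)) \<in> borel_measurable (lborel \<Otimes>\<^sub>M half_line)"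
      unfolding case_prod_unfold by measurable
  qed
  then show ?thesis using False unfolding Lp_norm_def eLp_norm_def by simp
qed

lemma finite_exponent_cases:
  fixes r :: ennreal
  assumes "1 \<le> r" "r \<noteq> top"
  obtains \<rho> where "1 \<le> \<rho>" "r = ennreal \<rho>" "enn2real r = \<rho>" "enn2real (1 / r) = 1 / \<rho>"
proof -
  define \<rho> where "\<rho> = enn2real r"
  have r: "r = ennreal \<rho>" using assms(2) by (simp add: \<rho>_def less_top)
  have 1: "1 \<le> \<rho>"
    using assms(1) unfolding r by (simp flip: ennreal_1 add: ennreal_le_iff2)
  have "1 / r = ennreal (1 / \<rho>)"
    unfolding r using 1 by (simp flip: ennreal_1 add: divide_ennreal)
  then have "enn2real (1 / r) = 1 / \<rho>" using 1 by simp
  then show thesis by (rule that[OF 1 r \<rho>_def[symmetric]])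
qed

text \<open>Pull \<open>S\<^bsup>r-2\<^esup>\<close> out of the integral of \<open>\<bar>f\<bar>\<^sup>r\<close>. The implication between \<open>S > 0\<close> and \<open>n > 0\<close> excludes
  a vanishing right-hand side caused by \<open>0 powr 0 = 0\<close>.\<close>

lemma Lp_norm_interpolation:
  assumes f: "square_integrable f" and r: "1 \<le> r" "enn2real (1 / r) \<le> 1 / 2"
    and S: "0 \<le> S" "AE x in half_line. norm (f x) \<le> S" and n: "mass f \<le> n\<^sup>2" "0 \<le> n" "S > 0 \<Longrightarrow> n > 0"
  defines "a \<equiv> 1 - 2 * enn2real (1 / r)"
  shows "Lp_norm half_line r f \<le> ennreal (S powr a * n powr (1 - a))"
proof -
  have fm[measurable]: "f \<in> borel_measurable half_line" using f by (simp add: square_integrable_def)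
  show ?thesis
  proof (cases "r = top")
    case True
    then have a: "a = 1" by (simp add: a_def)
    have "S powr a * n powr (1 - a) = S" using S n by (cases "S = 0") (auto simp: a)
    moreover have "Lp_norm half_line r f \<le> ennreal S"
      unfolding Lp_norm_def eLp_norm_def using True S(2)
      by (auto intro!: esssup_I elim!: eventually_mono simp: ennreal_leI)
    ultimately show ?thesis by simp
  next
    case False
    from finite_exponent_cases[OF r(1) False] obtain \<rho> where \<rho>: "1 \<le> \<rho>" "enn2real r = \<rho>" "enn2real (1 / r) = 1 / \<rho>" by metis
    have \<rho>2: "2 \<le> \<rho>" using r(2) \<rho> by (simp add: field_simps)
    have a: "a = (\<rho> - 2) / \<rho>" using \<rho> by (simp add: a_def field_simps)
    have fi: "integrable half_line (\<lambda>x. (norm (f x))\<^sup>2)" using f by (simp add: square_integrable_def)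
    have "(\<integral>\<^sup>+x. epowr (ennreal (norm (f x))) \<rho> \<partial>half_line) \<le> (\<integral>\<^sup>+x. ennreal (S powr (\<rho> - 2) * (norm (f x))\<^sup>2) \<partial>half_line)"
    proof (rule nn_integral_mono_AE)
      show "AE x in half_line. epowr (ennreal (norm (f x))) \<rho> \<le> ennreal (S powr (\<rho> - 2) * (norm (f x))\<^sup>2)"
        using S(2)
      proof eventually_elim
        case (elim x)
        have "norm (f x) powr \<rho> \<le> S powr (\<rho> - 2) * (norm (f x))\<^sup>2"
        proof (cases "f x = 0")
          case False
          have "norm (f x) powr \<rho> = norm (f x) powr (\<rho> - 2) * norm (f x) powr 2"
            using powr_add[of "norm (f x)" "\<rho> - 2" 2] by simp
          also have "\<dots> \<le> S powr (\<rho> - 2) * norm (f x) powr 2"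
            using elim \<rho>2 by (intro mult_right_mono powr_mono2) auto
          finally show ?thesis using False by (simp add: powr_numeral)
        qed simp
        then show ?case by (simp add: epowr_ennreal ennreal_leI)
      qed
    qed
    also have "\<dots> = ennreal (LINT x|half_line. S powr (\<rho> - 2) * (norm (f x))\<^sup>2)"
      using fi by (intro nn_integral_eq_integral) auto
    also have "(LINT x|half_line. S powr (\<rho> - 2) * (norm (f x))\<^sup>2) = S powr (\<rho> - 2) * mass f"
      by (simp add: mass_def)
    finally have "(\<integral>\<^sup>+x. epowr (ennreal (norm (f x))) \<rho> \<partial>half_line) \<le> ennreal (S powr (\<rho> - 2) * mass f)" .
    moreover have le: "S powr (\<rho> - 2) * mass f \<le> S powr (\<rho> - 2) * n\<^sup>2"
      by (rule mult_left_mono[OF n(1)]) simp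
    ultimately have "(\<integral>\<^sup>+x. epowr (ennreal (norm (f x))) \<rho> \<partial>half_line) \<le> ennreal (S powr (\<rho> - 2) * n\<^sup>2)"
      using ennreal_leI order_trans by blast
    then have "Lp_norm half_line r f \<le> epowr (ennreal (S powr (\<rho> - 2) * n\<^sup>2)) (1 / \<rho>)"
      unfolding Lp_norm_def eLp_norm_def using False \<rho> by (auto intro!: epowr_mono)
    also have "\<dots> = ennreal ((S powr (\<rho> - 2) * n powr 2) powr (1 / \<rho>))"
      using n(2) by (simp add: epowr_ennreal powr_numeral[symmetric] del: powr_numeral)
    also have "(S powr (\<rho> - 2) * n powr 2) powr (1 / \<rho>) = S powr a * n powr (1 - a)"
    proof -
      have "1 - a = 2 / \<rho>" using \<rho>(1) by (simp add: a field_simps)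
      then show ?thesis using \<rho>(1) by (simp add: powr_mult powr_powr a)
    qed
    finally show ?thesis .
  qed
qed

text \<open>Write \<open>a = 1 - 2/r\<close>. By interpolation the \<open>L\<^sup>r\<close> norm is at most \<open>S\<^sup>a N\<^bsup>(1-a)/2\<^esup>\<close>, so its
  \<open>q\<close>-th power contains \<open>S\<^bsup>a q\<^esup>\<close>. For finite \<open>q\<close> the hypothesis gives \<open>a q \<ge> 76/11 \<ge> 6\<close>: six factors are integrated in time,
  and the remaining \<open>a q - 6 = 2 e\<close> are estimated by the supremum. The powers of \<open>h\<close> add up to the exact
  scaling.\<close>

lemma mixed_norm_bound:
  fixes F :: "real \<Rightarrow> real \<Rightarrow> complex" and q r :: ennreal
  assumes q: "1 \<le> q" and r: "1 \<le> r"
    and qr: "enn2real (1 / q) \<le> (1/2 - (1/4 - 3/76)) * (1/2 - enn2real (1 / r))"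
    and K: "1 \<le> K" and M: "0 \<le> M" and h: "0 < h"
    and F: "(\<lambda>(t, x). F t x) \<in> borel_measurable (lborel \<Otimes>\<^sub>M half_line)"
    and sq: "\<And>t. square_integrable (F t)" and m: "\<And>t. mass (F t) \<le> K * M"
    and S: "\<And>t. 0 \<le> S t" "\<And>t. AE x in half_line. norm (F t x) \<le> S t" "\<And>t. (S t)\<^sup>2 \<le> K * M / h"
    and SH: "\<And>t. t \<in> {-1..1} \<Longrightarrow> S t ^ 6 \<le> H t" and Hm: "H \<in> borel_measurable lborel"
    and H: "(\<integral>\<^sup>+t. ennreal (H t) \<partial>lborel) \<le> ennreal (K * M ^ 3 / h\<^sup>2)"
  shows "ennreal (h powr ((1/2 - enn2real (1 / r)) - enn2real (1 / q))) *
      mixed_norm (restrict_space lborel {-1..1}) q half_line r F \<le> ennreal (sqrt K) * ennreal (sqrt M)"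
proof -
  define \<sigma> where "\<sigma> = enn2real (1 / q)"
  define a where "a = 1 - 2 * enn2real (1 / r)"
  have \<sigma>0: "0 \<le> \<sigma>" by (simp add: \<sigma>_def)
  have \<sigma>a: "\<sigma> \<le> 11/76 * a" using qr by (simp add: \<sigma>_def a_def field_simps)
  have a0: "0 \<le> a" using \<sigma>0 \<sigma>a by simp
  have a1: "a \<le> 1" by (simp add: a_def)
  define N where "N = K * M"
  have N0: "0 \<le> N" using K M by (simp add: N_def)
  have SN: "S t \<le> (N / h) powr (1/2)" for t
  proof -
    have "S t \<le> sqrt (N / h)" using S(3)[of t] by (simp add: N_def real_le_rsqrt)
    then show ?thesis using N0 h by (simp add: powr_half_sqrt)
  qed
  have pos: "0 < N powr (1/2)" if "S t > 0" for t
  proof -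
    have "0 < (S t)\<^sup>2" using that by simp
    then have "0 < N / h" using S(3)[of t] unfolding N_def by linarith
    then show ?thesis using h N0 by (simp add: zero_less_divide_iff)
  qed
  have L: "Lp_norm half_line r (F t) \<le> ennreal (S t powr a * (N powr (1/2)) powr (1 - a))" for t
    unfolding a_def
  proof (rule Lp_norm_interpolation[OF sq r _ S(1,2)])
    show "enn2real (1 / r) \<le> 1 / 2" using a0 by (simp add: a_def)
    show "mass (F t) \<le> (N powr (1/2))\<^sup>2" using m[of t] N0 by (simp add: N_def powr_half_sqrt)
  qed (use pos in auto)
  have Sa: "S t powr a \<le> (N / h) powr (a / 2)" for t
    using powr_mono2[OF a0 S(1) SN, of t] by (simp add: powr_powr)
  have cut: "(N / h) powr c = N powr c * h powr (- c)" for c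
    using N0 h by (simp add: powr_divide powr_minus field_simps)
  have main: "mixed_norm (restrict_space lborel {-1..1}) q half_line r F \<le> ennreal (N powr (1/2) * h powr (\<sigma> - a / 2))"
  proof (cases "q = top")
    case True
    then have \<sigma>: "\<sigma> = 0" by (simp add: \<sigma>_def)
    have "Lp_norm half_line r (F t) \<le> ennreal (N powr (1/2) * h powr (- (a / 2)))" for t
    proof -
      have "S t powr a * (N powr (1/2)) powr (1 - a) \<le> (N powr (a/2) * h powr (- (a/2))) * N powr ((1 - a) / 2)"
        using mult_right_mono[OF Sa[of t], of "(N powr (1/2)) powr (1 - a)"] by (simp add: cut powr_powr)
      also have "\<dots> = N powr (a / 2 + (1 - a) / 2) * h powr (- (a / 2))" by (simp add: powr_add)
      also have "a / 2 + (1 - a) / 2 = 1 / 2" by (simp add: field_simps)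
      finally show ?thesis using L[of t] ennreal_leI order_trans by blast
    qed
    then show ?thesis
      unfolding mixed_norm_def eLp_norm_def using True \<sigma> Lp_norm_measurable[OF F, of r]
      by (auto intro!: esssup_I measurable_restrict_space1)
  next
    case False
    from finite_exponent_cases[OF q False] obtain p where p: "1 \<le> p" "enn2real q = p" "enn2real (1 / q) = 1 / p" by metis
    have \<sigma>p: "\<sigma> = 1 / p" using p by (simp add: \<sigma>_def)
    have ap: "6 \<le> a * p"
    proof -
      have "1 \<le> 11/76 * a * p" using \<sigma>a p(1) by (simp add: \<sigma>p field_simps)
      then show ?thesis by simp
    qed
    define e where "e = (a * p - 6) / 2"
    have e0: "0 \<le> e" using ap by (simp add: e_def)
    define c where "c = (N / h) powr e * N powr ((1 - a) * p / 2)"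
    have c0: "0 \<le> c" by (simp add: c_def)
    have Sp: "(S t powr a * (N powr (1/2)) powr (1 - a)) powr p \<le> c * S t ^ 6" for t
    proof (cases "S t = 0")
      case True
      then show ?thesis by simp
    next
      case False
      then have St: "0 < S t" using S(1)[of t] by simp
      have "(S t powr a * (N powr (1/2)) powr (1 - a)) powr p = S t powr (a * p) * N powr ((1 - a) * p / 2)"
        by (simp add: powr_mult powr_powr)
      also have "S t powr (a * p) = S t powr (2 * e) * S t ^ 6"
      proof -
        have "a * p = 2 * e + 6" by (simp add: e_def field_simps)
        then show ?thesis using St by (simp add: powr_add powr_numeral)
      qed
      also have "S t powr (2 * e) \<le> ((N / h) powr (1/2)) powr (2 * e)"
        using e0 S(1) SN by (intro powr_mono2) auto
      also have "((N / h) powr (1/2)) powr (2 * e) = (N / h) powr e" by (simp add: powr_powr)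
      finally show ?thesis
        using St by (simp add: c_def mult_ac mult_left_mono mult_right_mono)
    qed
    define X where "X = N powr (1/2) * h powr (\<sigma> - a / 2)"
    have X0: "0 \<le> X" by (simp add: X_def)
    have "(\<integral>\<^sup>+t. epowr (Lp_norm half_line r (F t)) p \<partial>restrict_space lborel {-1..1}) =
        (\<integral>\<^sup>+t. epowr (Lp_norm half_line r (F t)) p * indicator {-1..1} t \<partial>lborel)"
      by (rule nn_integral_restrict_space) simp
    also have "\<dots> \<le> (\<integral>\<^sup>+t. ennreal c * ennreal (H t) \<partial>lborel)"
    proof (rule nn_integral_mono)
      fix t :: real
      show "epowr (Lp_norm half_line r (F t)) p * indicator {-1..1} t \<le> ennreal c * ennreal (H t)"
      proof (cases "t \<in> {-1..1}")
        case True
        have "epowr (Lp_norm half_line r (F t)) p \<le> epowr (ennreal (S t powr a * (N powr (1/2)) powr (1 - a))) p"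
          using p(1) by (intro epowr_mono L) simp
        also have "\<dots> \<le> ennreal (c * S t ^ 6)"
          using Sp[of t] by (simp add: epowr_ennreal ennreal_leI)
        also have "\<dots> \<le> ennreal (c * H t)"
          using SH[OF True] c0 by (intro ennreal_leI mult_left_mono)
        also have "\<dots> = ennreal c * ennreal (H t)"
          using c0 order_trans[OF _ SH[OF True]] S(1)[of t] by (intro ennreal_mult) auto
        finally show ?thesis using True by simp
      qed simp
    qed
    also have "\<dots> = ennreal c * (\<integral>\<^sup>+t. ennreal (H t) \<partial>lborel)"
      by (rule nn_integral_cmult, rule measurable_compose[OF Hm measurable_ennreal])
    also have "\<dots> \<le> ennreal c * ennreal (K * M ^ 3 / h\<^sup>2)" by (rule mult_left_mono[OF H]) simp
    also have "\<dots> = ennreal (c * (K * M ^ 3 / h\<^sup>2))"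
      using c0 K M by (intro ennreal_mult[symmetric]) auto
    also have "\<dots> \<le> ennreal (X powr p)"
    proof (rule ennreal_leI)
      have "K * M ^ 3 \<le> K ^ 3 * M ^ 3"
        using K M power_increasing[of 1 3 K] by (intro mult_right_mono) auto
      then have "K * M ^ 3 / h\<^sup>2 \<le> N ^ 3 / h\<^sup>2"
        by (intro divide_right_mono) (auto simp: N_def power_mult_distrib)
      also have "N ^ 3 / h\<^sup>2 = N powr 3 * h powr (-2)"
        using N0 h by (cases "N = 0") (auto simp: powr_minus powr_numeral divide_inverse)
      finally have "c * (K * M ^ 3 / h\<^sup>2) \<le> c * (N powr 3 * h powr (-2))"
        by (rule mult_left_mono[OF _ c0])
      also have "\<dots> = (N powr e * N powr ((1 - a) * p / 2) * N powr 3) * (h powr (- e) * h powr (-2))"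
        by (simp add: c_def cut mult_ac)
      also have "\<dots> = N powr (e + (1 - a) * p / 2 + 3) * h powr (- e + (-2))"
        by (simp only: powr_add)
      also have "e + (1 - a) * p / 2 + 3 = 1/2 * p" by (simp add: e_def field_simps)
      also have "- e + (-2) = (\<sigma> - a / 2) * p" using p(1) by (simp add: e_def \<sigma>p field_simps)
      also have "N powr (1/2 * p) * h powr ((\<sigma> - a / 2) * p) = X powr p"
        by (simp add: X_def powr_mult powr_powr)
      finally show "c * (K * M ^ 3 / h\<^sup>2) \<le> X powr p" .
    qed
    finally have "(\<integral>\<^sup>+t. epowr (Lp_norm half_line r (F t)) p \<partial>restrict_space lborel {-1..1}) \<le> ennreal (X powr p)" .
    then have "epowr (\<integral>\<^sup>+t. epowr (Lp_norm half_line r (F t)) p \<partial>restrict_space lborel {-1..1}) (1 / p)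
        \<le> epowr (ennreal (X powr p)) (1 / p)"
      using p(1) by (intro epowr_mono) auto
    also have "\<dots> = ennreal X" using p(1) X0 by (simp add: epowr_ennreal powr_powr)
    finally show ?thesis
      unfolding mixed_norm_def eLp_norm_def using False p(2) by (simp add: X_def)
  qed
  have "ennreal (h powr ((1/2 - enn2real (1 / r)) - enn2real (1 / q))) *
      mixed_norm (restrict_space lborel {-1..1}) q half_line r F
      \<le> ennreal (h powr (a / 2 - \<sigma>)) * ennreal (N powr (1/2) * h powr (\<sigma> - a / 2))"
    using mult_left_mono[OF main] by (simp add: a_def \<sigma>_def diff_divide_distrib)
  also have "\<dots> = ennreal (N powr (1/2) * (h powr (a / 2 - \<sigma>) * h powr (\<sigma> - a / 2)))"
    by (simp add: ennreal_mult[symmetric] mult_ac)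
  also have "h powr (a / 2 - \<sigma>) * h powr (\<sigma> - a / 2) = 1" using h by (simp flip: powr_add)
  also have "N powr (1/2) * 1 = sqrt K * sqrt M" using N0 by (simp add: powr_half_sqrt N_def real_sqrt_mult)
  also have "ennreal (sqrt K * sqrt M) = ennreal (sqrt K) * ennreal (sqrt M)"
    using K M by (simp add: ennreal_mult)
  finally show ?thesis .
qed


theorem theorem4:
  fixes q r :: ennreal and \<psi> :: "real \<Rightarrow> real" and \<beta> :: real
  assumes "1 \<le> q" and "1 \<le> r"
    and "enn2real (1 / q) \<le> (1/2 - (1/4 - 3/76)) * (1/2 - enn2real (1 / r))"
    and "\<beta> = (1/2 - enn2real (1 / r)) - enn2real (1 / q)"
    and "\<psi> \<in> Cc_infinity {1/2..3/2}" and "\<And>\<tau>. 0 \<le> \<psi> \<tau> \<and> \<psi> \<tau> \<le> 1"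
  shows "\<exists>C>0. \<exists>t0>0. \<forall>h v0 v.
    0 < h \<and> h < 1 \<and> v0 \<in> L2_functions half_line \<and> dirichlet_solution h v0 v \<longrightarrow>
    ennreal (h powr \<beta>) *
      mixed_norm (restrict_space lborel {-t0..t0}) q half_line r (time_cutoff \<psi> h v)
    \<le> ennreal C * Lp_norm half_line 2 v0"
proof (cases "\<forall>\<tau>. \<psi> \<tau> = 0")
  \<comment> \<open>Without a nonzero bump there are no test functions to work with, but then the cut-off annihilates
    everything.\<close>
  case True
  have cut: "time_cutoff \<psi> h v = (\<lambda>t x. 0)" for h v
    using True by (simp add: time_cutoff_def fourier_multiplier_def fun_eq_iff)
  have L: "Lp_norm half_line r (\<lambda>x. 0) = 0"
  proof (cases "r = top")
    case True
    have "esssup half_line (\<lambda>x. 0::ennreal) \<le> 0" by (rule esssup_I) auto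
    then show ?thesis using True by (simp add: Lp_norm_def eLp_norm_def)
  qed (simp add: Lp_norm_def eLp_norm_def epowr_def)
  have "mixed_norm (restrict_space lborel {-1..1::real}) q half_line r (\<lambda>t x. 0) = 0"
  proof (cases "q = top")
    case True
    have "esssup (restrict_space lborel {-1..1}) (\<lambda>t::real. 0::ennreal) \<le> 0" by (rule esssup_I) auto
    then show ?thesis using True by (simp add: mixed_norm_def eLp_norm_def L)
  qed (simp add: mixed_norm_def eLp_norm_def epowr_def L)
  then show ?thesis
    by (intro exI[of _ "1::real"] conjI) (simp_all add: cut)
next
  case False
  then obtain x0 where x0: "\<psi> x0 \<noteq> 0" by blast
  obtain \<theta> where \<theta>: "smooth_fun \<theta>" "\<And>x. 0 \<le> \<theta> x" "\<And>x. \<theta> x \<le> 1"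
      "\<And>x. x \<le> 0 \<Longrightarrow> \<theta> x = 0" "\<And>x. 1 \<le> x \<Longrightarrow> \<theta> x = 1"
    using smooth_step_exists[OF assms(5) _ x0] assms(6) by metis
  obtain K where K: "1 \<le> K" and est: "\<And>v h \<theta>. dirichlet_curve v h \<theta> \<Longrightarrow>
    (\<forall>t. square_integrable (time_cutoff \<psi> h v t) \<and> mass (time_cutoff \<psi> h v t) \<le> K * mass (v 0)) \<and>
    (\<lambda>(t, x). time_cutoff \<psi> h v t x) \<in> borel_measurable (lborel \<Otimes>\<^sub>M half_line) \<and>
    (\<exists>S H. (\<forall>t. 0 \<le> S t \<and> (AE x in half_line. norm (time_cutoff \<psi> h v t x) \<le> S t) \<and> (S t)\<^sup>2 \<le> K * mass (v 0) / h) \<and>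
      (\<forall>t\<in>{-1..1}. S t ^ 6 \<le> H t) \<and> H \<in> borel_measurable lborel \<and>
      (\<integral>\<^sup>+t. ennreal (H t) \<partial>lborel) \<le> ennreal (K * mass (v 0) ^ 3 / h\<^sup>2))"
    using cutoff_estimates[OF Cc_infinity_subset[OF assms(5)]] by blast
  show ?thesis
  proof (rule exI[of _ "sqrt K"], rule conjI[rotated], rule exI[of _ "1::real"], rule conjI[rotated], intro allI impI)
    fix h :: real and v0 v assume hyp: "0 < h \<and> h < 1 \<and> v0 \<in> L2_functions half_line \<and> dirichlet_solution h v0 v"
    then have h: "0 < h" and v0: "square_integrable v0" and sol: "dirichlet_solution h v0 v"
      by (auto simp: square_integrable_iff_L2)
    have DC: "dirichlet_curve v h \<theta>" by (rule dirichlet_curve_if_solution[OF sol h \<theta>])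
    have "mass v0 = mass (v 0)"
    proof (rule square_integrable_AE_cong(2))
      show "square_integrable (v 0)" "AE x in half_line. v 0 x = v0 x"
        using sol by (auto simp: dirichlet_solution_def square_integrable_iff_L2)
      show "v0 \<in> borel_measurable half_line" by (rule square_integrable_measurable[OF v0])
    qed
    then have N: "Lp_norm half_line 2 v0 = ennreal (sqrt (mass (v 0)))" by (simp add: Lp_norm_2[OF v0])
    from est[OF DC] obtain S H where
      1: "\<And>t. square_integrable (time_cutoff \<psi> h v t)" "\<And>t. mass (time_cutoff \<psi> h v t) \<le> K * mass (v 0)"
        "(\<lambda>(t, x). time_cutoff \<psi> h v t x) \<in> borel_measurable (lborel \<Otimes>\<^sub>M half_line)"
      and 2: "\<And>t. 0 \<le> S t" "\<And>t. AE x in half_line. norm (time_cutoff \<psi> h v t x) \<le> S t" "\<And>t. (S t)\<^sup>2 \<le> K * mass (v 0) / h"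
        "\<And>t. t \<in> {-1..1} \<Longrightarrow> S t ^ 6 \<le> H t" "H \<in> borel_measurable lborel"
        "(\<integral>\<^sup>+t. ennreal (H t) \<partial>lborel) \<le> ennreal (K * mass (v 0) ^ 3 / h\<^sup>2)"
      by blast
    show "ennreal (h powr \<beta>) * mixed_norm (restrict_space lborel {-1..1}) q half_line r (time_cutoff \<psi> h v)
        \<le> ennreal (sqrt K) * Lp_norm half_line 2 v0"
      unfolding N assms(4)
      by (rule mixed_norm_bound[OF assms(1-3) K mass_nonneg h 1(3,1,2) 2])
  qed (use K in auto)
qed

end
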